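(* Let $k$ be a fixed positive integer. The problem MSPD$_k$ can be solved in $2^{O(n/\log n)}$ time, where $n$ is the number of vertices of the input graph.
   Context: All graphs are finite, simple and undirected. A path decomposition of a graph $G=(V,E)$ is a sequence $(X_1,\ldots,X_s)$ of subsets of $V$ (bags) such that $\bigcup_i X_i=V$, every edge $\{v,w\}\in E$ has both endpoints in some $X_i$, and for every vertex $v$ the set $\{i : v\in X_i\}$ is an interval of integers. Its width is $\max_i |X_i|-1$ and its size is $s$. The problem MSPD$_k$ (Minimum Size Path Decomposition) is: given a graph $G$ with $n$ vertices and an integer $s$, decide whether $G$ has a path decomposition of width at most $k$ and size at most $s$. *)

theory Defs
  imports Complex_Main "HOL-Library.Landau_Symbols"
begin

definition simple_graph :: "'a set \<Rightarrow> 'a set set \<Rightarrow> bool" where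
  "simple_graph V E \<longleftrightarrow> finite V \<and> (\<forall>e\<in>E. e \<subseteq> V \<and> card e = 2)"

text \<open>The list is required to be nonempty, since the width is a maximum over the bags. The graph
  without vertices thus has the one-bag decomposition \<open>[{}]\<close> of width \<open>-1\<close>.\<close>

definition path_decomposition :: "'a set \<Rightarrow> 'a set set \<Rightarrow> 'a set list \<Rightarrow> bool" where
  "path_decomposition V E Xs \<longleftrightarrow>
     Xs \<noteq> [] \<and>
     \<Union>(set Xs) = V \<and>
     (\<forall>v w. {v, w} \<in> E \<longrightarrow> (\<exists>X\<in>set Xs. v \<in> X \<and> w \<in> X)) \<and>
     (\<forall>v\<in>V. \<exists>a b. {i. i < length Xs \<and> v \<in> Xs ! i} = {a..b})"

definition pd_width :: "'a set list \<Rightarrow> int" where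
  "pd_width Xs = int (Max (card ` set Xs)) - 1"

definition MSPD :: "nat \<Rightarrow> 'a set \<Rightarrow> 'a set set \<Rightarrow> int \<Rightarrow> bool" where
  "MSPD k V E s \<longleftrightarrow>
     (\<exists>Xs. path_decomposition V E Xs \<and> pd_width Xs \<le> int k \<and> int (length Xs) \<le> s)"

text \<open>Running time is measured on a deterministic random access machine with integer registers
  (of which a program can name only finitely many) and an integer-addressed memory, which is
  reached only through \<open>Load\<close> and \<open>Store\<close>. Every instruction costs one time unit. Addition and
  subtraction are the only arithmetic, so that a number grows by at most one bit per step;
  unit-cost multiplication, which would allow exponentially long numbers, is deliberately
  absent. Such a machine and a multitape Turing machine simulate each other with polynomial
  overhead, and bounds of the form \<open>2^O(n / log n)\<close> are insensitive to that overhead.\<close>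

datatype instr =
    Const nat int
  | Copy nat nat
  | Add nat nat nat
  | Sub nat nat nat
  | Load nat nat
  | Store nat nat
  | Jump nat
  | JumpPos nat nat

record config =
  pc :: nat
  reg :: "nat \<Rightarrow> int"
  mem :: "int \<Rightarrow> int"

fun exec :: "instr \<Rightarrow> config \<Rightarrow> config" where
  "exec (Const d c) \<sigma> = \<sigma>\<lparr>pc := pc \<sigma> + 1, reg := (reg \<sigma>)(d := c)\<rparr>"
| "exec (Copy d a) \<sigma> = \<sigma>\<lparr>pc := pc \<sigma> + 1, reg := (reg \<sigma>)(d := reg \<sigma> a)\<rparr>"
| "exec (Add d a b) \<sigma> = \<sigma>\<lparr>pc := pc \<sigma> + 1, reg := (reg \<sigma>)(d := reg \<sigma> a + reg \<sigma> b)\<rparr>"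
| "exec (Sub d a b) \<sigma> = \<sigma>\<lparr>pc := pc \<sigma> + 1, reg := (reg \<sigma>)(d := reg \<sigma> a - reg \<sigma> b)\<rparr>"
| "exec (Load d a) \<sigma> = \<sigma>\<lparr>pc := pc \<sigma> + 1, reg := (reg \<sigma>)(d := mem \<sigma> (reg \<sigma> a))\<rparr>"
| "exec (Store a b) \<sigma> = \<sigma>\<lparr>pc := pc \<sigma> + 1, mem := (mem \<sigma>)(reg \<sigma> a := reg \<sigma> b)\<rparr>"
| "exec (Jump l) \<sigma> = \<sigma>\<lparr>pc := l\<rparr>"
| "exec (JumpPos a l) \<sigma> = \<sigma>\<lparr>pc := (if reg \<sigma> a > 0 then l else pc \<sigma> + 1)\<rparr>"

definition halted :: "instr list \<Rightarrow> config \<Rightarrow> bool" where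
  "halted P \<sigma> \<longleftrightarrow> length P \<le> pc \<sigma>"

definition step :: "instr list \<Rightarrow> config \<Rightarrow> config" where
  "step P \<sigma> = (if halted P \<sigma> then \<sigma> else exec (P ! pc \<sigma>) \<sigma>)"

text \<open>The input graph has vertex set \<open>{0, \<dots>, n - 1}\<close> and is given by its adjacency matrix, stored
  row by row from address 0; \<open>n\<close> and \<open>s\<close> are in registers 0 and 1.\<close>

definition adj_matrix :: "nat \<Rightarrow> nat set set \<Rightarrow> int \<Rightarrow> int" where
  "adj_matrix n E a =
     (if \<exists>i<n. \<exists>j<n. a = int (i * n + j) \<and> {i, j} \<in> E then 1 else 0)"

definition input_config :: "nat \<Rightarrow> nat set set \<Rightarrow> int \<Rightarrow> config" where
  "input_config n E s =
     \<lparr>pc = 0, reg = (\<lambda>_. 0)(0 := int n, 1 := s), mem = adj_matrix n E\<rparr>"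

text \<open>\<open>Q\<close> is a decision problem on a graph and an integer, and \<open>T\<close> bounds the running time in
  terms of the number of vertices only. The answer is left in register 0. As \<^const>\<open>step\<close> leaves
  halted configurations unchanged, \<open>t\<close> is an upper bound on the number of executed instructions.\<close>

definition solves_in_time ::
  "instr list \<Rightarrow> (nat set \<Rightarrow> nat set set \<Rightarrow> int \<Rightarrow> bool) \<Rightarrow> (nat \<Rightarrow> real) \<Rightarrow> bool" where
  "solves_in_time P Q T \<longleftrightarrow>
     (\<forall>n E s. simple_graph {..<n} E \<longrightarrow>
        (\<exists>t \<sigma>. real t \<le> T n \<and> \<sigma> = (step P ^^ t) (input_config n E s) \<and> halted P \<sigma> \<and>
               reg \<sigma> 0 = (if Q {..<n} E s then 1 else 0)))"

end

theory Submission
  imports Defs "HOL-Library.FuncSet" "HOL-Real_Asymp.Real_Asymp"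
begin

text \<open>A path decomposition is swept from left to right. After each bag the state records which vertices
  are in the bag \<open>X\<close> and which are forgotten; the forgotten vertices form a union of components of \<open>G - X\<close>.
  States that differ by an automorphism of \<open>G\<close> fixing \<open>X\<close> are interchangeable, so it suffices to
  keep, among isomorphic components of size at most \<open>m = \<Theta>(log n)\<close>, those with the smallest vertices.
  There are at most \<open>n / m\<close> larger components. Since forgotten components have been swept by bags of size
  \<open>k + 1\<close>, each one is described by a word with one letter per vertex over an alphabet that depends only
  on \<open>k\<close>: the colour of the vertex, the colours of its earlier neighbours (in a colouring with \<open>k + 1\<close>
  colours that is injective on bags, a colour determines the most recent vertex that carries it), and its
  neighbours in \<open>X\<close>. Hence there are \<open>2^O(m)\<close> types of small components, at most
  \<open>\<surd>n\<close> up to a constant factor for a suitable \<open>m\<close>, and the number of states to keep is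
  \<open>n^O(1) * 2^(n/m) * (n + 1)^O(\<surd>n) = 2^O(n / log n)\<close>. The search over these states runs in time
  polynomial in their number.\<close>

subsection \<open>Programs for the random access machine\<close>

text \<open>Components, words and types occur only in the analysis. The program computes no
  component and tests no isomorphism: it tries all lists of m pairs of vertices and accepts those
  that act as an involutive automorphism and move only vertices outside the bag and not below the
  vertex v under treatment. There are n^(2*m) = 2^O(log^2 n) such lists, a negligible number.
  Accepting more exchanges than those of two components is harmless, since every automorphism
  carries sweeps to sweeps. The obstacle is the number of types. Describing edges by positions costs
  m * log m bits per component, and 2^(m * log m) exceeds every power of n already for m = Theta(log
  n); naming an earlier neighbour by one of k + 1 colours brings this down to O(m) bits. The
  threshold is the logarithm of n to base 2^(2*S), S being the alphabet size: S^m is then at most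
  the square root of n, while n / m is still O(n / log n). For the machine, every program construct
  gets one rule that bounds its time by a polynomial in a parameter B for all loop lengths. How
  large B has to be is decided only by the final count.\<close>

datatype val = Num int | Cell val val

text \<open>Cells carry no tags. Positive cell addresses make one positivity test enough for
  counters, truth values and nonempty lists, because the empty list and falsity are
  \<open>Num 0\<close>.\<close>

primrec rep :: "(int \<Rightarrow> int) \<Rightarrow> int \<Rightarrow> val \<Rightarrow> int \<Rightarrow> bool" where
  "rep m h (Num i) x \<longleftrightarrow> x = i"
| "rep m h (Cell a b) x \<longleftrightarrow> 0 < x \<and> x + 1 < h \<and> rep m h a (m x) \<and> rep m h b (m (x + 1))"

primrec vpos :: "val \<Rightarrow> bool" where
  "vpos (Num i) \<longleftrightarrow> 0 < i"
| "vpos (Cell a b) \<longleftrightarrow> True"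

text \<open>Frame property: data are immutable, so a value survives every run that writes only at or
  above the old heap pointer.\<close>

lemma rep_mono:
  "rep m h v x \<Longrightarrow> h \<le> h' \<Longrightarrow> (\<And>a. a < h \<Longrightarrow> m' a = m a) \<Longrightarrow> rep m' h' v x"
  by (induction v arbitrary: x) auto

lemma rep_vpos: "rep m h v x \<Longrightarrow> vpos v \<longleftrightarrow> 0 < x"
  by (cases v) auto

class enc =
  fixes enc :: "'a \<Rightarrow> val"

instantiation nat :: enc begin
definition enc_nat :: "nat \<Rightarrow> val" where "enc_nat i = Num (int i)"
instance ..
end

instantiation int :: enc begin
definition enc_int :: "int \<Rightarrow> val" where "enc_int i = Num i"
instance ..
end

instantiation bool :: enc begin
definition enc_bool :: "bool \<Rightarrow> val" where "enc_bool b = Num (if b then 1 else 0)"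
instance ..
end

instantiation prod :: (enc, enc) enc begin
definition enc_prod :: "'a \<times> 'b \<Rightarrow> val" where "enc_prod p = Cell (enc (fst p)) (enc (snd p))"
instance ..
end

instantiation list :: (enc) enc begin
primrec enc_list :: "'a list \<Rightarrow> val" where
  "enc_list [] = Num 0"
| "enc_list (x # xs) = Cell (enc x) (enc_list xs)"
instance ..
end

lemmas enc_simps = enc_nat_def enc_int_def enc_bool_def enc_prod_def

definition code_at :: "instr list \<Rightarrow> nat \<Rightarrow> instr list \<Rightarrow> bool" where
  "code_at P b c \<longleftrightarrow> (\<exists>p q. P = p @ c @ q \<and> length p = b)"

lemma code_at_append:
  "code_at P b (c @ c') \<longleftrightarrow> code_at P b c \<and> code_at P (b + length c) c'"
proof
  assume "code_at P b (c @ c')"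
  then obtain p q where "P = p @ (c @ c') @ q" "length p = b" by (auto simp: code_at_def)
  then have "P = p @ c @ (c' @ q)" "P = (p @ c) @ c' @ q" "length (p @ c) = b + length c" by auto
  then show "code_at P b c \<and> code_at P (b + length c) c'"
    using \<open>length p = b\<close> unfolding code_at_def by metis
next
  assume *: "code_at P b c \<and> code_at P (b + length c) c'"
  obtain p q where 1: "P = p @ c @ q" "length p = b" using * unfolding code_at_def by blast
  obtain p' q' where 2: "P = p' @ c' @ q'" "length p' = b + length c" using * unfolding code_at_def by blast
  have "p' = p @ c" using 1 2 by (metis append_assoc append_eq_append_conv length_append)
  then show "code_at P b (c @ c')" using 1 2 by (auto simp: code_at_def)
qed

lemma code_at_Cons:
  "code_at P b (i # c) \<longleftrightarrow> b < length P \<and> P ! b = i \<and> code_at P (Suc b) c"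
proof -
  have "code_at P b [i] \<longleftrightarrow> b < length P \<and> P ! b = i"
  proof
    assume "b < length P \<and> P ! b = i"
    then have "P = take b P @ [i] @ drop (Suc b) P" by (auto simp: id_take_nth_drop)
    then show "code_at P b [i]"
      using \<open>b < length P \<and> P ! b = i\<close> unfolding code_at_def
      by (metis length_take less_imp_le min.absorb2)
  qed (auto simp: code_at_def)
  then show ?thesis using code_at_append[of P b "[i]" c] by simp
qed

abbreviation conf :: "nat \<Rightarrow> (nat \<Rightarrow> int) \<Rightarrow> (int \<Rightarrow> int) \<Rightarrow> config" where
  "conf b R m \<equiv> \<lparr>pc = b, reg = R, mem = m\<rparr>"

definition reaches :: "instr list \<Rightarrow> config \<Rightarrow> nat \<Rightarrow> (config \<Rightarrow> bool) \<Rightarrow> bool" where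
  "reaches P \<sigma> T Q \<longleftrightarrow> (\<exists>t\<le>T. Q ((step P ^^ t) \<sigma>))"

lemma reaches_refl: "Q \<sigma> \<Longrightarrow> reaches P \<sigma> T Q"
  unfolding reaches_def by (rule exI[of _ 0]) auto

lemma reaches_trans:
  assumes "reaches P \<sigma> T Q" and "\<And>\<sigma>'. Q \<sigma>' \<Longrightarrow> reaches P \<sigma>' T' Q'" and "T + T' \<le> T''"
  shows "reaches P \<sigma> T'' Q'"
proof -
  obtain t where t: "t \<le> T" "Q ((step P ^^ t) \<sigma>)" using assms(1) by (auto simp: reaches_def)
  then obtain t' where "t' \<le> T'" "Q' ((step P ^^ t') ((step P ^^ t) \<sigma>))"
    using assms(2) by (auto simp: reaches_def)
  then show ?thesis
    using t assms(3) unfolding reaches_def by (intro exI[of _ "t' + t"]) (auto simp: funpow_add)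
qed

lemma reaches_step:
  assumes "b < length P" "P ! b = i" and "reaches P (exec i (conf b R m)) T Q"
  shows "reaches P (conf b R m) (Suc T) Q"
proof -
  obtain t where "t \<le> T" "Q ((step P ^^ t) (exec i (conf b R m)))"
    using assms(3) by (auto simp: reaches_def)
  then show ?thesis
    using assms(1,2) unfolding reaches_def
    by (intro exI[of _ "Suc t"]) (auto simp: funpow_Suc_right step_def halted_def simp del: funpow.simps)
qed

lemma exec_config:
  "exec (Const d c) (conf b R m) = conf (Suc b) (R(d := c)) m"
  "exec (Copy d a) (conf b R m) = conf (Suc b) (R(d := R a)) m"
  "exec (Add d a a') (conf b R m) = conf (Suc b) (R(d := R a + R a')) m"
  "exec (Sub d a a') (conf b R m) = conf (Suc b) (R(d := R a - R a')) m"
  "exec (Load d a) (conf b R m) = conf (Suc b) (R(d := m (R a))) m"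
  "exec (Store a a') (conf b R m) = conf (Suc b) R (m(R a := R a'))"
  "exec (Jump l) (conf b R m) = conf l R m"
  "exec (JumpPos a l) (conf b R m) = conf (if 0 < R a then l else Suc b) R m"
  by simp_all

declare exec.simps [simp del] exec_config [simp]

text \<open>A caller may keep live values in the registers strictly between 0 and \<open>r\<close>.
  The memory below the initial heap pointer is unchanged, so by \<open>rep_mono\<close> these values
  stay represented.\<close>

definition post :: "(nat \<Rightarrow> int) \<Rightarrow> (int \<Rightarrow> int) \<Rightarrow> nat \<Rightarrow> val \<Rightarrow> nat \<Rightarrow> config \<Rightarrow> bool" where
  "post R m r v b \<sigma> \<longleftrightarrow>
     pc \<sigma> = b \<and> R 0 \<le> reg \<sigma> 0 \<and> rep (mem \<sigma>) (reg \<sigma> 0) v (reg \<sigma> r) \<and>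
     (\<forall>q. 0 < q \<and> q < r \<longrightarrow> reg \<sigma> q = R q) \<and> (\<forall>a<R 0. mem \<sigma> a = m a)"

text \<open>Register 0 is the heap pointer, and cells are never overwritten. The code for \<open>f\<close> replaces the
  argument in register \<open>r\<close> by the result and uses the registers above \<open>r\<close> as scratch space.\<close>

definition implements ::
  "(nat \<Rightarrow> nat \<Rightarrow> instr list) \<Rightarrow> nat \<Rightarrow> (nat \<Rightarrow> nat) \<Rightarrow> (nat \<Rightarrow> 'a::enc \<Rightarrow> bool) \<Rightarrow> ('a \<Rightarrow> 'b::enc) \<Rightarrow> bool" where
  "implements c l \<tau> D f \<longleftrightarrow>
     (\<forall>r b. length (c r b) = l) \<and>
     (\<forall>B x r b P R m. D B x \<longrightarrow> 0 < r \<longrightarrow> code_at P b (c r b) \<longrightarrow> 0 < R 0 \<longrightarrow>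
        rep m (R 0) (enc x) (R r) \<longrightarrow>
        reaches P (conf b R m) (\<tau> B) (post R m r (enc (f x)) (b + l)))"

definition poly_bounded :: "(nat \<Rightarrow> nat) \<Rightarrow> bool" where
  "poly_bounded \<tau> \<longleftrightarrow> (\<exists>K d. \<forall>B. \<tau> B \<le> K * (B + 1) ^ d)"

lemma poly_bounded_const: "poly_bounded (\<lambda>B. c)"
  unfolding poly_bounded_def by (intro exI[of _ c] exI[of _ 0]) auto

lemma poly_bounded_id: "poly_bounded (\<lambda>B. B)"
  unfolding poly_bounded_def by (intro exI[of _ 1]) auto

lemma poly_bounded_Suc: "poly_bounded f \<Longrightarrow> poly_bounded (\<lambda>B. Suc (f B))"
proof -
  assume "poly_bounded f"
  then obtain K d where "\<And>B. f B \<le> K * (B + 1) ^ d" unfolding poly_bounded_def by blast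
  then have "Suc (f B) \<le> (K + 1) * (B + 1) ^ d" for B
    using one_le_power[of "B + 1" d] unfolding distrib_right by (smt (verit) Suc_eq_plus1 add_mono le_add2 nat_mult_1)
  then show ?thesis unfolding poly_bounded_def by blast
qed

lemma poly_bounded_add:
  assumes "poly_bounded f" "poly_bounded g" shows "poly_bounded (\<lambda>B. f B + g B)"
proof -
  obtain K d K' d' where *: "\<And>B. f B \<le> K * (B + 1) ^ d" "\<And>B. g B \<le> K' * (B + 1) ^ d'"
    using assms unfolding poly_bounded_def by blast
  have "f B + g B \<le> (K + K') * (B + 1) ^ (d + d')" for B
  proof -
    have "K * (B + 1) ^ d \<le> K * (B + 1) ^ (d + d')" "K' * (B + 1) ^ d' \<le> K' * (B + 1) ^ (d + d')"
      by (intro mult_left_mono power_increasing; simp)+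
    then show ?thesis using *[of B] unfolding distrib_right by linarith
  qed
  then show ?thesis unfolding poly_bounded_def by blast
qed

lemma poly_bounded_mult:
  assumes "poly_bounded f" "poly_bounded g" shows "poly_bounded (\<lambda>B. f B * g B)"
proof -
  obtain K d K' d' where *: "\<And>B. f B \<le> K * (B + 1) ^ d" "\<And>B. g B \<le> K' * (B + 1) ^ d'"
    using assms unfolding poly_bounded_def by blast
  have "f B * g B \<le> (K * K') * (B + 1) ^ (d + d')" for B
    using mult_mono[OF *(1)[of B] *(2)[of B]] by (simp add: algebra_simps power_add)
  then show ?thesis unfolding poly_bounded_def by blast
qed

lemmas poly_bounded_intros = poly_bounded_Suc poly_bounded_add poly_bounded_mult poly_bounded_const poly_bounded_id

text \<open>The parameter \<open>B\<close> of the domain \<open>D\<close> bounds the number of iterations of every loop, so that the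
  running time is polynomial in \<open>B\<close> with a degree depending only on the code.\<close>

definition ram :: "(nat \<Rightarrow> 'a::enc \<Rightarrow> bool) \<Rightarrow> ('a \<Rightarrow> 'b::enc) \<Rightarrow> bool" where
  "ram D f \<longleftrightarrow> (\<exists>c l \<tau>. poly_bounded \<tau> \<and> implements c l \<tau> D f)"

lemma implementsI:
  assumes "\<And>r b. length (c r b) = l"
    and "\<And>B x r b P R m. D B x \<Longrightarrow> 0 < r \<Longrightarrow> code_at P b (c r b) \<Longrightarrow> 0 < R 0 \<Longrightarrow>
        rep m (R 0) (enc x) (R r) \<Longrightarrow>
        reaches P (conf b R m) (\<tau> B) (post R m r (enc (f x)) (b + l))"
  shows "implements c l \<tau> D f"
  using assms unfolding implements_def by blast

lemma implementsD:
  assumes "implements c l \<tau> D f" and "D B x" "0 < r" "code_at P b (c r b)" "0 < R 0"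
    "rep m (R 0) (enc x) (R r)"
  shows "reaches P (conf b R m) (\<tau> B) (post R m r (enc (f x)) (b + l))"
  using assms unfolding implements_def by blast

lemma implements_length: "implements c l \<tau> D f \<Longrightarrow> length (c r b) = l"
  unfolding implements_def by blast

text \<open>Only the encodings of the results have to agree. Changes of type, such as from natural
  numbers to integers, therefore cost no code.\<close>

lemma ram_cong:
  assumes "ram D f" "\<And>B x. D' B x \<Longrightarrow> D B x" "\<And>B x. D' B x \<Longrightarrow> enc (g x) = enc (f x)"
  shows "ram D' g"
proof -
  obtain c l \<tau> where *: "poly_bounded \<tau>" "implements c l \<tau> D f" using assms(1) by (auto simp: ram_def)
  have "implements c l \<tau> D' g"
    by (rule implementsI)
      (use assms implementsD[OF *(2)] implements_length[OF *(2)] in auto)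
  then show ?thesis using * by (auto simp: ram_def)
qed

lemma ram_straight:
  assumes "\<And>r b. length (c r b) = l"
    and "\<And>B x r b P R m. D B x \<Longrightarrow> 0 < r \<Longrightarrow> code_at P b (c r b) \<Longrightarrow> 0 < R 0 \<Longrightarrow>
        rep m (R 0) (enc x) (R r) \<Longrightarrow>
        reaches P (conf b R m) T (post R m r (enc (f x)) (b + l))"
  shows "ram D f"
  unfolding ram_def
  by (intro exI[of _ c] exI[of _ l] exI[of _ "\<lambda>_. T"] conjI poly_bounded_const implementsI) (use assms in auto)

lemma ram_id: "ram D (\<lambda>x. x)"
  by (rule ram_straight[of "\<lambda>r b. []" 0 _ 0]) (auto intro!: reaches_refl simp: post_def)

lemma ram_num:
  assumes "\<And>B x. D B x \<Longrightarrow> enc (f x) = Num i" shows "ram D f"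
proof (rule ram_straight[of "\<lambda>r b. [Const r i]" 1 _ "Suc 0"])
  fix B x r b P and R :: "nat \<Rightarrow> int" and m
  assume "D B x" "0 < r" "code_at P b [Const r i]" "0 < R 0" "rep m (R 0) (enc x) (R r)"
  then show "reaches P (conf b R m) (Suc 0) (post R m r (enc (f x)) (b + 1))"
    unfolding code_at_Cons
    apply (elim conjE)
    apply (rule reaches_step, assumption, assumption)
    by (rule reaches_refl) (auto simp: post_def assms)
qed auto

text \<open>The hypothesis speaks of the encoding and not of a type, so that the same instruction
  serves \<open>fst\<close> and \<open>hd\<close>; likewise \<open>ram_cdr\<close> serves
  \<open>snd\<close> and \<open>tl\<close>.\<close>

lemma ram_car:
  assumes "\<And>B x. D B x \<Longrightarrow> \<exists>w. enc x = Cell (enc (f x)) w" shows "ram D f"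
proof (rule ram_straight[of "\<lambda>r b. [Load r r]" 1 _ "Suc 0"])
  fix B x r b P and R :: "nat \<Rightarrow> int" and m
  assume h: "D B x" "0 < r" "code_at P b [Load r r]" "0 < R 0" "rep m (R 0) (enc x) (R r)"
  obtain w where "enc x = Cell (enc (f x)) w" using assms h(1) by blast
  with h show "reaches P (conf b R m) (Suc 0) (post R m r (enc (f x)) (b + 1))"
    unfolding code_at_Cons
    apply (elim conjE)
    apply (rule reaches_step, assumption, assumption)
    by (rule reaches_refl) (auto simp: post_def)
qed auto

lemma ram_cdr:
  assumes "\<And>B x. D B x \<Longrightarrow> \<exists>w. enc x = Cell w (enc (f x))" shows "ram D f"
proof (rule ram_straight[of "\<lambda>r b. [Const (Suc r) 1, Add r r (Suc r), Load r r]" 3 _ "Suc (Suc (Suc 0))"])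
  fix B x r b P and R :: "nat \<Rightarrow> int" and m
  assume h: "D B x" "0 < r" "code_at P b [Const (Suc r) 1, Add r r (Suc r), Load r r]" "0 < R 0"
    "rep m (R 0) (enc x) (R r)"
  obtain w where "enc x = Cell w (enc (f x))" using assms h(1) by blast
  with h show "reaches P (conf b R m) (Suc (Suc (Suc 0)))
      (post R m r (enc (f x)) (b + 3))"
    unfolding code_at_Cons
    apply (elim conjE)
    apply (rule reaches_step, assumption, assumption, unfold exec_config)+
    by (rule reaches_refl) (auto simp: post_def)
qed auto

text \<open>Calling rule in continuation form: the rest of the run learns about the called code only
  what \<open>post\<close> guarantees.\<close>

lemma reaches_call:
  assumes "implements c l \<tau> D f" "code_at P b (c r b)" "D B x" "rep m (R 0) (enc x) (R r)" "0 < r" "0 < R 0"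
    and "\<And>R' m'. R 0 \<le> R' 0 \<Longrightarrow> rep m' (R' 0) (enc (f x)) (R' r) \<Longrightarrow>
           (\<And>q. 0 < q \<Longrightarrow> q < r \<Longrightarrow> R' q = R q) \<Longrightarrow> (\<And>a. a < R 0 \<Longrightarrow> m' a = m a) \<Longrightarrow>
           reaches P (conf (b + l) R' m') T Q"
  shows "reaches P (conf b R m) (\<tau> B + T) Q"
proof (rule reaches_trans[OF implementsD[OF assms(1,3,5,2,6,4)] _ order_refl])
  fix \<sigma> assume p: "post R m r (enc (f x)) (b + l) \<sigma>"
  then have "\<sigma> = conf (b + l) (reg \<sigma>) (mem \<sigma>)" by (simp add: post_def)
  moreover have "reaches P (conf (b + l) (reg \<sigma>) (mem \<sigma>)) T Q"
    by (rule assms(7)) (use p in \<open>auto simp: post_def\<close>)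
  ultimately show "reaches P \<sigma> T Q" by simp
qed

section \<open>Composition, pairs, conditionals and loops\<close>

lemma ram_comp:
  assumes "ram D' f" "ram D g" "\<And>B x. D B x \<Longrightarrow> D' B (g x)"
  shows "ram D (\<lambda>x. f (g x))"
proof -
  obtain c l \<tau> c' l' \<tau>' where *: "poly_bounded \<tau>" "implements c l \<tau> D' f" "poly_bounded \<tau>'" "implements c' l' \<tau>' D g"
    using assms(1,2) by (auto simp: ram_def)
  note [simp] = implements_length[OF *(2)] implements_length[OF *(4)]
  have "implements (\<lambda>r b. c' r b @ c r (b + l')) (l' + l) (\<lambda>B. \<tau>' B + (\<tau> B + 0)) D (\<lambda>x. f (g x))"
  proof (rule implementsI)
    fix B x r b P and R :: "nat \<Rightarrow> int" and m
    assume h: "D B x" "0 < r" "code_at P b (c' r b @ c r (b + l'))" "0 < R 0" "rep m (R 0) (enc x) (R r)"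
    then have code: "code_at P b (c' r b)" "code_at P (b + l') (c r (b + l'))" by (auto simp: code_at_append)
    show "reaches P (conf b R m) (\<tau>' B + (\<tau> B + 0)) (post R m r (enc (f (g x))) (b + (l' + l)))"
      apply (rule reaches_call[OF *(4) code(1) h(1,5,2,4)])
      apply (rule reaches_call[OF *(2) code(2) assms(3)[OF h(1)]], assumption, rule h(2), use h in linarith)
      by (rule reaches_refl) (auto simp: post_def)
  qed auto
  moreover have "poly_bounded (\<lambda>B. \<tau>' B + (\<tau> B + 0))" by (intro poly_bounded_intros *(1,3))
  ultimately show ?thesis unfolding ram_def by blast
qed

lemma ram_Pair:
  assumes "ram D f" "ram D g"
  shows "ram D (\<lambda>x. (f x, g x))"
proof -
  obtain c l \<tau> c' l' \<tau>' where *: "poly_bounded \<tau>" "implements c l \<tau> D f" "poly_bounded \<tau>'" "implements c' l' \<tau>' D g"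
    using assms(1,2) by (auto simp: ram_def)
  note [simp] = implements_length[OF *(2)] implements_length[OF *(4)]
  \<comment> \<open>Allocation of a cell: its address goes to \<open>r\<close>, and the heap pointer
    advances after each store. Register \<open>Suc r\<close> is free once its value has been stored
    and then holds the increment 1.\<close>
  let ?tail = "\<lambda>r. [Copy r 0, Store 0 (Suc r), Const (Suc r) 1, Add 0 0 (Suc r), Store 0 (Suc (Suc r)), Add 0 0 (Suc r)]"
  \<comment> \<open>The argument stays in \<open>r\<close> while the first component is computed in
    \<open>Suc r\<close>; the second is computed one register higher, where the code must preserve
    both.\<close>
  let ?c = "\<lambda>r b. Copy (Suc r) r # c (Suc r) (Suc b) @ Copy (Suc (Suc r)) r # c' (Suc (Suc r)) (Suc (Suc b + l)) @ ?tail r"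
  let ?\<tau> = "\<lambda>B. Suc (\<tau> B + Suc (\<tau>' B + Suc (Suc (Suc (Suc (Suc (Suc 0)))))))"
  have "implements ?c (l + l' + 8) ?\<tau> D (\<lambda>x. (f x, g x))"
  proof (rule implementsI)
    fix B x r b P and R :: "nat \<Rightarrow> int" and m
    assume h: "D B x" "0 < r" "code_at P b (?c r b)" "0 < R 0" "rep m (R 0) (enc x) (R r)"
    let ?post = "post R m r (enc (f x, g x)) (b + (l + l' + 8))"
    have r0: "r \<noteq> 0" using h by simp
    have code: "code_at P (Suc b) (c (Suc r) (Suc b))"
      "code_at P (Suc (Suc b + l)) (c' (Suc (Suc r)) (Suc (Suc b + l)))"
      "code_at P (Suc (Suc b + l) + l') (?tail r)"
      and b1: "b < length P" "P ! b = Copy (Suc r) r"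
      and b2: "Suc b + l < length P" "P ! (Suc b + l) = Copy (Suc (Suc r)) r"
      using h(3) unfolding code_at_append code_at_Cons implements_length[OF *(2)] implements_length[OF *(4)] by auto
    show "reaches P (conf b R m) (?\<tau> B) ?post"
      apply (rule reaches_step[OF b1], unfold exec_config)
    proof (rule reaches_call[OF *(2) code(1) h(1)], goal_cases)
      case (4 R1 m1)
      have r1: "R1 r = R r" using 4(3)[of r] r0 by simp
      have x1: "rep m1 (R1 0) (enc x) (R r)" using h 4 by (auto intro: rep_mono)
      show ?case
        apply (rule reaches_step[OF b2], unfold exec_config)
      proof (rule reaches_call[OF *(4) code(2) h(1)], goal_cases)
        case (4 R2 m2)
        note p1 = \<open>(R(Suc r := R r)) 0 \<le> R1 0\<close> \<open>rep m1 (R1 0) (enc (f x)) (R1 (Suc r))\<close>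
        let ?h = "R2 0"
        let ?m = "m2(?h := R2 (Suc r), ?h + 1 := R2 (Suc (Suc r)))"
        have bd: "R 0 \<le> R1 0" "R1 0 \<le> R2 0" using p1 4 by auto
        have f1: "R2 (Suc r) = R1 (Suc r)" using 4(3)[of "Suc r"] by simp
        have g1: "rep ?m (2 + ?h) (enc (f x)) (R2 (Suc r))"
          unfolding f1 by (rule rep_mono[OF p1(2)]) (use bd 4 in auto)
        have g2: "rep ?m (2 + ?h) (enc (g x)) (R2 (Suc (Suc r)))"
          by (rule rep_mono[OF 4(2)]) auto
        have g3: "R2 q = R q" if "0 < q" "q < r" for q
          using 4(3)[of q] \<open>\<And>q. 0 < q \<Longrightarrow> q < Suc r \<Longrightarrow> R1 q = (R(Suc r := R r)) q\<close>[of q] that by simp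
        have g4: "m2 a = m a" if "a < R 0" for a
          using 4(4)[of a] \<open>\<And>a. a < (R(Suc r := R r)) 0 \<Longrightarrow> m1 a = m a\<close>[of a] that bd by simp
        show ?case
          using code(3) unfolding code_at_Cons
          apply (elim conjE)
          apply (rule reaches_step, assumption, assumption, unfold exec_config)+
          apply (rule reaches_refl)
          using g1 g2 bd h(4) r0 g3 g4 by (simp add: post_def enc_prod_def)
      qed (use h x1 r1 4 in auto)
    qed (use h in auto)
  qed auto
  moreover have "poly_bounded ?\<tau>" by (intro poly_bounded_intros *(1,3))
  ultimately show ?thesis unfolding ram_def by blast
qed

lemma ram_fst: "ram D f \<Longrightarrow> ram D (\<lambda>x. fst (f x))"
  by (rule ram_comp[where D' = "\<lambda>_ _. True" and f = fst]) (auto intro: ram_car simp: enc_simps)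

lemma ram_snd: "ram D f \<Longrightarrow> ram D (\<lambda>x. snd (f x))"
  by (rule ram_comp[where D' = "\<lambda>_ _. True" and f = snd]) (auto intro: ram_cdr simp: enc_simps)

text \<open>\<open>I\<close> is the instruction and \<open>op\<close> its effect on integers.
  Stating the hypotheses for encodings lets one proof cover natural numbers and integers.\<close>

lemma ram_arith:
  assumes "ram D f" "ram D g"
    and "\<And>B x. D B x \<Longrightarrow> enc (f x) = Num (p x) \<and> enc (g x) = Num (q x) \<and> enc (h x) = Num (op (p x) (q x))"
    and op: "\<And>d a a' b R m. exec (I d a a') (conf b R m) = conf (Suc b) (R(d := op (R a) (R a'))) m"
  shows "ram D h"
proof -
  let ?c = "\<lambda>r b. [Const (Suc r) 1, Add (Suc r) r (Suc r), Load (Suc r) (Suc r), Load r r, I r r (Suc r)]"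
  have "ram (\<lambda>B x. True) (\<lambda>x :: int \<times> int. op (fst x) (snd x))"
  proof (rule ram_straight[of ?c 5 _ "Suc (Suc (Suc (Suc (Suc 0))))"])
    fix x :: "int \<times> int" and r b P and R :: "nat \<Rightarrow> int" and m
    assume "0 < r" "code_at P b (?c r b)" "0 < R 0" "rep m (R 0) (enc x) (R r)"
    then show "reaches P (conf b R m) (Suc (Suc (Suc (Suc (Suc 0))))) (post R m r (enc (op (fst x) (snd x))) (b + 5))"
      unfolding code_at_Cons
      apply (elim conjE)
      apply (rule reaches_step, assumption, assumption, unfold exec_config op)+
      by (rule reaches_refl) (simp add: post_def enc_simps add.commute)
  qed auto
  moreover have "ram D (\<lambda>x. (p x, q x))"
    by (rule ram_cong[OF ram_Pair[OF assms(1,2)]]) (use assms(3) in \<open>auto simp: enc_simps\<close>)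
  ultimately have "ram D (\<lambda>x. op (fst (p x, q x)) (snd (p x, q x)))"
    by (rule ram_comp) auto
  then show ?thesis by (rule ram_cong) (use assms(3) in \<open>auto simp: enc_simps\<close>)
qed

text \<open>The test is positivity of an encoded value, so differences of numbers can serve as
  conditions. Each branch is required to work only on its own part of the domain.\<close>

lemma ram_if_val:
  assumes "ram D g" "ram (\<lambda>B x. D B x \<and> p x) f" "ram (\<lambda>B x. D B x \<and> \<not> p x) f'"
    and "\<And>B x. D B x \<Longrightarrow> vpos (enc (g x)) = p x"
  shows "ram D (\<lambda>x. if p x then f x else f' x)"
proof -
  obtain cg lg \<tau>g where g: "poly_bounded \<tau>g" "implements cg lg \<tau>g D g"
    using assms(1) by (auto simp: ram_def)
  obtain c l \<tau> where f: "poly_bounded \<tau>" "implements c l \<tau> (\<lambda>B x. D B x \<and> p x) f"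
    using assms(2) by (auto simp: ram_def)
  obtain c' l' \<tau>' where f': "poly_bounded \<tau>'" "implements c' l' \<tau>' (\<lambda>B x. D B x \<and> \<not> p x) f'"
    using assms(3) by (auto simp: ram_def)
  note len = implements_length[OF g(2)] implements_length[OF f(2)] implements_length[OF f'(2)]
  let ?c = "\<lambda>r b. Copy (Suc r) r # cg (Suc r) (Suc b) @
     JumpPos (Suc r) (Suc (Suc (Suc b + lg) + l')) # c' r (Suc (Suc b + lg)) @
     Jump (Suc (Suc (Suc b + lg) + l') + l) # c r (Suc (Suc (Suc b + lg) + l'))"
  let ?\<tau> = "\<lambda>B. Suc (\<tau>g B + Suc (\<tau>' B + \<tau> B + Suc 0))"
  have "implements ?c (lg + l + l' + 3) ?\<tau> D (\<lambda>x. if p x then f x else f' x)"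
  proof (rule implementsI)
    fix B x r b P and R :: "nat \<Rightarrow> int" and m
    assume h: "D B x" "0 < r" "code_at P b (?c r b)" "0 < R 0" "rep m (R 0) (enc x) (R r)"
    let ?post = "post R m r (enc (if p x then f x else f' x)) (b + (lg + l + l' + 3))"
    have code: "code_at P (Suc b) (cg (Suc r) (Suc b))"
      "code_at P (Suc (Suc b + lg)) (c' r (Suc (Suc b + lg)))"
      "code_at P (Suc (Suc (Suc b + lg) + l')) (c r (Suc (Suc (Suc b + lg) + l')))"
      and b1: "b < length P" "P ! b = Copy (Suc r) r"
      and b2: "Suc b + lg < length P" "P ! (Suc b + lg) = JumpPos (Suc r) (Suc (Suc (Suc b + lg) + l'))"
      and b3: "Suc (Suc b + lg) + l' < length P" "P ! (Suc (Suc b + lg) + l') = Jump (Suc (Suc (Suc b + lg) + l') + l)"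
      using h(3) unfolding code_at_append code_at_Cons len by auto
    show "reaches P (conf b R m) (?\<tau> B) ?post"
      apply (rule reaches_step[OF b1], unfold exec_config)
    proof (rule reaches_call[OF g(2) code(1) h(1)], goal_cases)
      case (4 R1 m1)
      have x1: "rep m1 (R1 0) (enc x) (R1 r)" using h 4(1,4) 4(3)[of r] by (auto intro: rep_mono)
      have pos: "0 < R1 (Suc r) \<longleftrightarrow> p x" using rep_vpos[OF 4(2)] assms(4) h(1) by simp
      have bd: "R 0 \<le> R1 0" "0 < R1 0" using 4(1) h by auto
      have g3: "R1 q = R q" if "0 < q" "q < r" for q using 4(3)[of q] that by simp
      have g4: "m1 a = m a" if "a < R 0" for a using 4(4)[of a] that h(2) by simp
      show ?case
      proof (cases "p x")
        case True
        have "reaches P (conf (Suc (Suc (Suc b + lg) + l')) R1 m1) (\<tau> B + (\<tau>' B + Suc 0)) ?post"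
          apply (rule reaches_call[OF f(2) code(3) conjI[OF h(1) True] x1 h(2) bd(2)])
          apply (rule reaches_refl)
          using g3 g4 bd True by (auto simp: post_def)
        then show ?thesis using True pos by (intro reaches_step[OF b2]) (simp add: add_ac)
      next
        case False
        have "reaches P (conf (Suc (Suc b + lg)) R1 m1) (\<tau>' B + Suc (\<tau> B)) ?post"
          apply (rule reaches_call[OF f'(2) code(2) conjI[OF h(1) False] x1 h(2) bd(2)])
          apply (rule reaches_step[OF b3], unfold exec_config)
          apply (rule reaches_refl)
          using g3 g4 bd False by (auto simp: post_def)
        then show ?thesis using False pos by (intro reaches_step[OF b2]) (simp add: add_ac)
      qed
    qed (use h in auto)
  qed (auto simp: len)
  moreover have "poly_bounded ?\<tau>" by (intro poly_bounded_intros g(1) f(1) f'(1))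
  ultimately show ?thesis unfolding ram_def by blast
qed

text \<open>The loop is specified by its result \<open>h\<close>, which is constant along iterations
  and the identity on exit states, so no recursive function has to be defined. \<open>D\<close> is
  the invariant, and \<open>\<mu>\<close> bounds the number of iterations left.\<close>

lemma ram_while:
  assumes "ram D g" "ram (\<lambda>B x. D B x \<and> vpos (enc (g x))) f"
    and "\<And>B x. D B x \<Longrightarrow> vpos (enc (g x)) \<Longrightarrow> D B (f x) \<and> \<mu> (f x) < \<mu> x \<and> h x = h (f x)"
    and "\<And>B x. D B x \<Longrightarrow> \<mu> x \<le> B"
    and "\<And>B x. D B x \<Longrightarrow> \<not> vpos (enc (g x)) \<Longrightarrow> h x = x"
  shows "ram D h"
proof -
  obtain cg lg \<tau>g where g: "poly_bounded \<tau>g" "implements cg lg \<tau>g D g"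
    using assms(1) by (auto simp: ram_def)
  obtain c l \<tau> where f: "poly_bounded \<tau>" "implements c l \<tau> (\<lambda>B x. D B x \<and> vpos (enc (g x))) f"
    using assms(2) by (auto simp: ram_def)
  note len = implements_length[OF g(2)] implements_length[OF f(2)]
  let ?c = "\<lambda>r b. Copy (Suc r) r # cg (Suc r) (Suc b) @
     JumpPos (Suc r) (Suc (Suc (Suc b + lg))) # Jump (Suc (Suc (Suc (Suc b + lg)) + l)) #
     c r (Suc (Suc (Suc b + lg))) @ [Jump b]"
  let ?u = "\<lambda>B. \<tau>g B + \<tau> B + 3"
  have "implements ?c (lg + l + 4) (\<lambda>B. (B + 1) * ?u B) D h"
  proof (rule implementsI)
    fix B x r b P and R :: "nat \<Rightarrow> int" and m
    assume *: "D B x" "0 < r" "code_at P b (?c r b)" "0 < R 0" "rep m (R 0) (enc x) (R r)"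
    have code: "code_at P (Suc b) (cg (Suc r) (Suc b))"
      "code_at P (Suc (Suc (Suc b + lg))) (c r (Suc (Suc (Suc b + lg))))"
      and b1: "b < length P" "P ! b = Copy (Suc r) r"
      and b2: "Suc b + lg < length P" "P ! (Suc b + lg) = JumpPos (Suc r) (Suc (Suc (Suc b + lg)))"
      and b3: "Suc (Suc b + lg) < length P" "P ! (Suc (Suc b + lg)) = Jump (Suc (Suc (Suc (Suc b + lg)) + l))"
      and b4: "Suc (Suc (Suc b + lg)) + l < length P" "P ! (Suc (Suc (Suc b + lg)) + l) = Jump b"
      using *(3) unfolding code_at_append code_at_Cons len by auto
    \<comment> \<open>The summand 1 pays for the last evaluation of the guard. The 3 in
      \<open>?u\<close> counts the copy and the two jumps of a pass, on exit as well as on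
      repetition.\<close>
    have "reaches P (conf b R m) ((\<mu> x + 1) * ?u B) (post R m r (enc (h x)) (b + (lg + l + 4)))"
      using *(1,4,5)
    proof (induction "\<mu> x" arbitrary: x R m rule: less_induct)
      case less
      let ?post = "post R m r (enc (h x)) (b + (lg + l + 4))"
      have "reaches P (conf b R m) (Suc (\<tau>g B + Suc (\<tau> B + Suc (\<mu> x * ?u B)))) ?post"
        apply (rule reaches_step[OF b1], unfold exec_config)
      proof (rule reaches_call[OF g(2) code(1) less.prems(1)], goal_cases)
        case (4 R1 m1)
        have x1: "rep m1 (R1 0) (enc x) (R1 r)"
          using less.prems *(2) 4(1,4) 4(3)[of r] by (auto intro: rep_mono)
        have pos: "0 < R1 (Suc r) \<longleftrightarrow> vpos (enc (g x))" using rep_vpos[OF 4(2)] by simp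
        have bd: "R 0 \<le> R1 0" "0 < R1 0" using 4(1) less.prems by auto
        have g3: "R1 q = R q" if "0 < q" "q < r" for q using 4(3)[of q] that by simp
        have g4: "m1 a = m a" if "a < R 0" for a using 4(4)[of a] that *(2) by simp
        show ?case
        proof (cases "vpos (enc (g x))")
          case True
          note nxt = assms(3)[OF less.prems(1) True]
          have "reaches P (conf (Suc (Suc (Suc b + lg))) R1 m1) (\<tau> B + Suc (\<mu> x * ?u B)) ?post"
          proof (rule reaches_call[OF f(2) code(2) conjI[OF less.prems(1) True] x1 *(2) bd(2)],
              rule reaches_step[OF b4], unfold exec_config)
            fix R2 m2
            assume 5: "R1 0 \<le> R2 0" "rep m2 (R2 0) (enc (f x)) (R2 r)"
              "\<And>q. 0 < q \<Longrightarrow> q < r \<Longrightarrow> R2 q = R1 q" "\<And>a. a < R1 0 \<Longrightarrow> m2 a = m1 a"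
            have "0 < R2 0" using bd 5 by linarith
            then have R: "reaches P (conf b R2 m2) ((\<mu> (f x) + 1) * ?u B)
                (post R2 m2 r (enc (h (f x))) (b + (lg + l + 4)))"
              using less.hyps nxt 5(2) by blast
            show "reaches P (conf b R2 m2) (\<mu> x * ?u B) ?post"
            proof (rule reaches_trans[OF R, where T' = 0])
              show "(\<mu> (f x) + 1) * ?u B + 0 \<le> \<mu> x * ?u B"
                unfolding add_0_right by (rule mult_right_mono) (use nxt in auto)
              fix \<sigma> assume "post R2 m2 r (enc (h (f x))) (b + (lg + l + 4)) \<sigma>"
              then show "reaches P \<sigma> 0 ?post"
                using 5 bd g3 g4 nxt by (intro reaches_refl) (simp add: post_def)
            qed
          qed
          then show ?thesis using True pos by (intro reaches_step[OF b2]) (simp add: add_ac)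
        next
          case False
          have "reaches P (conf (Suc (Suc b + lg)) R1 m1) (Suc (\<tau> B + \<mu> x * ?u B)) ?post"
            apply (rule reaches_step[OF b3], unfold exec_config)
            apply (rule reaches_refl)
            using g3 g4 bd x1 assms(5)[OF less.prems(1) False] by (auto simp: post_def)
          then show ?thesis using False pos by (intro reaches_step[OF b2]) (simp add: add_ac)
        qed
      qed (use less.prems *(2) in auto)
      then show ?case
        by (rule reaches_trans[where T' = 0, OF _ reaches_refl]) simp_all
    qed
    then show "reaches P (conf b R m) ((B + 1) * ?u B) (post R m r (enc (h x)) (b + (lg + l + 4)))"
    proof (rule reaches_trans[where T' = 0, OF _ reaches_refl])
      show "(\<mu> x + 1) * ?u B + 0 \<le> (B + 1) * ?u B"
        unfolding add_0_right by (rule mult_right_mono) (use assms(4)[OF *(1)] in auto)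
    qed
  qed (auto simp: len)
  moreover have "poly_bounded (\<lambda>B. (B + 1) * ?u B)" by (intro poly_bounded_intros f(1) g(1))
  ultimately show ?thesis unfolding ram_def by blast
qed

section \<open>Numbers, comparisons and Boolean connectives\<close>

lemma ram_const_nat: "ram D (\<lambda>x. c :: nat)"
  by (rule ram_num) (auto simp: enc_simps)

lemma ram_const_int: "ram D (\<lambda>x. c :: int)"
  by (rule ram_num) (auto simp: enc_simps)

lemma ram_const_bool: "ram D (\<lambda>x. c :: bool)"
  by (rule ram_num) (auto simp: enc_simps)

lemma ram_Nil: "ram D (\<lambda>x. [])"
  by (rule ram_num) auto

lemma ram_Cons:
  "ram D f \<Longrightarrow> ram D g \<Longrightarrow> ram D (\<lambda>x. f x # g x)"
  by (drule (1) ram_Pair, erule ram_cong) (auto simp: enc_simps)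

lemmas ram_basic = ram_id ram_Pair ram_fst ram_snd ram_Nil ram_Cons

lemma ram_of_nat: "ram D f \<Longrightarrow> ram D (\<lambda>x. int (f x))"
  by (erule ram_cong) (auto simp: enc_simps)

lemma ram_nat:
  "ram D f \<Longrightarrow> (\<And>B x. D B x \<Longrightarrow> 0 \<le> f x) \<Longrightarrow> ram D (\<lambda>x. nat (f x))"
  by (erule ram_cong) (auto simp: enc_simps)

lemma ram_add_nat:
  "ram D f \<Longrightarrow> ram D g \<Longrightarrow> ram D (\<lambda>x. f x + g x :: nat)"
  by (erule (1) ram_arith[where op = "(+)" and I = Add and p = "\<lambda>x. int (f x)" and q = "\<lambda>x. int (g x)"]) (auto simp: enc_simps exec_config)

lemma ram_add_int:
  "ram D f \<Longrightarrow> ram D g \<Longrightarrow> ram D (\<lambda>x. f x + g x :: int)"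
  by (erule (1) ram_arith[where op = "(+)" and I = Add and p = "\<lambda>x. f x" and q = "\<lambda>x. g x"]) (auto simp: enc_simps exec_config)

lemma ram_diff_int:
  "ram D f \<Longrightarrow> ram D g \<Longrightarrow> ram D (\<lambda>x. f x - g x :: int)"
  by (erule (1) ram_arith[where op = "(-)" and I = Sub and p = "\<lambda>x. f x" and q = "\<lambda>x. g x"]) (auto simp: enc_simps exec_config)

lemma ram_if:
  assumes "ram D p" "ram (\<lambda>B x. D B x \<and> p x) f" "ram (\<lambda>B x. D B x \<and> \<not> p x) g"
  shows "ram D (\<lambda>x. if p x then f x else g x)"
  by (rule ram_if_val[OF assms]) (auto simp: enc_simps)

lemma ram_less_int:
  assumes "ram D f" "ram D g" shows "ram D (\<lambda>x. f x < (g x :: int))"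
proof -
  have "ram D (\<lambda>x. if f x < g x then True else False)"
    by (rule ram_if_val[OF ram_diff_int[OF assms(2,1)]])
      (auto simp: enc_simps intro: ram_const_bool)
  then show ?thesis by (rule ram_cong) auto
qed

lemma ram_less_nat:
  assumes "ram D f" "ram D g" shows "ram D (\<lambda>x. f x < (g x :: nat))"
  using ram_less_int[OF ram_of_nat ram_of_nat, OF assms] by simp

lemma ram_not:
  assumes "ram D p" shows "ram D (\<lambda>x. \<not> p x)"
  by (rule ram_cong[OF ram_if[OF assms ram_const_bool[where c = False] ram_const_bool[where c = True]]])
    auto

lemma ram_conj:
  assumes "ram D p" "ram (\<lambda>B x. D B x \<and> p x) q" shows "ram D (\<lambda>x. p x \<and> q x)"
proof -
  have "ram D (\<lambda>x. if p x then q x else False)"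
    by (intro ram_if assms ram_const_bool)
  then show ?thesis by (rule ram_cong) auto
qed

lemma ram_imp:
  assumes "ram D p" "ram (\<lambda>B x. D B x \<and> p x) q" shows "ram D (\<lambda>x. p x \<longrightarrow> q x)"
proof -
  have "ram D (\<lambda>x. if p x then q x else True)"
    by (intro ram_if assms ram_const_bool)
  then show ?thesis by (rule ram_cong) auto
qed

lemma ram_weaken: "ram D f \<Longrightarrow> (\<And>B x. D' B x \<Longrightarrow> D B x) \<Longrightarrow> ram D' f"
  by (erule ram_cong) auto

lemma ram_iff:
  assumes "ram D p" "ram D q" shows "ram D (\<lambda>x. p x \<longleftrightarrow> q x)"
proof -
  have "ram D (\<lambda>x. if p x then q x else \<not> q x)"
    using assms by (intro ram_if ram_not) (auto elim: ram_weaken)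
  then show ?thesis by (rule ram_cong) auto
qed

lemma ram_le_nat:
  assumes "ram D f" "ram D g" shows "ram D (\<lambda>x. f x \<le> (g x :: nat))"
  using ram_not[OF ram_less_nat[OF assms(2,1)]] by (simp add: not_less)

lemma ram_le_int:
  assumes "ram D f" "ram D g" shows "ram D (\<lambda>x. f x \<le> (g x :: int))"
  using ram_not[OF ram_less_int[OF assms(2,1)]] by (simp add: not_less)

lemma ram_eq_nat:
  assumes "ram D f" "ram D g" shows "ram D (\<lambda>x. f x = (g x :: nat))"
  unfolding eq_iff
  by (intro ram_conj ram_le_nat) (auto intro: assms ram_weaken[OF assms(1)] ram_weaken[OF assms(2)])

lemma ram_eq_int:
  assumes "ram D f" "ram D g" shows "ram D (\<lambda>x. f x = (g x :: int))"
  unfolding eq_iff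
  by (intro ram_conj ram_le_int) (auto intro: assms ram_weaken[OF assms(1)] ram_weaken[OF assms(2)])

section \<open>Lists and folds\<close>

lemma ram_hd:
  "ram D f \<Longrightarrow> (\<And>B x. D B x \<Longrightarrow> f x \<noteq> []) \<Longrightarrow> ram D (\<lambda>x. hd (f x))"
  by (rule ram_comp[where D' = "\<lambda>_ l. l \<noteq> []" and f = hd]) (auto intro: ram_car simp: neq_Nil_conv)

lemma ram_tl:
  "ram D f \<Longrightarrow> (\<And>B x. D B x \<Longrightarrow> f x \<noteq> []) \<Longrightarrow> ram D (\<lambda>x. tl (f x))"
  by (rule ram_comp[where D' = "\<lambda>_ l. l \<noteq> []" and f = tl]) (auto intro: ram_cdr simp: neq_Nil_conv)

lemma vpos_enc_list: "vpos (enc l) \<longleftrightarrow> l \<noteq> []" for l :: "'a::enc list"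
  by (cases l) auto

text \<open>The body has to run only on accumulators that really occur, namely folds over a prefix
  of the list. This admits accumulators whose size is bounded for a global reason, such as the
  levels of the search, and not by an induction over single steps.\<close>

lemma ram_fold_history:
  assumes xs: "ram D xs" and a0: "ram D a0"
    and len: "\<And>B x. D B x \<Longrightarrow> length (xs x) \<le> B"
    and F: "ram D' (\<lambda>p. F (fst p) (fst (snd p)) (snd (snd p)))"
    and D': "\<And>B x ys y zs. D B x \<Longrightarrow> xs x = ys @ y # zs \<Longrightarrow> D' B (x, y, fold (F x) ys (a0 x))"
  shows "ram D (\<lambda>x. fold (F x) (xs x) (a0 x))"
proof -
  \<comment> \<open>The loop state consists of the remaining list, the input and the accumulator;
    \<open>ys\<close> is the consumed prefix.\<close>
  define D0 where "D0 = (\<lambda>B (s :: 'b list \<times> 'a \<times> 'c). D B (fst (snd s)) \<and>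
    (\<exists>ys. xs (fst (snd s)) = ys @ fst s \<and> snd (snd s) = fold (F (fst (snd s))) ys (a0 (fst (snd s)))))"
  define h where "h = (\<lambda>s :: 'b list \<times> 'a \<times> 'c. ([] :: 'b list, fst (snd s), fold (F (fst (snd s))) (fst s) (snd (snd s))))"
  define f where "f = (\<lambda>s :: 'b list \<times> 'a \<times> 'c. (tl (fst s), fst (snd s), F (fst (snd s)) (hd (fst s)) (snd (snd s))))"
  have "ram D0 h"
  proof (rule ram_while[where g = fst and f = f and \<mu> = "\<lambda>s. length (fst s)"])
    show "ram D0 fst" by (intro ram_fst[of _ "\<lambda>x. x"] ram_id)
    have "ram (\<lambda>B s. D0 B s \<and> vpos (enc (fst s))) (\<lambda>s. F (fst (fst (snd s), hd (fst s), snd (snd s)))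
        (fst (snd (fst (snd s), hd (fst s), snd (snd s)))) (snd (snd (fst (snd s), hd (fst s), snd (snd s)))))"
    proof (rule ram_comp[OF F, where g = "\<lambda>s. (fst (snd s), hd (fst s), snd (snd s))"])
      show "ram (\<lambda>B s. D0 B s \<and> vpos (enc (fst s))) (\<lambda>s. (fst (snd s), hd (fst s), snd (snd s)))"
        by (intro ram_basic ram_hd) (auto simp: vpos_enc_list)
      fix B s assume s: "D0 B s \<and> vpos (enc (fst s))"
      then have "fst s = hd (fst s) # tl (fst s)" by (auto simp: vpos_enc_list)
      then show "D' B (fst (snd s), hd (fst s), snd (snd s))"
        using D'[of B "fst (snd s)" _ "hd (fst s)" "tl (fst s)"] s unfolding D0_def by auto
    qed
    then show "ram (\<lambda>B s. D0 B s \<and> vpos (enc (fst s))) f"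
      unfolding f_def by (intro ram_basic ram_tl)
        (auto simp: vpos_enc_list)
  next
    fix B s assume s: "D0 B s" "vpos (enc (fst s))"
    then obtain y zs where y: "fst s = y # zs" by (auto simp: vpos_enc_list neq_Nil_conv)
    obtain ys where "xs (fst (snd s)) = ys @ y # zs" "snd (snd s) = fold (F (fst (snd s))) ys (a0 (fst (snd s)))"
      "D B (fst (snd s))" using s y unfolding D0_def by auto
    then have "D0 B (f s)"
      using y unfolding D0_def f_def by (auto intro!: exI[of _ "ys @ [y]"])
    then show "D0 B (f s) \<and> length (fst (f s)) < length (fst s) \<and> h s = h (f s)"
      using y by (simp add: f_def h_def)
  next
    fix B and s :: "'b list \<times> 'a \<times> 'c" assume "D0 B s" then show "length (fst s) \<le> B"
      using len[of B "fst (snd s)"] unfolding D0_def by fastforce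
  next
    fix B and s :: "'b list \<times> 'a \<times> 'c" assume "\<not> vpos (enc (fst s))" then show "h s = s"
      by (cases s) (auto simp: h_def vpos_enc_list)
  qed
  moreover have "ram D (\<lambda>x. (xs x, x, a0 x))"
    by (intro ram_basic xs a0)
  ultimately have "ram D (\<lambda>x. h (xs x, x, a0 x))"
    by (rule ram_comp) (auto simp: D0_def)
  from ram_snd[OF ram_snd[OF this]] show ?thesis by (simp add: h_def)
qed

lemma ram_fold_inv:
  assumes "ram D xs" "ram D a0" "\<And>B x. D B x \<Longrightarrow> length (xs x) \<le> B"
    and "ram (\<lambda>B p. D B (fst p) \<and> fst (snd p) \<in> set (xs (fst p)) \<and> I B (fst p) (snd (snd p)))
           (\<lambda>p. F (fst p) (fst (snd p)) (snd (snd p)))"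
    and init: "\<And>B x. D B x \<Longrightarrow> I B x (a0 x)"
    and step: "\<And>B x y a. D B x \<Longrightarrow> y \<in> set (xs x) \<Longrightarrow> I B x a \<Longrightarrow> I B x (F x y a)"
  shows "ram D (\<lambda>x. fold (F x) (xs x) (a0 x))"
proof (rule ram_fold_history[OF assms(1-4)])
  fix B x ys y zs assume h: "D B x" "xs x = ys @ y # zs"
  have "I B x (fold (F x) ys a)" if "set ys \<subseteq> set (xs x)" "I B x a" for ys a
    using that by (induction ys arbitrary: a) (auto intro: step[OF h(1)])
  then show "D B (fst (x, y, fold (F x) ys (a0 x))) \<and>
       fst (snd (x, y, fold (F x) ys (a0 x))) \<in> set (xs (fst (x, y, fold (F x) ys (a0 x)))) \<and>
       I B (fst (x, y, fold (F x) ys (a0 x))) (snd (snd (x, y, fold (F x) ys (a0 x))))"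
    using h init[OF h(1)] by auto
qed

lemma ram_fold:
  assumes "ram D xs" "ram D a0" "\<And>B x. D B x \<Longrightarrow> length (xs x) \<le> B"
    and "ram (\<lambda>B p. D B (fst p) \<and> fst (snd p) \<in> set (xs (fst p))) (\<lambda>p. F (fst p) (fst (snd p)) (snd (snd p)))"
  shows "ram D (\<lambda>x. fold (F x) (xs x) (a0 x))"
  using ram_fold_inv[OF assms(1-3), where I = "\<lambda>_ _ _. True"] assms(4) by simp

lemma ram_rev:
  assumes "ram D xs" "\<And>B x. D B x \<Longrightarrow> length (xs x) \<le> B"
  shows "ram D (\<lambda>x. rev (xs x))"
proof -
  have "ram D (\<lambda>x. fold (\<lambda>y a. y # a) (xs x) [])"
    by (intro ram_fold assms ram_basic)
  moreover have "fold (\<lambda>y a. y # a) l a = rev l @ a" for l and a :: "'b list" by (induction l arbitrary: a) auto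
  ultimately show ?thesis by simp
qed

lemma ram_foldr:
  assumes "ram D xs" "ram D a0" "\<And>B x. D B x \<Longrightarrow> length (xs x) \<le> B"
    and "ram (\<lambda>B p. D B (fst p) \<and> fst (snd p) \<in> set (xs (fst p))) (\<lambda>p. F (fst p) (fst (snd p)) (snd (snd p)))"
  shows "ram D (\<lambda>x. foldr (F x) (xs x) (a0 x))"
  unfolding foldr_conv_fold
  by (rule ram_fold) (use assms ram_rev[OF assms(1,3)] in auto)

text \<open>Adapter for \<open>map\<close>, \<open>filter\<close> and the quantifiers, whose bodies
  look only at the list entry.\<close>

lemma ram_skip_accumulator:
  assumes "ram (\<lambda>B p. D B (fst p) \<and> snd p \<in> X (fst p)) (\<lambda>p. f (fst p) (snd p))"
  shows "ram (\<lambda>B p. D B (fst p) \<and> fst (snd p) \<in> X (fst p)) (\<lambda>p. f (fst p) (fst (snd p)))"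
  by (rule ram_comp[OF assms, where g = "\<lambda>p. (fst p, fst (snd p))", simplified])
    (auto intro!: ram_basic)

lemma ram_map:
  assumes "ram D xs" "\<And>B x. D B x \<Longrightarrow> length (xs x) \<le> B"
    and "ram (\<lambda>B p. D B (fst p) \<and> snd p \<in> set (xs (fst p))) (\<lambda>p. f (fst p) (snd p))"
  shows "ram D (\<lambda>x. map (f x) (xs x))"
proof -
  have "ram D (\<lambda>x. foldr (\<lambda>y a. f x y # a) (xs x) [])"
    by (intro ram_foldr assms(1,2) ram_Nil ram_Cons ram_snd ram_id ram_skip_accumulator[OF assms(3)])
  moreover have "foldr (\<lambda>y a. g y # a) l [] = map g l" for g :: "'b \<Rightarrow> 'c" and l by (induction l) auto
  ultimately show ?thesis by simp
qed

lemma ram_filter: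
  assumes "ram D xs" "\<And>B x. D B x \<Longrightarrow> length (xs x) \<le> B"
    and "ram (\<lambda>B p. D B (fst p) \<and> snd p \<in> set (xs (fst p))) (\<lambda>p. f (fst p) (snd p))"
  shows "ram D (\<lambda>x. filter (f x) (xs x))"
proof -
  have "ram D (\<lambda>x. foldr (\<lambda>y a. if f x y then y # a else a) (xs x) [])"
    by (intro ram_foldr assms(1,2) ram_Nil ram_Cons ram_snd ram_fst ram_id ram_if ram_skip_accumulator[OF assms(3)])
  moreover have "foldr (\<lambda>y a. if g y then y # a else a) l [] = filter g l" for g :: "'b \<Rightarrow> bool" and l by (induction l) auto
  ultimately show ?thesis by simp
qed

lemma ram_all:
  assumes "ram D xs" "\<And>B x. D B x \<Longrightarrow> length (xs x) \<le> B"
    and "ram (\<lambda>B p. D B (fst p) \<and> snd p \<in> set (xs (fst p))) (\<lambda>p. f (fst p) (snd p))"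
  shows "ram D (\<lambda>x. \<forall>y\<in>set (xs x). f x y)"
proof -
  have "ram D (\<lambda>x. foldr (\<lambda>y a. if f x y then a else False) (xs x) True)"
    by (intro ram_foldr assms(1,2) ram_const_bool ram_snd ram_fst ram_id ram_if ram_skip_accumulator[OF assms(3)])
  moreover have "foldr (\<lambda>y a. if g y then a else False) l True = (\<forall>y\<in>set l. g y)" for g :: "'b \<Rightarrow> bool" and l by (induction l) auto
  ultimately show ?thesis by simp
qed

lemma ram_ex:
  assumes "ram D xs" "\<And>B x. D B x \<Longrightarrow> length (xs x) \<le> B"
    and "ram (\<lambda>B p. D B (fst p) \<and> snd p \<in> set (xs (fst p))) (\<lambda>p. f (fst p) (snd p))"
  shows "ram D (\<lambda>x. \<exists>y\<in>set (xs x). f x y)"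
  using ram_not[OF ram_all[OF assms(1,2) ram_not[OF assms(3)]]] by simp

lemma ram_append:
  assumes "ram D xs" "ram D ys" "\<And>B x. D B x \<Longrightarrow> length (xs x) \<le> B"
  shows "ram D (\<lambda>x. xs x @ ys x)"
proof -
  have "ram D (\<lambda>x. foldr (\<lambda>y a. y # a) (xs x) (ys x))"
    by (intro ram_foldr assms ram_basic)
  moreover have "foldr (\<lambda>y a. y # a) l l' = l @ l'" for l l' :: "'b list" by (induction l) auto
  ultimately show ?thesis by simp
qed

lemma ram_concat:
  assumes "ram D xs" "\<And>B x. D B x \<Longrightarrow> length (xs x) \<le> B \<and> (\<forall>l\<in>set (xs x). length l \<le> B)"
  shows "ram D (\<lambda>x. concat (xs x))"
proof -
  have "ram D (\<lambda>x. foldr (\<lambda>y a. y @ a) (xs x) [])"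
    by (intro ram_foldr assms(1) ram_append ram_Nil ram_fst ram_snd ram_id)
      (use assms(2) in auto)
  then show ?thesis by (simp add: concat_conv_foldr)
qed

text \<open>Counting down makes consing produce the increasing list, and the counter itself serves
  as the guard.\<close>

lemma ram_upt:
  assumes "ram D k" "\<And>B x. D B x \<Longrightarrow> k x \<le> B"
  shows "ram D (\<lambda>x. [0..<k x])"
proof -
  define D0 where "D0 = (\<lambda>B (s :: int \<times> nat list). 0 \<le> fst s \<and> nat (fst s) \<le> B)"
  define h where "h = (\<lambda>s :: int \<times> nat list. (0 :: int, [0..<nat (fst s)] @ snd s))"
  have "ram D0 h"
  proof (rule ram_while[where g = fst and f = "\<lambda>s. (fst s - 1, nat (fst s - 1) # snd s)" and \<mu> = "\<lambda>s. nat (fst s)"])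
    show "ram D0 fst" by (intro ram_fst[of _ "\<lambda>x. x"] ram_id)
    show "ram (\<lambda>B x. D0 B x \<and> vpos (enc (fst x))) (\<lambda>s. (fst s - 1, nat (fst s - 1) # snd s))"
      by (intro ram_basic ram_nat ram_diff_int ram_const_int) (auto simp: enc_simps)
    fix B s assume s: "D0 B s" "vpos (enc (fst s))"
    then have "fst s = int (Suc (nat (fst s) - 1))" by (simp add: enc_simps)
    then obtain i where i: "fst s = int (Suc i)" by blast
    show "D0 B (fst s - 1, nat (fst s - 1) # snd s) \<and>
           nat (fst (fst s - 1, nat (fst s - 1) # snd s)) < nat (fst s) \<and> h s = h (fst s - 1, nat (fst s - 1) # snd s)"
      using s i by (simp add: D0_def h_def nat_add_distrib)
  qed (auto simp: D0_def h_def enc_simps)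
  moreover have "ram D (\<lambda>x. (int (k x), [] :: nat list))"
    by (intro ram_Pair ram_of_nat assms(1) ram_Nil)
  ultimately have "ram D (\<lambda>x. h (int (k x), []))"
    by (rule ram_comp) (use assms(2) in \<open>auto simp: D0_def\<close>)
  from ram_snd[OF this] show ?thesis by (simp add: h_def)
qed

text \<open>The machine has no multiplication. The first factor counts the additions, and therefore
  it is the one that needs a bound.\<close>

lemma ram_mult:
  assumes "ram D f" "ram D g" "\<And>B x. D B x \<Longrightarrow> f x \<le> B"
  shows "ram D (\<lambda>x. f x * g x :: nat)"
proof -
  have "ram D (\<lambda>x. fold (\<lambda>_ a. a + g x) [0..<f x] 0)"
  proof (intro ram_fold ram_upt assms(1) ram_const_nat ram_add_nat ram_snd ram_id)
    show "ram (\<lambda>B p. D B (fst p) \<and> fst (snd p) \<in> set [0..<f (fst p)]) (\<lambda>x :: 'a \<times> nat \<times> nat. g (fst x))"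
      by (rule ram_comp[OF assms(2)]) (auto intro: ram_basic)
  qed (use assms(3) in auto)
  moreover have "fold (\<lambda>_ a. a + c) [0..<l] 0 = l * c" for l c :: nat by (induction l) auto
  ultimately show ?thesis by simp
qed

subsection \<open>The search\<close>

text \<open>A fold with a countdown, with default 0 beyond the end. The counter is an integer so
  that it becomes negative after the hit; a natural number would stay at 0 and match all later
  entries.\<close>

definition lookup :: "nat list \<Rightarrow> nat \<Rightarrow> nat" where
  "lookup xs i = snd (fold (\<lambda>y a. (fst a - 1, if fst a = 0 then y else snd a)) xs (int i, 0))"

definition has_edge :: "nat \<Rightarrow> nat list \<Rightarrow> nat \<Rightarrow> nat \<Rightarrow> bool" where
  "has_edge n A u v \<longleftrightarrow> 0 < lookup A (u * n + v)"

text \<open>The first pair that contains \<open>v\<close> decides. For disjoint transpositions this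
  is their product, and repeating a pair has no effect, so lists can be padded.\<close>

definition apply_swaps :: "(nat \<times> nat) list \<Rightarrow> nat \<Rightarrow> nat" where
  "apply_swaps ps v = foldr (\<lambda>p a. if v = fst p then snd p else if v = snd p then fst p else a) ps v"

text \<open>An arbitrary list of pairs need not act as a permutation:
  \<open>[(0, 1), (0, 2)]\<close> sends both 1 and 2 to 0. Hence the explicit test for an
  involution.\<close>

definition is_symmetry :: "nat \<Rightarrow> nat list \<Rightarrow> (nat \<times> nat) list \<Rightarrow> bool" where
  "is_symmetry n A ps \<longleftrightarrow>
     (\<forall>u\<in>set [0..<n]. apply_swaps ps u < n \<and> apply_swaps ps (apply_swaps ps u) = u \<and>
        (\<forall>w\<in>set [0..<n]. has_edge n A u w = has_edge n A (apply_swaps ps u) (apply_swaps ps w)))"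

text \<open>The condition that only vertices from \<open>v\<close> on are moved protects what has
  been achieved for smaller vertices. Fixing the bag keeps the current bag of the state.\<close>

definition improves :: "nat \<Rightarrow> nat list \<Rightarrow> nat list \<Rightarrow> nat \<Rightarrow> (nat \<times> nat) list \<Rightarrow> bool" where
  "improves n A \<sigma> v ps \<longleftrightarrow> is_symmetry n A ps \<and>
     (\<forall>u\<in>set [0..<n]. apply_swaps ps u \<noteq> u \<longrightarrow> lookup \<sigma> u \<noteq> 1 \<and> v \<le> u) \<and>
     lookup \<sigma> v = 0 \<and> lookup \<sigma> (apply_swaps ps v) = 2"

definition permute :: "nat \<Rightarrow> nat list \<Rightarrow> (nat \<times> nat) list \<Rightarrow> nat list" where
  "permute n \<sigma> ps = map (\<lambda>u. lookup \<sigma> (apply_swaps ps u)) [0..<n]"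

text \<open>The vertices are treated in increasing order. After an accepted exchange
  \<open>v\<close> has label 2, so that the remaining lists are refused for this
  \<open>v\<close>.\<close>

definition canonize :: "nat \<Rightarrow> nat list \<Rightarrow> (nat \<times> nat) list list \<Rightarrow> nat list \<Rightarrow> nat list" where
  "canonize n A PL \<sigma> =
     fold (\<lambda>v \<sigma>. fold (\<lambda>ps \<sigma>. if improves n A \<sigma> v ps then permute n \<sigma> ps else \<sigma>) PL \<sigma>) [0..<n] \<sigma>"

text \<open>Forgotten vertices that are listed in \<open>bs\<close> are ignored, and so every
  \<open>bs\<close> yields a legal change of labels; only the edges remain to be tested.\<close>

definition advance :: "nat \<Rightarrow> nat list \<Rightarrow> nat list \<Rightarrow> nat list" where
  "advance n \<sigma> bs = map (\<lambda>v. if lookup \<sigma> v = 2 then 2 else if \<exists>b\<in>set bs. b = v then 1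
     else if lookup \<sigma> v = 1 then 2 else 0) [0..<n]"

text \<open>The label of \<open>v\<close> before the step matters: a neighbour introduced in the
  very bag that drops \<open>u\<close> would share no bag with \<open>u\<close>.\<close>

definition admissible :: "nat \<Rightarrow> nat list \<Rightarrow> nat list \<Rightarrow> nat list \<Rightarrow> bool" where
  "admissible n A \<sigma> \<tau> \<longleftrightarrow> (\<forall>u\<in>set [0..<n]. \<forall>v\<in>set [0..<n].
     has_edge n A u v \<longrightarrow> lookup \<tau> u = 2 \<longrightarrow> lookup \<sigma> v \<noteq> 0)"

definition dedup :: "nat \<Rightarrow> nat list list \<Rightarrow> nat list list" where
  "dedup n xs = fold (\<lambda>x a. if \<exists>y\<in>set a. \<forall>v\<in>set [0..<n]. lookup y v = lookup x v then a else x # a) xs []"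

definition next_level ::
  "nat \<Rightarrow> nat list \<Rightarrow> (nat \<times> nat) list list \<Rightarrow> nat list list \<Rightarrow> nat list list \<Rightarrow> nat list list" where
  "next_level n A PL BL T = dedup n (concat (map (\<lambda>\<sigma>. map (\<lambda>bs. canonize n A PL (advance n \<sigma> bs))
     (filter (\<lambda>bs. admissible n A \<sigma> (advance n \<sigma> bs)) BL)) T))"

text \<open>Level \<open>i\<close> is to hold, up to automorphisms of the graph, all states
  reachable with \<open>i\<close> bags. The search starts from the state before the first
  bag.\<close>

definition level ::
  "nat \<Rightarrow> nat list \<Rightarrow> (nat \<times> nat) list list \<Rightarrow> nat list list \<Rightarrow> nat \<Rightarrow> nat list list" where
  "level n A PL BL i = fold (\<lambda>_ T. next_level n A PL BL T) [0..<i] [map (\<lambda>_. 0) [0..<n]]"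

text \<open>For \<open>2 <= q\<close> and \<open>0 < n\<close> this is the integer part of the
  logarithm of \<open>n\<close> to base \<open>q\<close>. Exponents below \<open>n\<close> suffice
  because \<open>j < q ^ j\<close>.\<close>

definition threshold :: "nat \<Rightarrow> nat \<Rightarrow> nat" where
  "threshold q n = fold (\<lambda>j a. if q ^ j \<le> n then j else a) [0..<n] 0"

definition swap_lists :: "nat \<Rightarrow> nat \<Rightarrow> (nat \<times> nat) list list" where
  "swap_lists q n = List.n_lists (threshold q n) (concat (map (\<lambda>u. map (\<lambda>v. (u, v)) [0..<n]) [0..<n]))"

text \<open>A bag is a list of exactly \<open>Suc k\<close> entries; the value \<open>n\<close>,
  which is no vertex, is a blank that allows smaller bags.\<close>

definition bag_lists :: "nat \<Rightarrow> nat \<Rightarrow> nat list list" where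
  "bag_lists k n = List.n_lists (Suc k) [0..<Suc n]"

definition decide :: "nat \<Rightarrow> nat \<Rightarrow> nat \<times> int \<times> nat list \<Rightarrow> nat" where
  "decide k q x = (let n = fst x; s = fst (snd x); A = snd (snd x) in
     if 0 < s \<and> (\<exists>\<sigma>\<in>set (level n A (swap_lists q n) (bag_lists k n) (nat (min s (int (n + n) + 1)))).
          \<forall>v\<in>set [0..<n]. lookup \<sigma> v \<noteq> 0) then 1 else 0)"

section \<open>Polynomial running time of the search procedures\<close>

lemmas ram_intros = ram_const_nat ram_const_int ram_const_bool ram_Nil
  ram_Cons ram_Pair ram_fst ram_snd ram_id ram_add_nat ram_add_int
  ram_diff_int ram_if ram_less_nat ram_less_int ram_le_nat ram_le_int
  ram_eq_nat ram_eq_int ram_not ram_conj ram_imp ram_iff ram_of_nat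

text \<open>The function is analysed on tuples, where its arguments are projections, and then
  composed with the code for the actual arguments. The rules for the other procedures have the same
  shape.\<close>

lemma ram_lookup:
  assumes "ram D xs" "ram D i" "\<And>B x. D B x \<Longrightarrow> length (xs x) \<le> B"
  shows "ram D (\<lambda>x. lookup (xs x) (i x))"
proof -
  have "ram (\<lambda>B p. length (fst p) \<le> B) (\<lambda>p. lookup (fst p) (snd p))"
    unfolding lookup_def by (intro ram_intros ram_fold)
  from ram_comp[OF this ram_Pair[OF assms(1,2)]] show ?thesis using assms(3) by simp
qed

lemma ram_has_edge:
  assumes "ram D n" "ram D A" "ram D u" "ram D v"
    and "\<And>B x. D B x \<Longrightarrow> u x \<le> B \<and> length (A x) \<le> B"
  shows "ram D (\<lambda>x. has_edge (n x) (A x) (u x) (v x))"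
  unfolding has_edge_def by (intro ram_intros ram_lookup ram_mult assms) (use assms(5) in auto)

lemma ram_apply_swaps:
  assumes "ram D ps" "ram D v" "\<And>B x. D B x \<Longrightarrow> length (ps x) \<le> B"
  shows "ram D (\<lambda>x. apply_swaps (ps x) (v x))"
proof -
  have "ram (\<lambda>B p. length (fst p) \<le> B) (\<lambda>p. apply_swaps (fst p) (snd p))"
    unfolding apply_swaps_def by (intro ram_intros ram_foldr)
  from ram_comp[OF this ram_Pair[OF assms(1,2)]] show ?thesis using assms(3) by simp
qed

lemma ram_is_symmetry:
  assumes "ram D n" "ram D A" "ram D ps"
    and "\<And>B x. D B x \<Longrightarrow> n x \<le> B \<and> length (A x) \<le> B \<and> length (ps x) \<le> B"
  shows "ram D (\<lambda>x. is_symmetry (n x) (A x) (ps x))"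
proof -
  have "ram (\<lambda>B p. fst p \<le> B \<and> length (fst (snd p)) \<le> B \<and> length (snd (snd p)) \<le> B)
     (\<lambda>p. is_symmetry (fst p) (fst (snd p)) (snd (snd p)))"
    unfolding is_symmetry_def
    by (intro ram_intros ram_all ram_upt ram_apply_swaps ram_has_edge) auto
  from ram_comp[OF this ram_Pair[OF assms(1) ram_Pair[OF assms(2,3)]]]
  show ?thesis using assms(4) by simp
qed

lemma ram_improves:
  assumes "ram D n" "ram D A" "ram D s" "ram D v" "ram D ps"
    and "\<And>B x. D B x \<Longrightarrow> n x \<le> B \<and> length (A x) \<le> B \<and> length (s x) \<le> B \<and> length (ps x) \<le> B"
  shows "ram D (\<lambda>x. improves (n x) (A x) (s x) (v x) (ps x))"
proof -
  have "ram (\<lambda>B p. fst p \<le> B \<and> length (fst (snd p)) \<le> B \<and> length (fst (snd (snd p))) \<le> B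
       \<and> length (snd (snd (snd (snd p)))) \<le> B)
     (\<lambda>p. improves (fst p) (fst (snd p)) (fst (snd (snd p))) (fst (snd (snd (snd p)))) (snd (snd (snd (snd p)))))"
    unfolding improves_def
    by (intro ram_intros ram_all ram_upt ram_apply_swaps ram_is_symmetry
        ram_lookup) auto
  from ram_comp[OF this ram_Pair[OF assms(1) ram_Pair[OF assms(2) ram_Pair[OF assms(3)
    ram_Pair[OF assms(4,5)]]]]]
  show ?thesis using assms(6) by simp
qed

lemma ram_permute:
  assumes "ram D n" "ram D s" "ram D ps"
    and "\<And>B x. D B x \<Longrightarrow> n x \<le> B \<and> length (s x) \<le> B \<and> length (ps x) \<le> B"
  shows "ram D (\<lambda>x. permute (n x) (s x) (ps x))"
proof -
  have "ram (\<lambda>B p. fst p \<le> B \<and> length (fst (snd p)) \<le> B \<and> length (snd (snd p)) \<le> B)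
     (\<lambda>p. permute (fst p) (fst (snd p)) (snd (snd p)))"
    unfolding permute_def
    by (intro ram_intros ram_map ram_upt ram_apply_swaps ram_lookup) auto
  from ram_comp[OF this ram_Pair[OF assms(1) ram_Pair[OF assms(2,3)]]]
  show ?thesis using assms(4) by simp
qed

lemma length_permute [simp]: "length (permute n s ps) = n"
  by (simp add: permute_def)

lemma fold_invariant_set:
  "P a \<Longrightarrow> (\<And>x a. x \<in> set xs \<Longrightarrow> P a \<Longrightarrow> P (f x a)) \<Longrightarrow> P (fold f xs a)"
  by (induction xs arbitrary: a) auto

lemma ram_canonize:
  assumes "ram D n" "ram D A" "ram D PL" "ram D s"
    and "\<And>B x. D B x \<Longrightarrow> n x \<le> B \<and> length (A x) \<le> B \<and> length (s x) \<le> B \<and> length (PL x) \<le> B \<and>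
           (\<forall>ps\<in>set (PL x). length ps \<le> B)"
  shows "ram D (\<lambda>x. canonize (n x) (A x) (PL x) (s x))"
proof -
  have "ram (\<lambda>B p. fst p \<le> B \<and> length (fst (snd p)) \<le> B \<and> length (fst (snd (snd p))) \<le> B
       \<and> length (snd (snd (snd p))) \<le> B \<and> (\<forall>ps\<in>set (fst (snd (snd p))). length ps \<le> B))
     (\<lambda>p. canonize (fst p) (fst (snd p)) (fst (snd (snd p))) (snd (snd (snd p))))"
    unfolding canonize_def
    apply (rule ram_fold_inv[where I = "\<lambda>B x a. length a \<le> B"])
         apply (intro ram_intros ram_upt, simp)
        apply (intro ram_intros)
       apply simp
      apply (rule ram_fold_inv[where I = "\<lambda>B x a. length a \<le> B"])
           apply (intro ram_intros)
          apply (intro ram_intros)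
         apply simp
        apply (intro ram_intros ram_improves ram_permute; simp)
       apply simp
      apply (simp split: if_splits)
     apply simp
    apply (rule fold_invariant_set, simp, simp)
    done
  from ram_comp[OF this ram_Pair[OF assms(1) ram_Pair[OF assms(2)
    ram_Pair[OF assms(3,4)]]]]
  show ?thesis using assms(5) by simp
qed

lemma ram_advance:
  assumes "ram D n" "ram D s" "ram D bs"
    and "\<And>B x. D B x \<Longrightarrow> n x \<le> B \<and> length (s x) \<le> B \<and> length (bs x) \<le> B"
  shows "ram D (\<lambda>x. advance (n x) (s x) (bs x))"
proof -
  have "ram (\<lambda>B p. fst p \<le> B \<and> length (fst (snd p)) \<le> B \<and> length (snd (snd p)) \<le> B)
     (\<lambda>p. advance (fst p) (fst (snd p)) (snd (snd p)))"
    unfolding advance_def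
    by (intro ram_intros ram_map ram_upt ram_ex ram_lookup) auto
  from ram_comp[OF this ram_Pair[OF assms(1) ram_Pair[OF assms(2,3)]]]
  show ?thesis using assms(4) by simp
qed

lemma ram_admissible:
  assumes "ram D n" "ram D A" "ram D s" "ram D t"
    and "\<And>B x. D B x \<Longrightarrow> n x \<le> B \<and> length (A x) \<le> B \<and> length (s x) \<le> B \<and> length (t x) \<le> B"
  shows "ram D (\<lambda>x. admissible (n x) (A x) (s x) (t x))"
proof -
  have "ram (\<lambda>B p. fst p \<le> B \<and> length (fst (snd p)) \<le> B \<and> length (fst (snd (snd p))) \<le> B
       \<and> length (snd (snd (snd p))) \<le> B)
     (\<lambda>p. admissible (fst p) (fst (snd p)) (fst (snd (snd p))) (snd (snd (snd p))))"
    unfolding admissible_def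
    by (intro ram_intros ram_all ram_upt ram_has_edge ram_lookup) auto
  from ram_comp[OF this ram_Pair[OF assms(1) ram_Pair[OF assms(2)
    ram_Pair[OF assms(3,4)]]]]
  show ?thesis using assms(5) by simp
qed

lemma fold_dedup_bounds:
  "length (fold (\<lambda>x a. if P x a then a else x # a) xs a) \<le> length xs + length a"
  "set (fold (\<lambda>x a. if P x a then a else x # a) xs a) \<subseteq> set xs \<union> set a"
proof (induction xs arbitrary: a)
  case (Cons x xs)
  {
    case 1 show ?case using Cons.IH(1)[of a] Cons.IH(1)[of "x # a"] by simp
  next
    case 2 show ?case using Cons.IH(2)[of a] Cons.IH(2)[of "x # a"] by auto
  }
qed simp_all

lemma ram_dedup:
  assumes "ram D n" "ram D xs"
    and "\<And>B x. D B x \<Longrightarrow> n x \<le> B \<and> length (xs x) \<le> B \<and> (\<forall>l\<in>set (xs x). length l \<le> B)"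
  shows "ram D (\<lambda>x. dedup (n x) (xs x))"
proof -
  define D' where "D' = (\<lambda>B (p :: (nat \<times> nat list list) \<times> nat list \<times> nat list list). fst (fst p) \<le> B \<and>
    length (fst (snd p)) \<le> B \<and> length (snd (snd p)) \<le> B \<and> (\<forall>l\<in>set (snd (snd p)). length l \<le> B))"
  have "ram (\<lambda>B p. fst p \<le> B \<and> length (snd p) \<le> B \<and> (\<forall>l\<in>set (snd p). length l \<le> B))
     (\<lambda>p. dedup (fst p) (snd p))"
    unfolding dedup_def
  proof (rule ram_fold_history[where D' = D'])
    show "ram D' (\<lambda>p. if \<exists>y\<in>set (snd (snd p)). \<forall>v\<in>set [0..<fst (fst p)]. lookup y v = lookup (fst (snd p)) v
        then snd (snd p) else fst (snd p) # snd (snd p))"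
      by (intro ram_intros ram_ex ram_all ram_upt ram_lookup) (auto simp: D'_def)
    fix B and x :: "nat \<times> nat list list" and ys y zs
    assume *: "fst x \<le> B \<and> length (snd x) \<le> B \<and> (\<forall>l\<in>set (snd x). length l \<le> B)" "snd x = ys @ y # zs"
    let ?f = "\<lambda>ys. fold (\<lambda>z a. if \<exists>y\<in>set a. \<forall>v\<in>set [0..<fst x]. lookup y v = lookup z v then a else z # a) ys []"
    have "length (?f ys) \<le> length ys" "set (?f ys) \<subseteq> set ys"
      using fold_dedup_bounds[where xs = ys and a = "[]" and P = "\<lambda>z a. \<exists>y\<in>set a. \<forall>v\<in>set [0..<fst x]. lookup y v = lookup z v"] by simp_all
    then show "D' B (x, y, ?f ys)" using * unfolding D'_def by auto
  qed (auto intro!: ram_intros)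
  from ram_comp[OF this ram_Pair[OF assms(1,2)]] show ?thesis using assms(3) by simp
qed

lemma length_advance [simp]: "length (advance n s bs) = n"
  by (simp add: advance_def)

lemma length_canonize: "length s = n \<Longrightarrow> length (canonize n A PL s) = n"
  unfolding canonize_def by (rule fold_invariant_set, simp, rule fold_invariant_set) auto

lemma length_concat_map_le:
  "(\<And>x. x \<in> set xs \<Longrightarrow> length (f x) \<le> c) \<Longrightarrow> length (concat (map f xs)) \<le> length xs * c"
  by (induction xs) (auto simp: add_mono)

lemma ram_next_level:
  assumes "ram D n" "ram D A" "ram D PL" "ram D BL" "ram D T"
    and "\<And>B x. D B x \<Longrightarrow> n x \<le> B \<and> length (A x) \<le> B \<and> length (PL x) \<le> B \<and> (\<forall>ps\<in>set (PL x). length ps \<le> B) \<and>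
       length (BL x) \<le> B \<and> (\<forall>bs\<in>set (BL x). length bs \<le> B) \<and>
       length (T x) \<le> B \<and> length (T x) * length (BL x) \<le> B \<and> (\<forall>s\<in>set (T x). length s \<le> B)"
  shows "ram D (\<lambda>x. next_level (n x) (A x) (PL x) (BL x) (T x))"
proof -
  have "ram (\<lambda>B p. fst p \<le> B \<and> length (fst (snd p)) \<le> B \<and> length (fst (snd (snd p))) \<le> B \<and>
       (\<forall>ps\<in>set (fst (snd (snd p))). length ps \<le> B) \<and>
       length (fst (snd (snd (snd p)))) \<le> B \<and> (\<forall>bs\<in>set (fst (snd (snd (snd p)))). length bs \<le> B) \<and>
       length (snd (snd (snd (snd p)))) \<le> B \<and>
       length (snd (snd (snd (snd p)))) * length (fst (snd (snd (snd p)))) \<le> B \<and>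
       (\<forall>s\<in>set (snd (snd (snd (snd p)))). length s \<le> B))
     (\<lambda>p. next_level (fst p) (fst (snd p)) (fst (snd (snd p))) (fst (snd (snd (snd p)))) (snd (snd (snd (snd p)))))"
    unfolding next_level_def
    apply (intro ram_dedup ram_concat ram_map ram_filter ram_canonize
        ram_admissible ram_advance ram_intros)
    apply (auto intro: le_trans[OF length_filter_le] simp: length_canonize)
    apply (rule le_trans[OF length_concat_map_le])
    apply (auto intro: length_filter_le)
    done
  from ram_comp[OF this ram_Pair[OF assms(1) ram_Pair[OF assms(2)
    ram_Pair[OF assms(3) ram_Pair[OF assms(4,5)]]]]]
  show ?thesis using assms(6) by simp
qed

text \<open>The lengths of the levels are bounded by hypothesis: a single step may multiply them by
  the number of bags, and only the count of canonical states limits them.\<close>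

lemma ram_level:
  assumes "ram D n" "ram D A" "ram D PL" "ram D BL" "ram D i"
    and "\<And>B x. D B x \<Longrightarrow> n x \<le> B \<and> length (A x) \<le> B \<and> length (PL x) \<le> B \<and> (\<forall>ps\<in>set (PL x). length ps \<le> B) \<and>
       length (BL x) \<le> B \<and> (\<forall>bs\<in>set (BL x). length bs \<le> B) \<and> i x \<le> B \<and>
       (\<forall>j\<le>i x. length (level (n x) (A x) (PL x) (BL x) j) \<le> B \<and>
         length (level (n x) (A x) (PL x) (BL x) j) * length (BL x) \<le> B \<and>
         (\<forall>s\<in>set (level (n x) (A x) (PL x) (BL x) j). length s \<le> B))"
  shows "ram D (\<lambda>x. level (n x) (A x) (PL x) (BL x) (i x))"
proof -
  let ?T = "\<lambda>B p j. level (fst p) (fst (snd p)) (fst (snd (snd p))) (fst (snd (snd (snd p)))) j"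
  define D1 where "D1 = (\<lambda>B (p :: nat \<times> nat list \<times> (nat \<times> nat) list list \<times> nat list list \<times> nat).
     fst p \<le> B \<and> length (fst (snd p)) \<le> B \<and> length (fst (snd (snd p))) \<le> B \<and>
       (\<forall>ps\<in>set (fst (snd (snd p))). length ps \<le> B) \<and>
       length (fst (snd (snd (snd p)))) \<le> B \<and> (\<forall>bs\<in>set (fst (snd (snd (snd p)))). length bs \<le> B) \<and>
       snd (snd (snd (snd p))) \<le> B \<and>
       (\<forall>j\<le>snd (snd (snd (snd p))). length (?T B p j) \<le> B \<and>
         length (?T B p j) * length (fst (snd (snd (snd p)))) \<le> B \<and> (\<forall>s\<in>set (?T B p j). length s \<le> B)))"
  define D2 where "D2 = (\<lambda>B (p :: (nat \<times> nat list \<times> (nat \<times> nat) list list \<times> nat list list \<times> nat) \<times> nat \<times> nat list list).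
     D1 B (fst p) \<and> (\<exists>j\<le>snd (snd (snd (snd (fst p)))). snd (snd p) = ?T B (fst p) j))"
  have "ram D1
     (\<lambda>p. level (fst p) (fst (snd p)) (fst (snd (snd p))) (fst (snd (snd (snd p)))) (snd (snd (snd (snd p)))))"
    unfolding level_def
  proof (rule ram_fold_history[where D' = D2])
    show "ram D2 (\<lambda>p. next_level (fst (fst p)) (fst (snd (fst p))) (fst (snd (snd (fst p))))
            (fst (snd (snd (snd (fst p))))) (snd (snd p)))"
      by (intro ram_next_level ram_intros) (auto simp: D2_def D1_def)
    fix B x ys y zs assume "D1 B x" and s: "[0..<snd (snd (snd (snd x)))] = ys @ y # zs"
    then have "ys = [0..<length ys]" "length ys \<le> snd (snd (snd (snd x)))"
      by (metis append_eq_conv_conj take_upt add_0 le_add1 length_append length_upt diff_zero,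
          metis le_add1 length_append length_upt diff_zero)
    then show "D2 B (x, y, fold (\<lambda>_. next_level (fst x) (fst (snd x)) (fst (snd (snd x))) (fst (snd (snd (snd x))))) ys
            [map (\<lambda>_. 0) [0..<fst x]])"
      using \<open>D1 B x\<close> unfolding D2_def level_def by (auto intro!: exI[of _ "length ys"])
  qed (auto simp: D1_def intro!: ram_upt ram_map ram_intros)
  from ram_comp[OF this ram_Pair[OF assms(1) ram_Pair[OF assms(2)
    ram_Pair[OF assms(3) ram_Pair[OF assms(4,5)]]]]]
  show ?thesis using assms(6) by (simp add: D1_def)
qed

lemma ram_power:
  assumes "ram D j" "\<And>B x. D B x \<Longrightarrow> j x \<le> B \<and> q \<le> B"
  shows "ram D (\<lambda>x. q ^ j x :: nat)"
proof -
  have "ram D (\<lambda>x. fold (\<lambda>_ a. q * a) [0..<j x] 1)"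
    by (intro ram_fold ram_upt ram_mult assms(1) ram_intros) (use assms(2) in auto)
  moreover have "fold (\<lambda>_ a. q * a) [0..<j] 1 = q ^ j" for j by (induction j) auto
  ultimately show ?thesis by simp
qed

lemma ram_threshold:
  assumes "ram D n" "\<And>B x. D B x \<Longrightarrow> n x \<le> B \<and> q \<le> B"
  shows "ram D (\<lambda>x. threshold q (n x))"
proof -
  have "ram (\<lambda>B n. n \<le> B \<and> q \<le> B) (\<lambda>n. threshold q n)"
    unfolding threshold_def
    by (intro ram_fold ram_upt ram_power ram_intros) auto
  from ram_comp[OF this assms(1)] show ?thesis using assms(2) by simp
qed

lemma n_lists_conv_fold:
  "List.n_lists m xs = fold (\<lambda>_ a. concat (map (\<lambda>ys. map (\<lambda>y. y # ys) xs) a)) [0..<m] [[]]"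
  by (induction m) auto

lemma ram_n_lists:
  assumes "ram D m" "ram D xs"
    and "\<And>B x. D B x \<Longrightarrow> m x \<le> B \<and> length (xs x) \<le> B \<and> (\<forall>j\<le>m x. length (xs x) ^ j \<le> B)"
  shows "ram D (\<lambda>x. List.n_lists (m x) (xs x))"
proof -
  define D1 where "D1 = (\<lambda>B (p :: nat \<times> 'b list). fst p \<le> B \<and> length (snd p) \<le> B \<and> (\<forall>j\<le>fst p. length (snd p) ^ j \<le> B))"
  define D2 where "D2 = (\<lambda>B (p :: (nat \<times> 'b list) \<times> nat \<times> 'b list list). D1 B (fst p) \<and> length (snd (snd p)) \<le> B)"
  have "ram D1 (\<lambda>p. List.n_lists (fst p) (snd p))"
    unfolding n_lists_conv_fold
  proof (rule ram_fold_history[where D' = D2])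
    show "ram D2 (\<lambda>p. concat (map (\<lambda>ys. map (\<lambda>y. y # ys) (snd (fst p))) (snd (snd p))))"
      by (intro ram_concat ram_map ram_intros) (auto simp: D2_def D1_def)
    fix B and x :: "nat \<times> 'b list" and ys y zs assume "D1 B x" and s: "[0..<fst x] = ys @ y # zs"
    then have ys: "ys = [0..<length ys]" "length ys \<le> fst x"
      by (metis append_eq_conv_conj take_upt add_0 le_add1 length_append length_upt diff_zero,
          metis le_add1 length_append length_upt diff_zero)
    have "fold (\<lambda>_ a. concat (map (\<lambda>ys. map (\<lambda>y. y # ys) (snd x)) a)) ys [[]] = List.n_lists (length ys) (snd x)"
      unfolding n_lists_conv_fold using ys(1) by simp
    then show "D2 B (x, y, fold (\<lambda>_ a. concat (map (\<lambda>ys. map (\<lambda>y. y # ys) (snd x)) a)) ys [[]])"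
      using \<open>D1 B x\<close> ys(2) by (simp add: D2_def D1_def length_n_lists)
  qed (auto simp: D1_def intro!: ram_upt ram_intros)
  from ram_comp[OF this ram_Pair[OF assms(1,2)]] show ?thesis using assms(3) by (simp add: D1_def)
qed

lemma length_vertex_pairs [simp]:
  "length (concat (map (\<lambda>u. map (\<lambda>v. (u, v)) [0..<n]) [0..<n])) = n * n"
  by (simp add: length_concat comp_def sum_list_triv)

lemma ram_swap_lists:
  assumes "ram D n"
    and "\<And>B x. D B x \<Longrightarrow> n x * n x \<le> B \<and> q \<le> B \<and> threshold q (n x) \<le> B \<and> (\<forall>j\<le>threshold q (n x). (n x * n x) ^ j \<le> B)"
  shows "ram D (\<lambda>x. swap_lists q (n x))"
proof -
  have le: "n * n \<le> B \<Longrightarrow> n \<le> B" for n B :: nat by (cases n) auto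
  have "ram (\<lambda>B n. n * n \<le> B \<and> q \<le> B \<and> threshold q n \<le> B \<and> (\<forall>j\<le>threshold q n. (n * n) ^ j \<le> B)) (\<lambda>n. swap_lists q n)"
    unfolding swap_lists_def
    by (intro ram_n_lists ram_concat ram_map ram_upt ram_threshold ram_intros)
      (auto dest: le simp del: power_mult_distrib)
  from ram_comp[OF this assms(1)] show ?thesis using assms(2) by simp
qed

lemma ram_bag_lists:
  assumes "ram D n" "\<And>B x. D B x \<Longrightarrow> Suc k \<le> B \<and> Suc (n x) \<le> B \<and> Suc (n x) ^ Suc k \<le> B"
  shows "ram D (\<lambda>x. bag_lists k (n x))"
proof -
  have le: "Suc n ^ Suc k \<le> B \<Longrightarrow> j \<le> Suc k \<Longrightarrow> Suc n ^ j \<le> B" for n j B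
    using power_increasing[of j "Suc k" "Suc n"] by simp
  have "ram (\<lambda>B n. Suc k \<le> B \<and> Suc n \<le> B \<and> Suc n ^ Suc k \<le> B) (\<lambda>n. bag_lists k n)"
    unfolding bag_lists_def Suc_eq_plus1[of "_ :: nat"]
    by (intro ram_n_lists ram_upt ram_intros) (auto intro: le simp del: upt_Suc)
  from ram_comp[OF this assms(1)] show ?thesis using assms(2) by simp
qed

lemma ram_min_int:
  assumes "ram D f" "ram D g" shows "ram D (\<lambda>x. min (f x) (g x) :: int)"
  unfolding min_def by (intro ram_if ram_le_int) (auto intro: assms ram_weaken[OF assms(1)] ram_weaken[OF assms(2)])

lemma length_in_n_lists: "l \<in> set (List.n_lists m xs) \<Longrightarrow> length l = m"
  by (simp add: set_n_lists)

lemma ram_decide: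
  assumes "\<And>B x. D B x \<Longrightarrow> fst x * fst x \<le> B \<and> length (snd (snd x)) \<le> B \<and> Suc (fst x + fst x) \<le> B \<and> q \<le> B \<and>
      threshold q (fst x) \<le> B \<and> (\<forall>j\<le>threshold q (fst x). (fst x * fst x) ^ j \<le> B) \<and>
      Suc k \<le> B \<and> Suc (fst x) ^ Suc k \<le> B \<and>
      (\<forall>j. length (level (fst x) (snd (snd x)) (swap_lists q (fst x)) (bag_lists k (fst x)) j) \<le> B \<and>
         length (level (fst x) (snd (snd x)) (swap_lists q (fst x)) (bag_lists k (fst x)) j) * Suc (fst x) ^ Suc k \<le> B \<and>
         (\<forall>s\<in>set (level (fst x) (snd (snd x)) (swap_lists q (fst x)) (bag_lists k (fst x)) j). length s \<le> B))"
  shows "ram D (decide k q)"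
proof -
  have len: "length (swap_lists q n) = (n * n) ^ threshold q n" "length (bag_lists k n) = Suc n ^ Suc k"
    "ps \<in> set (swap_lists q n) \<Longrightarrow> length ps = threshold q n" "bs \<in> set (bag_lists k n) \<Longrightarrow> length bs = Suc k"
    for n ps bs
    unfolding swap_lists_def bag_lists_def by (simp_all add: length_n_lists length_in_n_lists del: upt_Suc List.n_lists.simps power_Suc)
  show ?thesis
    unfolding decide_def Let_def
    apply (intro ram_intros ram_ex ram_all ram_level ram_nat ram_min_int
        ram_swap_lists ram_bag_lists ram_upt ram_lookup)
    using assms by (fastforce simp: len)+
qed

subsection \<open>Sweeps\<close>

locale bounded_sweep =
  fixes n :: nat and adj :: "nat \<Rightarrow> nat \<Rightarrow> bool" and k :: nat
  assumes adj_sym: "adj u v \<Longrightarrow> adj v u" and adj_irrefl: "\<not> adj v v"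
begin

text \<open>A state maps every vertex to 0 (not yet seen), 1 (in the current bag) or 2 (forgotten).\<close>

definition sweep_step :: "(nat \<Rightarrow> nat) \<Rightarrow> (nat \<Rightarrow> nat) \<Rightarrow> bool" where
  "sweep_step s t \<longleftrightarrow>
     (\<forall>v<n. s v = 0 \<and> t v \<in> {0, 1} \<or> s v = 1 \<and> t v \<in> {1, 2} \<or> s v = 2 \<and> t v = 2) \<and>
     card {v. v < n \<and> t v = 1} \<le> Suc k \<and>
     (\<forall>u<n. \<forall>v<n. adj u v \<longrightarrow> t u = 2 \<longrightarrow> s v \<noteq> 0)"

inductive sweep :: "nat \<Rightarrow> (nat \<Rightarrow> nat) \<Rightarrow> bool" where
  sweep_0: "(\<And>v. v < n \<Longrightarrow> s v = 0) \<Longrightarrow> sweep 0 s"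
| sweep_Suc: "sweep i s \<Longrightarrow> sweep_step s t \<Longrightarrow> sweep (Suc i) t"

lemma sweep_stepD:
  assumes "sweep_step s t"
  shows "v < n \<Longrightarrow> s v = 0 \<and> t v \<in> {0, 1} \<or> s v = 1 \<and> t v \<in> {1, 2} \<or> s v = 2 \<and> t v = 2"
    "card {v. v < n \<and> t v = 1} \<le> Suc k" "u < n \<Longrightarrow> v < n \<Longrightarrow> adj u v \<Longrightarrow> t u = 2 \<Longrightarrow> s v \<noteq> 0"
  using assms unfolding sweep_step_def by blast+

lemma sweep_step_cong:
  assumes "sweep_step s t" "\<And>v. v < n \<Longrightarrow> s' v = s v" "\<And>v. v < n \<Longrightarrow> t' v = t v"
  shows "sweep_step s' t'"
proof -
  have "{v. v < n \<and> t' v = 1} = {v. v < n \<and> t v = 1}" using assms(3) by auto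
  then show ?thesis using assms unfolding sweep_step_def by simp
qed

lemma sweep_cong: "sweep i s \<Longrightarrow> (\<And>v. v < n \<Longrightarrow> s' v = s v) \<Longrightarrow> sweep i s'"
  by (erule sweep.cases) (auto intro: sweep.intros sweep_step_cong)

text \<open>The bag separates forgotten from unseen vertices. This makes repeating a bag a legal
  step and the forgotten set a union of components.\<close>

lemma sweep_invariant:
  "sweep i s \<Longrightarrow> (\<forall>v<n. s v \<le> 2) \<and> card {v. v < n \<and> s v = 1} \<le> Suc k \<and>
     (\<forall>u<n. \<forall>v<n. adj u v \<longrightarrow> s u = 2 \<longrightarrow> s v \<noteq> 0)"
proof (induction rule: sweep.induct)
  case (sweep_0 s)
  then have *: "{v. v < n \<and> s v = 1} = {}" by auto
  show ?case unfolding * using sweep_0 by simp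
next
  case (sweep_Suc i s t)
  then have st: "\<forall>v<n. s v = 0 \<and> t v \<in> {0, 1} \<or> s v = 1 \<and> t v \<in> {1, 2} \<or> s v = 2 \<and> t v = 2"
    "card {v. v < n \<and> t v = 1} \<le> Suc k" "\<forall>u<n. \<forall>v<n. adj u v \<longrightarrow> t u = 2 \<longrightarrow> s v \<noteq> 0"
    unfolding sweep_step_def by blast+
  have "t v \<noteq> 0" if "u < n" "v < n" "adj u v" "t u = 2" for u v
    using st(1,3) that by (metis insertE singletonD zero_neq_numeral zero_neq_one)
  moreover have "t v \<le> 2" if "v < n" for v using st(1) that by fastforce
  ultimately show ?case using st(2) by blast
qed

lemma sweep_stutter: "sweep i s \<Longrightarrow> sweep (Suc i) s"
proof (rule sweep_Suc)
  assume "sweep i s"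
  note inv = sweep_invariant[OF this]
  have "s v = 0 \<or> s v = 1 \<or> s v = 2" if "v < n" for v using inv that by force
  then show "sweep_step s s" using inv unfolding sweep_step_def by blast
qed

lemma sweep_mono:
  assumes "sweep i s" "i \<le> j" shows "sweep j s"
  using assms(2,1) by (induction j rule: dec_induct) (auto intro: sweep_stutter)

text \<open>Every step that is not a repetition increases the sum of the labels, which is at most \<open>2n\<close>.\<close>

lemma sweep_short: "sweep i s \<Longrightarrow> sweep (\<Sum>v<n. s v) s"
proof (induction rule: sweep.induct)
  case (sweep_0 s)
  then show ?case by (auto intro: sweep.sweep_0)
next
  case (sweep_Suc i s t)
  have st: "\<forall>v<n. s v = 0 \<and> t v \<in> {0, 1} \<or> s v = 1 \<and> t v \<in> {1, 2} \<or> s v = 2 \<and> t v = 2"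
    using sweep_Suc.hyps(2) unfolding sweep_step_def by blast
  then have le: "s v \<le> t v" if "v < n" for v using that by fastforce
  show ?case
  proof (cases "\<forall>v<n. t v = s v")
    case True
    then have "sweep (\<Sum>v<n. s v) t" using sweep_Suc.IH sweep_cong by blast
    moreover have "(\<Sum>v<n. s v) = (\<Sum>v<n. t v)" using True by (intro sum.cong) auto
    ultimately show ?thesis by simp
  next
    case False
    then obtain v where "v < n" "s v < t v" using le by (metis le_neq_implies_less)
    then have "(\<Sum>v<n. s v) < (\<Sum>v<n. t v)" using le by (intro sum_strict_mono_ex1) auto
    then show ?thesis
      using sweep.sweep_Suc[OF sweep_Suc.IH sweep_Suc.hyps(2)] by (auto intro: sweep_mono)
  qed
qed

text \<open>This justifies bounding the number of levels in terms of \<open>n\<close> alone.\<close>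

lemma sweep_cap:
  assumes "sweep i s" "2 * n \<le> j" shows "sweep j s"
proof -
  have "(\<Sum>v<n. s v) \<le> (\<Sum>v<n. 2)" using sweep_invariant[OF assms(1)] by (intro sum_mono) auto
  then show ?thesis using sweep_mono[OF sweep_short[OF assms(1)]] assms(2) by simp
qed

section \<open>Invariance of sweeps under automorphisms\<close>

definition symmetry :: "(nat \<Rightarrow> nat) \<Rightarrow> bool" where
  "symmetry f \<longleftrightarrow> bij_betw f {..<n} {..<n} \<and> (\<forall>u<n. \<forall>v<n. adj (f u) (f v) \<longleftrightarrow> adj u v)"

lemma symmetry_less: "symmetry f \<Longrightarrow> v < n \<Longrightarrow> f v < n"
  unfolding symmetry_def by (auto dest: bij_betwE)

lemma symmetry_id: "symmetry (\<lambda>v. v)"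
  unfolding symmetry_def by (auto simp: bij_betw_def)

lemma symmetry_comp: "symmetry f \<Longrightarrow> symmetry g \<Longrightarrow> symmetry (\<lambda>v. f (g v))"
  using bij_betw_trans[of g "{..<n}" "{..<n}" f "{..<n}"] symmetry_less[of g]
  unfolding symmetry_def by (auto simp: comp_def)

lemma sweep_step_symmetry:
  assumes "symmetry f" "sweep_step s t" shows "sweep_step (\<lambda>v. s (f v)) (\<lambda>v. t (f v))"
proof -
  have "bij_betw f {v. v < n \<and> t (f v) = 1} {v. v < n \<and> t v = 1}"
    using assms(1) unfolding symmetry_def bij_betw_def
    by (auto simp: inj_on_def)
  then have "card {v. v < n \<and> t (f v) = 1} = card {v. v < n \<and> t v = 1}" by (rule bij_betw_same_card)
  moreover have "s (f v) \<noteq> 0" if "u < n" "v < n" "adj u v" "t (f u) = 2" for u v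
    using assms symmetry_less[OF assms(1)] that unfolding sweep_step_def symmetry_def by meson
  ultimately show ?thesis
    using assms(2) symmetry_less[OF assms(1)] unfolding sweep_step_def by simp
qed

lemma sweep_symmetry: "sweep i s \<Longrightarrow> symmetry f \<Longrightarrow> sweep i (\<lambda>v. s (f v))"
  by (induction rule: sweep.induct)
    (auto intro: sweep.intros sweep_step_symmetry dest: symmetry_less)

section \<open>Path decompositions and sweeps\<close>

lemma decomposition_imp_sweep:
  assumes pd: "path_decomposition {..<n} E Xs" and w: "\<forall>X\<in>set Xs. card X \<le> Suc k"
    and E: "\<And>u v. u < n \<Longrightarrow> v < n \<Longrightarrow> adj u v \<Longrightarrow> {u, v} \<in> E"
  shows "\<exists>s. sweep (length Xs) s \<and> (\<forall>v<n. s v \<noteq> 0)"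
proof -
  have un: "\<Union>(set Xs) = {..<n}"
    and ivl: "\<forall>v\<in>{..<n}. \<exists>a b. {i. i < length Xs \<and> v \<in> Xs ! i} = {a..b}"
    using pd unfolding path_decomposition_def by simp_all
  have ed: "\<And>u v. {u, v} \<in> E \<Longrightarrow> \<exists>X\<in>set Xs. u \<in> X \<and> v \<in> X" using pd unfolding path_decomposition_def by blast
  have convex: "v \<in> Xs ! b" if "v < n" "a \<le> b" "b \<le> c" "c < length Xs" "v \<in> Xs ! a" "v \<in> Xs ! c" for v a b c
  proof -
    obtain x y where xy: "{i. i < length Xs \<and> v \<in> Xs ! i} = {x..y}"
      using bspec[OF ivl, of v] \<open>v < n\<close> by auto
    have "a \<in> {i. i < length Xs \<and> v \<in> Xs ! i}" "c \<in> {i. i < length Xs \<and> v \<in> Xs ! i}"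
      using that(2-6) by simp_all
    then have "b \<in> {i. i < length Xs \<and> v \<in> Xs ! i}" using that(2,3) unfolding xy by simp
    then show ?thesis by simp
  qed
  \<comment> \<open>The state after \<open>j\<close> bags, the last of which has index
    \<open>j - 1\<close>. Label 2 means seen before but missing from that bag; convexity prevents
    such a vertex from returning.\<close>
  define s where "s = (\<lambda>j v. if 0 < j \<and> v \<in> Xs ! (j - 1) then 1 else if \<exists>i<j. v \<in> Xs ! i then 2 else (0::nat))"
  have s1: "s j v = 1 \<longleftrightarrow> 0 < j \<and> v \<in> Xs ! (j - 1)" for j v unfolding s_def by simp
  have s0: "s j v = 0 \<longleftrightarrow> \<not> (\<exists>i<j. v \<in> Xs ! i)" for j v
    unfolding s_def using diff_less[of 1 j] by (metis less_numeral_extra(1) zero_neq_numeral zero_neq_one)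
  have s2: "s j v = 2 \<longleftrightarrow> s j v \<noteq> 0 \<and> s j v \<noteq> 1" for j v unfolding s_def by simp
  have "sweep j (s j)" if "j \<le> length Xs" for j
    using that
  proof (induction j)
    case 0
    then show ?case by (auto simp: s_def intro: sweep_0)
  next
    case (Suc j)
    have sub: "Xs ! j \<subseteq> {..<n}" using un Suc.prems by (auto simp: Suc_le_eq)
    have "sweep_step (s j) (s (Suc j))"
      unfolding sweep_step_def
    proof (intro conjI allI impI)
      fix v assume v: "v < n"
      have "s (Suc j) v = 2" if "s j v = 2"
      proof -
        from that obtain i where i: "i < j" "v \<in> Xs ! i" "v \<notin> Xs ! (j - 1)" using s2 s0 s1 by (metis gr0I not_less0)
        moreover have "i \<le> j - 1" using i(1) by linarith
        ultimately have "v \<notin> Xs ! j" using convex[of v i "j - 1" j] v Suc.prems by auto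
        then show ?thesis using i s0 s1 s2 by (metis diff_Suc_1 less_SucI)
      qed
      moreover have "s (Suc j) v \<in> {0, 1}" if "s j v = 0"
        using that s0 s1 less_Suc_eq by (metis diff_Suc_1 insertCI zero_less_Suc)
      moreover have "s (Suc j) v \<in> {1, 2}" if "s j v = 1"
        using that s0 s1 s2 by (metis diff_less insertCI less_SucI less_numeral_extra(1))
      moreover have "s j v = 0 \<or> s j v = 1 \<or> s j v = 2" using s2 by blast
      ultimately show "s j v = 0 \<and> s (Suc j) v \<in> {0, 1} \<or> s j v = 1 \<and> s (Suc j) v \<in> {1, 2} \<or>
          s j v = 2 \<and> s (Suc j) v = 2" by metis
    next
      have "{v. v < n \<and> s (Suc j) v = 1} = Xs ! j" unfolding s1 using sub by auto
      then show "card {v. v < n \<and> s (Suc j) v = 1} \<le> Suc k" using w Suc.prems by (simp add: Suc_le_eq)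
    next
      fix u v assume uv: "u < n" "v < n" "adj u v" "s (Suc j) u = 2"
      from uv(4) obtain i where i: "i < Suc j" "u \<in> Xs ! i" "u \<notin> Xs ! j" using s2 s0 s1 by (metis diff_Suc_1 zero_less_Suc)
      obtain l where l: "l < length Xs" "u \<in> Xs ! l" "v \<in> Xs ! l"
        using ed[OF E[OF uv(1-3)]] by (metis in_set_conv_nth)
      \<comment> \<open>A bag shared by \<open>u\<close> and \<open>v\<close> at or after position
        \<open>j\<close> would by convexity force \<open>u\<close> into bag \<open>j\<close>, which
        has dropped it.\<close>
      have "l < j"
      proof (rule ccontr)
        assume "\<not> l < j"
        then have "u \<in> Xs ! j" using convex[of u i j l] i l uv by auto
        then show False using i by simp
      qed
      then show "s j v \<noteq> 0" using l s0 by blast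
    qed
    then show ?case using sweep_Suc[OF Suc.IH] Suc.prems by simp
  qed
  then have "sweep (length Xs) (s (length Xs))" by simp
  moreover have "s (length Xs) v \<noteq> 0" if "v < n" for v
  proof -
    obtain i where "i < length Xs" "v \<in> Xs ! i" 
      using un \<open>v < n\<close> by (metis UnionE in_set_conv_nth lessThan_iff)
    then show ?thesis using s0 by blast
  qed
  ultimately show ?thesis by blast
qed

text \<open>Invariant for rebuilding the bags. Edges without a forgotten endpoint need no clause:
  once all vertices have been seen, both endpoints of such an edge lie in the last bag.\<close>

definition bags_of :: "nat \<Rightarrow> (nat \<Rightarrow> nat) \<Rightarrow> nat set list \<Rightarrow> bool" where
  "bags_of i s Xs \<longleftrightarrow> length Xs = i \<and> (\<forall>X\<in>set Xs. X \<subseteq> {..<n} \<and> card X \<le> Suc k) \<and>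
     (\<forall>v<n. s v = 0 \<longleftrightarrow> v \<notin> \<Union>(set Xs)) \<and>
     (\<forall>v<n. s v = 1 \<longleftrightarrow> 0 < i \<and> v \<in> Xs ! (i - 1)) \<and>
     (\<forall>v a b c. a \<le> b \<longrightarrow> b \<le> c \<longrightarrow> c < i \<longrightarrow> v \<in> Xs ! a \<longrightarrow> v \<in> Xs ! c \<longrightarrow> v \<in> Xs ! b) \<and>
     (\<forall>u<n. \<forall>v<n. adj u v \<longrightarrow> s u = 2 \<longrightarrow> (\<exists>X\<in>set Xs. u \<in> X \<and> v \<in> X))"

lemma bags_ofD:
  assumes "bags_of i s Xs"
  shows "length Xs = i" "\<forall>X\<in>set Xs. X \<subseteq> {..<n} \<and> card X \<le> Suc k"
    "\<And>v. v < n \<Longrightarrow> s v = 0 \<longleftrightarrow> v \<notin> \<Union>(set Xs)"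
    "\<And>v. v < n \<Longrightarrow> s v = 1 \<longleftrightarrow> 0 < i \<and> v \<in> Xs ! (i - 1)"
    "\<And>v a b c. a \<le> b \<Longrightarrow> b \<le> c \<Longrightarrow> c < i \<Longrightarrow> v \<in> Xs ! a \<Longrightarrow> v \<in> Xs ! c \<Longrightarrow> v \<in> Xs ! b"
    "\<And>u v. u < n \<Longrightarrow> v < n \<Longrightarrow> adj u v \<Longrightarrow> s u = 2 \<Longrightarrow> \<exists>X\<in>set Xs. u \<in> X \<and> v \<in> X"
  using assms unfolding bags_of_def by simp_all

lemma sweep_imp_bags: "sweep i s \<Longrightarrow> \<exists>Xs. bags_of i s Xs"
proof (induction rule: sweep.induct)
  case (sweep_0 s)
  then show ?case by (intro exI[of _ "[]"]) (simp add: bags_of_def)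
next
  case (sweep_Suc i s t)
  obtain Xs where "bags_of i s Xs" using sweep_Suc.IH ..
  note Xs = bags_ofD[OF this]
  note st = sweep_stepD[OF sweep_Suc.hyps(2)]
  let ?X = "{v. v < n \<and> t v = 1}" let ?Xs = "Xs @ [?X]"
  have nth: "?Xs ! j = (if j < i then Xs ! j else ?X)" if "j < Suc i" for j
    using that Xs(1) by (auto simp: nth_append less_Suc_eq)
  have sub: "Xs ! j \<subseteq> {..<n}" if "j < i" for j using Xs(1,2) that by auto
  have "t v = 0 \<longleftrightarrow> v \<notin> \<Union>(set ?Xs)" if "v < n" for v
    using st(1)[OF that] Xs(3)[OF that] that by auto
  moreover have "v \<in> ?Xs ! b" if "a \<le> b" "b \<le> c" "c < Suc i" "v \<in> ?Xs ! a" "v \<in> ?Xs ! c" for v a b c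
  proof (cases "c < i")
    case True
    then show ?thesis using that Xs(5)[of a b c v] nth by auto
  next
    case False
    then have c: "c = i" "v \<in> ?X" using that nth[of c] by auto
    show ?thesis
    proof (cases "b < i")
      case True
      then have va: "v \<in> Xs ! a" "v < n" using that nth[of a] c by auto
      then have "v \<in> \<Union>(set Xs)" using that True Xs(1) by auto
      then have "s v \<noteq> 0" using Xs(3) va by blast
      then have "s v = 1" using st(1)[OF va(2)] c by auto
      then have "v \<in> Xs ! (i - 1)" using Xs(4) va by blast
      then show ?thesis using Xs(5)[of a b "i - 1" v] that va True nth[of b] by auto
    next
      case False
      then show ?thesis using c that nth[of b] by auto
    qed
  qed
  moreover have "\<exists>X\<in>set ?Xs. u \<in> X \<and> v \<in> X" if uv: "u < n" "v < n" "adj u v" "t u = 2" for u v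
  proof -
    have "s u = 2 \<or> s u = 1" using st(1)[OF uv(1)] uv(4) by auto
    moreover have "\<exists>X\<in>set Xs. u \<in> X \<and> v \<in> X" if "s u = 2" using Xs(6) uv that by blast
    moreover have "\<exists>X\<in>set Xs. u \<in> X \<and> v \<in> X" if "s u = 1"
    proof -
      \<comment> \<open>Here \<open>u\<close> is dropped in this very step. A neighbour with label 1
        shares the previous bag with it; one with label 2 is handled by the invariant with the two
        endpoints exchanged.\<close>
      have "s v = 1 \<or> s v = 2" using st(3)[OF uv] st(1)[OF uv(2)] by auto
      then show ?thesis
      proof
        assume "s v = 1"
        then have "u \<in> Xs ! (i - 1)" "v \<in> Xs ! (i - 1)" "Xs ! (i - 1) \<in> set Xs"
          using that Xs(1,4) uv by auto
        then show ?thesis by blast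
      qed (use Xs(6)[OF uv(2,1) adj_sym[OF uv(3)]] in blast)
    qed
    ultimately show ?thesis by auto
  qed
  moreover have "t v = 1 \<longleftrightarrow> 0 < Suc i \<and> v \<in> ?Xs ! (Suc i - 1)" if "v < n" for v
    using that nth[of i] by simp
  ultimately show ?case
    using Xs(1,2) st(2) unfolding bags_of_def by (intro exI[of _ ?Xs]) (simp add: subset_iff)
qed

lemma sweep_imp_decomposition:
  assumes "sweep i s" "\<forall>v<n. s v \<noteq> 0" "0 < i"
    and E: "\<And>u v. {u, v} \<in> E \<Longrightarrow> u < n \<and> v < n \<and> adj u v"
  shows "\<exists>Xs. path_decomposition {..<n} E Xs \<and> (\<forall>X\<in>set Xs. card X \<le> Suc k) \<and> length Xs = i"
proof -
  obtain Xs where "bags_of i s Xs" using sweep_imp_bags[OF assms(1)] ..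
  note Xs = bags_ofD[OF this]
  have "\<Union>(set Xs) = {..<n}"
  proof (intro equalityI subsetI)
    fix v assume "v \<in> {..<n}" then show "v \<in> \<Union>(set Xs)" using Xs(3)[of v] assms(2) by blast
  qed (use Xs(2) in blast)
  moreover have "\<exists>X\<in>set Xs. u \<in> X \<and> v \<in> X" if "{u, v} \<in> E" for u v
  proof -
    note uv = E[OF that]
    have "s u \<le> 2" "s v \<le> 2" "s u \<noteq> 0" "s v \<noteq> 0" using sweep_invariant[OF assms(1)] assms(2) uv by auto
    then consider "s u = 2" | "s v = 2" | "s u = 1" "s v = 1" by linarith
    then show ?thesis
    proof cases
      case 3
      then have "u \<in> Xs ! (i - 1)" "v \<in> Xs ! (i - 1)" "Xs ! (i - 1) \<in> set Xs" using Xs(1,4) uv assms(3) by auto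
      then show ?thesis by blast
    qed (use Xs(6) uv adj_sym in blast)+
  qed
  moreover have "\<exists>a b. {j. j < length Xs \<and> v \<in> Xs ! j} = {a..b}" if "v \<in> {..<n}" for v
  proof -
    let ?J = "{j. j < length Xs \<and> v \<in> Xs ! j}"
    have "v \<in> \<Union>(set Xs)" using Xs(3)[of v] assms(2) that by blast
    then have J: "finite ?J" "?J \<noteq> {}" by (auto simp: in_set_conv_nth)
    have "?J = {Min ?J..Max ?J}"
    proof (intro equalityI subsetI)
      fix j assume "j \<in> {Min ?J..Max ?J}"
      moreover have "Min ?J \<in> ?J" "Max ?J \<in> ?J" using J by (auto intro: Min_in Max_in simp del: mem_Collect_eq)
      ultimately show "j \<in> ?J" using Xs(5)[of "Min ?J" j "Max ?J" v] Xs(1) by auto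
    qed (use J in auto)
    then show ?thesis by blast
  qed
  ultimately show ?thesis
    using Xs(1,2) assms(3) unfolding path_decomposition_def by (intro exI[of _ Xs]) auto
qed

lemma pd_width_le_iff: "Xs \<noteq> [] \<Longrightarrow> pd_width Xs \<le> int k \<longleftrightarrow> (\<forall>X\<in>set Xs. card X \<le> Suc k)"
proof -
  assume "Xs \<noteq> []"
  then have "Max (card ` set Xs) \<le> Suc k \<longleftrightarrow> (\<forall>X\<in>set Xs. card X \<le> Suc k)" by (subst Max_le_iff) auto
  then show ?thesis unfolding pd_width_def by linarith
qed

text \<open>Repeating the last bag turns a size of at most \<open>z\<close> into an exact number of
  steps.\<close>

lemma MSPD_iff_sweep:
  assumes E: "\<And>u v. {u, v} \<in> E \<longleftrightarrow> u < n \<and> v < n \<and> adj u v"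
  shows "MSPD k {..<n} E z \<longleftrightarrow>
    0 < z \<and> (\<exists>s. sweep (nat (min z (int (n + n) + 1))) s \<and> (\<forall>v<n. s v \<noteq> 0))"
proof
  assume "MSPD k {..<n} E z"
  then obtain Xs where Xs: "path_decomposition {..<n} E Xs" "pd_width Xs \<le> int k" "int (length Xs) \<le> z"
    unfolding MSPD_def by blast
  then have ne: "Xs \<noteq> []" unfolding path_decomposition_def by blast
  obtain s where s: "sweep (length Xs) s" "\<forall>v<n. s v \<noteq> 0"
    using decomposition_imp_sweep[OF Xs(1)] Xs(2) pd_width_le_iff[OF ne] E by blast
  have "0 < length Xs" using ne by simp
  then have "0 < z" using Xs(3) by linarith
  have "sweep (nat (min z (int (n + n) + 1))) s"
  proof (cases "z \<le> int (n + n) + 1")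
    case True
    then show ?thesis using Xs(3) by (intro sweep_mono[OF s(1)]) linarith
  qed (rule sweep_cap[OF s(1)], linarith)
  then show "0 < z \<and> (\<exists>s. sweep (nat (min z (int (n + n) + 1))) s \<and> (\<forall>v<n. s v \<noteq> 0))"
    using s(2) \<open>0 < z\<close> by blast
next
  assume "0 < z \<and> (\<exists>s. sweep (nat (min z (int (n + n) + 1))) s \<and> (\<forall>v<n. s v \<noteq> 0))"
  then obtain s where s: "0 < z" "sweep (nat (min z (int (n + n) + 1))) s" "\<forall>v<n. s v \<noteq> 0" by blast
  obtain Xs where Xs: "path_decomposition {..<n} E Xs" "\<forall>X\<in>set Xs. card X \<le> Suc k"
    "length Xs = nat (min z (int (n + n) + 1))"
    using sweep_imp_decomposition[OF s(2,3), of E] s(1) E by auto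
  moreover have "Xs \<noteq> []" using Xs(1) unfolding path_decomposition_def by blast
  ultimately show "MSPD k {..<n} E z"
    unfolding MSPD_def using pd_width_le_iff s(1) by (intro exI[of _ Xs] conjI) (blast, blast, linarith)
qed


section \<open>Components of the graph without the bag\<close>

definition bag :: "(nat \<Rightarrow> nat) \<Rightarrow> nat set" where
  "bag s = {v. v < n \<and> s v = 1}"

definition linked :: "nat set \<Rightarrow> nat \<Rightarrow> nat \<Rightarrow> bool" where
  "linked X u v \<longleftrightarrow> u < n \<and> v < n \<and> u \<notin> X \<and> v \<notin> X \<and> adj u v"

definition component :: "nat set \<Rightarrow> nat \<Rightarrow> nat set" where
  "component X v = {u. (linked X)\<^sup>*\<^sup>* v u}"

lemma linked_sym: "linked X u v \<Longrightarrow> linked X v u"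
  unfolding linked_def using adj_sym by blast

lemma component_self: "v \<in> component X v"
  by (simp add: component_def)

lemma component_least:
  assumes "v \<in> S" "\<And>u w. u \<in> S \<Longrightarrow> linked X u w \<Longrightarrow> w \<in> S" shows "component X v \<subseteq> S"
proof
  fix u assume "u \<in> component X v"
  then have "(linked X)\<^sup>*\<^sup>* v u" by (simp add: component_def)
  then show "u \<in> S" by (induction rule: rtranclp_induct) (use assms in auto)
qed

lemma component_closed: "u \<in> component X v \<Longrightarrow> linked X u w \<Longrightarrow> w \<in> component X v"
  unfolding component_def by (simp add: rtranclp.rtrancl_into_rtrancl)

lemma component_sym: "u \<in> component X v \<Longrightarrow> v \<in> component X u"
proof -
  assume "u \<in> component X v"
  then have "(linked X)\<^sup>*\<^sup>* v u" by (simp add: component_def)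
  then have "(linked X)\<^sup>*\<^sup>* u v"
    by (induction rule: rtranclp_induct) (auto intro: converse_rtranclp_into_rtranclp linked_sym)
  then show ?thesis by (simp add: component_def)
qed

lemma component_eq:
  assumes "u \<in> component X v" shows "component X u = component X v"
proof
  show "component X u \<subseteq> component X v" by (rule component_least) (use assms component_closed in blast)+
  show "component X v \<subseteq> component X u" by (rule component_least) (use component_sym[OF assms] component_closed in blast)+
qed

lemma component_subset: "v < n \<Longrightarrow> v \<notin> X \<Longrightarrow> component X v \<subseteq> {..<n} - X"
  by (rule component_least) (auto simp: linked_def)

text \<open>Besides being an isomorphism, the map preserves the neighbours of each vertex in
  \<open>X\<close>. Exchanging two such disjoint components is then an automorphism that fixes
  \<open>X\<close>.\<close>

definition isomorphic :: "nat set \<Rightarrow> nat set \<Rightarrow> nat set \<Rightarrow> bool" where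
  "isomorphic X C D \<longleftrightarrow> (\<exists>f. bij_betw f C D \<and> (\<forall>u\<in>C. \<forall>w\<in>C. adj (f u) (f w) \<longleftrightarrow> adj u w) \<and>
     (\<forall>u\<in>C. \<forall>x\<in>X. adj x (f u) \<longleftrightarrow> adj x u))"

text \<open>The forgotten component of \<open>d\<close> could be exchanged for the isomorphic unseen component of the
  smaller vertex \<open>v\<close>.\<close>

definition improvable :: "nat \<Rightarrow> (nat \<Rightarrow> nat) \<Rightarrow> nat \<Rightarrow> bool" where
  "improvable m s v \<longleftrightarrow> v < n \<and> s v = 0 \<and> (\<forall>u\<in>component (bag s) v. v \<le> u) \<and> card (component (bag s) v) \<le> m \<and>
     (\<exists>d<n. s d = 2 \<and> (\<forall>u\<in>component (bag s) d. v < u) \<and> isomorphic (bag s) (component (bag s) v) (component (bag s) d))"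

definition canonical :: "nat \<Rightarrow> (nat \<Rightarrow> nat) \<Rightarrow> bool" where
  "canonical m s \<longleftrightarrow> (\<forall>v. \<not> improvable m s v)"

text \<open>A walk outside the bag meets no label 1, and a forgotten vertex has no unseen neighbour;
  hence label 2 propagates along the walk.\<close>

lemma sweep_component_forgotten:
  assumes "sweep i s" "v < n" "s v = 2" "u \<in> component (bag s) v" shows "u < n \<and> s u = 2"
proof -
  have "component (bag s) v \<subseteq> {u. u < n \<and> s u = 2}"
  proof (rule component_least)
    fix u w assume "u \<in> {u. u < n \<and> s u = 2}" "linked (bag s) u w"
    then have *: "u < n" "w < n" "s u = 2" "adj u w" "s w \<noteq> 1" by (auto simp: linked_def bag_def)
    then have "s w \<noteq> 0" "s w \<le> 2" using sweep_invariant[OF assms(1)] by blast+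
    then show "w \<in> {u. u < n \<and> s u = 2}" using * by simp
  qed (use assms in simp)
  then show ?thesis using assms(4) by blast
qed

lemma sweep_component_const:
  assumes "sweep i s" "v < n" "s v \<noteq> 1" "u \<in> component (bag s) v" shows "s u = 2 \<longleftrightarrow> s v = 2"
proof -
  have "u < n" using component_subset[of v "bag s"] assms by (auto simp: bag_def)
  then show ?thesis using sweep_component_forgotten[OF assms(1)] assms component_sym by blast
qed

subsection \<open>Words encoding components\<close>

definition layout :: "(nat \<Rightarrow> nat) \<Rightarrow> (nat \<Rightarrow> nat) \<Rightarrow> (nat \<Rightarrow> nat) \<Rightarrow> bool" where
  "layout s pos c \<longleftrightarrow> inj_on pos {v. v < n \<and> s v \<noteq> 0} \<and> (\<forall>v<n. s v \<noteq> 0 \<longrightarrow> c v \<le> k) \<and> inj_on c (bag s) \<and>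
     (\<forall>u<n. \<forall>v<n. \<forall>w<n. s u \<noteq> 0 \<longrightarrow> s v \<noteq> 0 \<longrightarrow> s w \<noteq> 0 \<longrightarrow> adj u v \<longrightarrow> pos u < pos w \<longrightarrow> pos w < pos v \<longrightarrow> c w \<noteq> c u) \<and>
     (\<forall>x\<in>bag s. \<forall>w<n. s w \<noteq> 0 \<longrightarrow> pos x < pos w \<longrightarrow> c w \<noteq> c x)"

lemma sweep_layout: "sweep i s \<Longrightarrow> \<exists>pos c. layout s pos c"
proof (induction rule: sweep.induct)
  case (sweep_0 s)
  then have "layout s (\<lambda>_. 0) (\<lambda>_. 0)" by (auto simp: layout_def bag_def inj_on_def)
  then show ?case by blast
next
  case (sweep_Suc i s t)
  then obtain pos c where L: "layout s pos c" by blast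
  note st = sweep_stepD[OF sweep_Suc.hyps(2)]
  define S where "S = {v. v < n \<and> s v \<noteq> 0}"
  define Y where "Y = {v. v < n \<and> s v = 0 \<and> t v = 1}"
  define K where "K = bag s \<inter> bag t"
  have fin: "finite S" "finite Y" "finite K" by (auto simp: S_def Y_def K_def bag_def)
  have S': "v < n \<and> t v \<noteq> 0 \<longleftrightarrow> v \<in> S \<or> v \<in> Y" for v using st(1)[of v] unfolding S_def Y_def by auto
  have bt: "bag t = K \<union> Y" using st(1) unfolding K_def Y_def bag_def by fastforce
  have disj: "S \<inter> Y = {}" "K \<inter> Y = {}" "K \<subseteq> S" unfolding S_def Y_def K_def bag_def by auto
  note KS = subsetD[OF disj(3)]
  have inj: "inj_on pos S" and ck: "\<And>v. v \<in> S \<Longrightarrow> c v \<le> k" and cinj: "inj_on c (bag s)"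
    and old: "\<And>u v w. u \<in> S \<Longrightarrow> v \<in> S \<Longrightarrow> w \<in> S \<Longrightarrow> adj u v \<Longrightarrow> pos u < pos w \<Longrightarrow> pos w < pos v \<Longrightarrow> c w \<noteq> c u"
    and live: "\<And>x w. x \<in> bag s \<Longrightarrow> w \<in> S \<Longrightarrow> pos x < pos w \<Longrightarrow> c w \<noteq> c x"
    using L unfolding layout_def S_def by simp_all blast
  obtain M where M: "\<And>v. v \<in> S \<Longrightarrow> pos v < M"
    using finite_imageI[OF fin(1), of pos] unfolding finite_nat_set_iff_bounded by blast
  have "card K + card Y \<le> Suc k"
    using st(2) card_Un_disjoint[OF fin(3,2) disj(2)] bt unfolding bag_def by simp
  moreover have "card ({..k} - c ` K) \<ge> Suc k - card K"
    using card_image_le[OF fin(3), of c] diff_card_le_card_Diff[of "c ` K" "{..k}"] fin(3) by simp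
  ultimately have "card Y \<le> card ({..k} - c ` K)" by linarith
  then obtain e where e: "e ` Y \<subseteq> {..k} - c ` K" "inj_on e Y"
    using card_le_inj[OF fin(2), of "{..k} - c ` K"] by auto
  \<comment> \<open>\<open>M\<close> exceeds all old positions, and adding \<open>v\<close>
    separates the new vertices from each other.\<close>
  define pos' where "pos' = (\<lambda>v. if v \<in> Y then M + v else pos v)"
  define c' where "c' = (\<lambda>v. if v \<in> Y then e v else c v)"
  have posS: "v \<in> S \<Longrightarrow> pos' v = pos v \<and> c' v = c v \<and> pos' v < M" for v
    using M disj unfolding pos'_def c'_def by auto
  have posY: "v \<in> Y \<Longrightarrow> pos' v = M + v \<and> c' v = e v" for v unfolding pos'_def c'_def by simp
  have "inj_on pos' (S \<union> Y)"
  proof (rule inj_onI)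
    fix u v assume uv: "u \<in> S \<union> Y" "v \<in> S \<union> Y" "pos' u = pos' v"
    then consider "u \<in> S" "v \<in> S" | "u \<in> Y" "v \<in> Y" | "u \<in> S" "v \<in> Y" | "u \<in> Y" "v \<in> S" by blast
    then show "u = v"
    proof cases
      case 1
      then show ?thesis using uv(3) posS[of u] posS[of v] inj_onD[OF inj, of u v] by simp
    next
      case 2
      then show ?thesis using uv(3) posY[of u] posY[of v] by simp
    next
      case 3
      then show ?thesis using uv(3) posS[of u] posY[of v] by simp
    next
      case 4
      then show ?thesis using uv(3) posS[of v] posY[of u] by simp
    qed
  qed
  moreover have "c' v \<le> k" if "v \<in> S \<union> Y" for v
  proof (cases "v \<in> Y")
    case True
    then show ?thesis using posY[of v] e(1) by auto
  next
    case False
    then show ?thesis using that posS[of v] ck[of v] by simp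
  qed
  moreover have "inj_on c' (K \<union> Y)"
  proof (rule inj_onI)
    fix u v assume uv: "u \<in> K \<union> Y" "v \<in> K \<union> Y" "c' u = c' v"
    then consider "u \<in> K" "v \<in> K" | "u \<in> Y" "v \<in> Y" | "u \<in> K" "v \<in> Y" | "u \<in> Y" "v \<in> K" by blast
    then show "u = v"
    proof cases
      case 1
      then have "c u = c v" "u \<in> bag s" "v \<in> bag s" using uv(3) posS[OF KS, of u] posS[OF KS, of v] unfolding K_def by auto
      then show ?thesis using cinj by (auto dest: inj_onD)
    next
      case 2
      then show ?thesis using uv(3) posY[of u] posY[of v] inj_onD[OF e(2), of u v] by simp
    next
      case 3
      then have "c' u \<in> c ` K" "c' v \<in> e ` Y" using posS[OF KS, of u] posY[of v] by auto
      then show ?thesis using e(1) uv(3) by auto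
    next
      case 4
      then have "c' v \<in> c ` K" "c' u \<in> e ` Y" using posS[OF KS, of v] posY[of u] by auto
      then show ?thesis using e(1) uv(3) by auto
    qed
  qed
  moreover have live': "c' w \<noteq> c' x" if h: "x \<in> K \<union> Y" "w \<in> S \<union> Y" "pos' x < pos' w" for x w
  proof -
    consider "x \<in> K" "w \<in> S" | "x \<in> K" "w \<in> Y" | "x \<in> Y" "w \<in> Y" | "x \<in> Y" "w \<in> S" using h by blast
    then show ?thesis
    proof cases
      case 1
      then show ?thesis using live[of x w] h(3) posS[OF KS, of x] posS[of w] unfolding K_def by auto
    next
      case 2
      then have "c' x \<in> c ` K" "c' w \<in> e ` Y" using posS[OF KS, of x] posY[of w] by auto
      then show ?thesis using e(1) by (metis DiffD2 subsetD)
    next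
      case 3
      then show ?thesis using h(3) posY[of x] posY[of w] inj_onD[OF e(2), of w x] by auto
    next
      case 4
      then show ?thesis using h(3) posY[of x] posS[of w] by linarith
    qed
  qed
  moreover have "c' w \<noteq> c' u" if h: "u \<in> S \<union> Y" "v \<in> S \<union> Y" "w \<in> S \<union> Y" "adj u v" "pos' u < pos' w" "pos' w < pos' v" for u v w
  proof (cases "v \<in> S")
    case True
    then have "pos' v < M" using posS by blast
    then have "u \<notin> Y" "w \<notin> Y" using h(5,6) posY[of u] posY[of w] by linarith+
    then have "u \<in> S" "w \<in> S" using h by blast+
    then show ?thesis using old[of u v w] True h posS[of u] posS[of v] posS[of w] by simp
  next
    case False
    then have v: "v \<in> Y" using h by blast
    \<comment> \<open>A vertex dropped by this step or earlier has no neighbour among the new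
      vertices, by the edge condition of the step. So \<open>u\<close> is still in the bag and its
      colour is reserved.\<close>
    have "u \<in> K \<union> Y"
    proof (cases "u \<in> Y")
      case False
      then have u: "u < n" "s u \<noteq> 0" using h(1) unfolding S_def by auto
      have "t u \<noteq> 2" using st(3)[of u v] u v h(4) unfolding Y_def by auto
      then show ?thesis using st(1)[OF u(1)] u unfolding K_def bag_def by auto
    qed simp
    then show ?thesis using live' h by blast
  qed
  moreover have SY: "v \<in> S \<union> Y" if "v < n" "t v \<noteq> 0" for v using S' that by blast
  moreover have S_Y: "{v. v < n \<and> t v \<noteq> 0} = S \<union> Y" using S' by blast
  ultimately have "layout t pos' c'"
    unfolding layout_def bt S_Y by (intro conjI allI impI ballI) (blast intro: SY)+
  then show ?case by blast
qed

text \<open>A letter consists of a colour, the colours of earlier neighbours and the neighbours in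
  \<open>X\<close>. Position \<open>j\<close> refers through a colour to the last earlier position
  that carries it.\<close>

definition decodes_edge :: "(nat \<times> nat set \<times> nat set) list \<Rightarrow> nat \<Rightarrow> nat \<Rightarrow> bool" where
  "decodes_edge w i j \<longleftrightarrow> fst (w ! i) \<in> fst (snd (w ! j)) \<and> (\<forall>l. i < l \<longrightarrow> l < j \<longrightarrow> fst (w ! l) \<noteq> fst (w ! i))"

definition encodes :: "nat set \<Rightarrow> nat set \<Rightarrow> (nat \<times> nat set \<times> nat set) list \<Rightarrow> bool" where
  "encodes X D w \<longleftrightarrow> (\<exists>ds. distinct ds \<and> set ds = D \<and> length w = length ds \<and>
     (\<forall>j<length ds. \<forall>i<j. adj (ds ! i) (ds ! j) \<longleftrightarrow> decodes_edge w i j) \<and>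
     (\<forall>j<length ds. snd (snd (w ! j)) = {x\<in>X. adj x (ds ! j)}))"

definition words :: "nat \<Rightarrow> nat set \<Rightarrow> (nat \<times> nat set \<times> nat set) list set" where
  "words m X = {w. set w \<subseteq> {..k} \<times> Pow {..k} \<times> Pow X \<and> length w \<le> m}"

text \<open>If the vertices are listed in the order of introduction, no colour returns between a
  vertex and a later neighbour. This remains true for every subset \<open>D\<close> of the seen
  vertices, so the positions outside \<open>D\<close> may be skipped.\<close>

lemma word_exists:
  assumes "sweep i s" and D: "D \<subseteq> {v. v < n \<and> s v \<noteq> 0}" and "card D \<le> m"
  shows "\<exists>w\<in>words m X. encodes X D w"
proof -
  obtain pos c where L: "layout s pos c" using sweep_layout[OF assms(1)] by blast
  have fin: "finite D" using D by (rule finite_subset) simp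
  define ds where "ds = sort_key pos (sorted_list_of_set D)"
  define w where "w = map (\<lambda>j. (c (ds ! j), {c (ds ! i) | i. i < j \<and> adj (ds ! i) (ds ! j)}, {x\<in>X. adj x (ds ! j)})) [0..<length ds]"
  have ds: "distinct ds" "set ds = D" using fin unfolding ds_def by simp_all
  have len: "length ds = card D" using ds distinct_card by fastforce
  have inD: "ds ! i \<in> D" if "i < length ds" for i using ds that by auto
  have srt: "pos (ds ! i) < pos (ds ! j)" if "i < j" "j < length ds" for i j
  proof -
    have "sorted (map pos ds)" unfolding ds_def by simp
    then have "pos (ds ! i) \<le> pos (ds ! j)" using that sorted_nth_mono[of "map pos ds" i j] by simp
    moreover have "ds ! i \<noteq> ds ! j" using ds(1) that by (simp add: nth_eq_iff_index_eq)
    moreover have "inj_on pos D" using L D unfolding layout_def by (auto intro: inj_on_subset)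
    ultimately show ?thesis using inD[of i] inD[of j] that by (metis inj_onD le_neq_implies_less less_trans)
  qed
  have col': "c w \<noteq> c u" if "u \<in> D" "v \<in> D" "w \<in> D" "adj u v" "pos u < pos w" "pos w < pos v" for u v w
    by (rule L[unfolded layout_def, THEN conjunct2, THEN conjunct2, THEN conjunct2, THEN conjunct1, rule_format, of u v w])
      (use D that in auto)
  have col: "c (ds ! l) \<noteq> c (ds ! i)" if "i < l" "l < j" "j < length ds" "adj (ds ! i) (ds ! j)" for i l j
    by (rule col'[of _ "ds ! j"]) (use inD srt that in auto)
  have dec: "adj (ds ! i) (ds ! j) \<longleftrightarrow> decodes_edge w i j" if ij: "i < j" "j < length ds" for i j
  proof
    assume "adj (ds ! i) (ds ! j)"
    then show "decodes_edge w i j" using ij col unfolding decodes_edge_def w_def by auto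
  next
    \<comment> \<open>The colour listed at \<open>j\<close> stems from some neighbour
      \<open>i'\<close>. If \<open>i'\<close> came after \<open>i\<close>, the colour would recur in
      between, against the decoding rule; if before, against the colouring.\<close>
    assume d: "decodes_edge w i j"
    then obtain i' where i': "c (ds ! i) = c (ds ! i')" "i' < j" "adj (ds ! i') (ds ! j)"
      using ij unfolding decodes_edge_def w_def by auto
    have "\<not> i < i'"
    proof
      assume "i < i'"
      then have "fst (w ! i') \<noteq> fst (w ! i)" using d i' unfolding decodes_edge_def by blast
      then show False using i' ij unfolding w_def by simp
    qed
    moreover have "\<not> i' < i" using col[of i' i j] i' ij by auto
    ultimately have "i = i'" by simp
    then show "adj (ds ! i) (ds ! j)" using i' by simp
  qed
  have "c (ds ! j) \<le> k" if "j < length ds" for j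
    using L D inD[OF that] unfolding layout_def by auto
  then have "set w \<subseteq> {..k} \<times> Pow {..k} \<times> Pow X" unfolding w_def by auto
  then have "w \<in> words m X" using len assms(3) unfolding words_def w_def by simp
  moreover have "encodes X D w"
    unfolding encodes_def by (rule exI[of _ ds]) (use ds dec in \<open>auto simp: w_def\<close>)
  ultimately show ?thesis by blast
qed

text \<open>Vertices at equal positions correspond. A graph may have many words, but a common word
  forces an isomorphism, which is enough to bound the number of types from above.\<close>

lemma encodes_isomorphic:
  assumes "encodes X C w" "encodes X D w" shows "isomorphic X C D"
proof -
  obtain cs where cs: "distinct cs" "set cs = C" "length w = length cs"
    "\<And>i j. j < length cs \<Longrightarrow> i < j \<Longrightarrow> adj (cs ! i) (cs ! j) \<longleftrightarrow> decodes_edge w i j"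
    "\<And>j. j < length cs \<Longrightarrow> snd (snd (w ! j)) = {x\<in>X. adj x (cs ! j)}"
    using assms(1) unfolding encodes_def by blast
  obtain ds where ds: "distinct ds" "set ds = D" "length w = length ds"
    "\<And>i j. j < length ds \<Longrightarrow> i < j \<Longrightarrow> adj (ds ! i) (ds ! j) \<longleftrightarrow> decodes_edge w i j"
    "\<And>j. j < length ds \<Longrightarrow> snd (snd (w ! j)) = {x\<in>X. adj x (ds ! j)}"
    using assms(2) unfolding encodes_def by blast
  let ?I = "{..<length cs}"
  have bc: "bij_betw ((!) cs) ?I C" using cs bij_betw_nth by blast
  have bd: "bij_betw ((!) ds) ?I D" using ds cs(3) bij_betw_nth by metis
  define f where "f = (\<lambda>u. ds ! inv_into ?I ((!) cs) u)"
  have "bij_betw f C D"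
    using bij_betw_trans[OF bij_betw_inv_into[OF bc] bd] unfolding f_def by (simp add: o_def)
  moreover have f: "f (cs ! i) = ds ! i" if "i < length cs" for i
    using bij_betw_inv_into_left[OF bc, of i] that unfolding f_def by simp
  moreover have "adj (f u) (f v) \<longleftrightarrow> adj u v" if uv: "u \<in> C" "v \<in> C" for u v
  proof -
    obtain i j where ij: "i < length cs" "j < length cs" "u = cs ! i" "v = cs ! j"
      using uv cs(2) by (metis in_set_conv_nth)
    consider "i < j" | "j < i" | "i = j" by linarith
    then show ?thesis
    proof cases
      case 1
      then show ?thesis using ij f cs(3,4) ds(3,4) by simp
    next
      case 2
      then have "adj (f v) (f u) \<longleftrightarrow> adj v u" using ij f cs(3,4) ds(3,4) by simp
      then show ?thesis using adj_sym by blast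
    next
      case 3
      then show ?thesis using ij adj_irrefl by simp
    qed
  qed
  moreover have "adj x (f u) \<longleftrightarrow> adj x u" if u: "u \<in> C" "x \<in> X" for u x
  proof -
    obtain i where i: "i < length cs" "u = cs ! i" using u cs(2) by (metis in_set_conv_nth)
    then have "{x\<in>X. adj x (cs ! i)} = {x\<in>X. adj x (ds ! i)}" using cs(3,5) ds(3,5) by simp
    then show ?thesis using i f u(2) by auto
  qed
  ultimately show ?thesis unfolding isomorphic_def by blast
qed


subsection \<open>Counting canonical states\<close>

definition alphabet_size :: nat where
  "alphabet_size = Suc k * 2 ^ Suc k * 2 ^ Suc k"

definition minima :: "nat set \<Rightarrow> nat set" where
  "minima X = {v. v < n \<and> v \<notin> X \<and> (\<forall>u\<in>component X v. v \<le> u)}"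

text \<open>The choice depends on the bag and the component but not on the state. Types can
  therefore be compared between two states with the same bag, provided that the component is
  forgotten in one of them.\<close>

definition word_of :: "nat \<Rightarrow> nat set \<Rightarrow> nat \<Rightarrow> (nat \<times> nat set \<times> nat set) list" where
  "word_of m X v = (SOME w. w \<in> words m X \<and> encodes X (component X v) w)"

definition of_type :: "nat \<Rightarrow> (nat \<Rightarrow> nat) \<Rightarrow> (nat \<times> nat set \<times> nat set) list \<Rightarrow> nat set" where
  "of_type m s w = {v \<in> minima (bag s). card (component (bag s) v) \<le> m \<and> s v = 2 \<and> word_of m (bag s) v = w}"

definition big_minima :: "nat \<Rightarrow> nat set \<Rightarrow> nat set" where
  "big_minima m X = {v \<in> minima X. m < card (component X v)}"

text \<open>Large components are recorded individually, small ones only by their number per type.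
  The restriction makes the second part an element of a finite function space.\<close>

definition signature :: "nat \<Rightarrow> (nat \<Rightarrow> nat) \<Rightarrow> nat set \<times> ((nat \<times> nat set \<times> nat set) list \<Rightarrow> nat)" where
  "signature m s = ({v \<in> big_minima m (bag s). s v = 2}, restrict (\<lambda>w. card (of_type m s w)) (words m (bag s)))"

lemma finite_minima: "finite (minima X)"
  unfolding minima_def by simp

lemma minima_exists:
  assumes "v < n" "v \<notin> X" shows "\<exists>u \<in> minima X. u \<in> component X v \<and> component X u = component X v"
proof -
  have fin: "finite (component X v)" "component X v \<noteq> {}"
    using finite_subset[OF component_subset[OF assms]] component_self by auto
  let ?u = "Min (component X v)"
  have u: "?u \<in> component X v" using fin by (rule Min_in)
  then have "component X ?u = component X v" by (rule component_eq)
  moreover have "?u < n" "?u \<notin> X" using u component_subset[OF assms] by auto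
  ultimately have "?u \<in> minima X" unfolding minima_def using Min_le[OF fin(1)] by simp
  then show ?thesis using u component_eq by blast
qed

lemma word_of_properties:
  assumes "sweep i s" "v \<in> minima (bag s)" "card (component (bag s) v) \<le> m" "s v = 2"
  shows "word_of m (bag s) v \<in> words m (bag s)" "encodes (bag s) (component (bag s) v) (word_of m (bag s) v)"
proof -
  have "v < n" using assms(2) unfolding minima_def by simp
  then have "component (bag s) v \<subseteq> {u. u < n \<and> s u \<noteq> 0}"
    using sweep_component_forgotten[OF assms(1) _ assms(4)] by auto
  then have "\<exists>w. w \<in> words m (bag s) \<and> encodes (bag s) (component (bag s) v) w"
    using word_exists[OF assms(1) _ assms(3)] by blast
  then have "word_of m (bag s) v \<in> words m (bag s) \<and> encodes (bag s) (component (bag s) v) (word_of m (bag s) v)"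
    unfolding word_of_def by (rule someI_ex)
  then show "word_of m (bag s) v \<in> words m (bag s)" "encodes (bag s) (component (bag s) v) (word_of m (bag s) v)"
    by blast+
qed

text \<open>If a small component is forgotten in \<open>s\<close> but not in \<open>t\<close>, equal
  counts yield another one of the same type that is forgotten in \<open>t\<close> but not in
  \<open>s\<close>. Whichever has the smaller least vertex is unseen in one state, where the other
  is forgotten; so that state is improvable.\<close>

lemma signature_forgotten:
  assumes s: "sweep i s" "canonical m s" and t: "sweep j t" "canonical m t"
    and bag: "bag s = bag t" and sig: "signature m s = signature m t" and v: "v < n" "s v = 2"
  shows "t v = 2"
proof (rule ccontr)
  assume "t v \<noteq> 2"
  define X where "X = bag s"
  have XT: "X = bag t" using bag X_def by simp
  have vX: "v \<notin> X" using v unfolding X_def bag_def by simp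
  then have tv1: "t v \<noteq> 1" using v(1) unfolding XT bag_def by simp
  obtain u where u: "u \<in> minima X" "u \<in> component X v" using minima_exists[OF v(1) vX] by blast
  have su: "s u = 2" using sweep_component_const[OF s(1) v(1)] v u unfolding X_def by simp
  have tu: "t u \<noteq> 2" using sweep_component_const[OF t(1) v(1) tv1] u \<open>t v \<noteq> 2\<close> unfolding XT by simp
  have zero: "r x = 0" if "sweep l r" "bag r = X" "x \<in> minima X" "r x \<noteq> 2" for l r x
  proof -
    have "x < n" "r x \<noteq> 1" using that unfolding minima_def bag_def by auto
    then have "r x \<le> 2" "r x \<noteq> 1" using sweep_invariant[OF that(1)] by auto
    then show ?thesis using that(4) by linarith
  qed
  have sig1: "{v \<in> big_minima m X. s v = 2} = {v \<in> big_minima m X. t v = 2}"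
    and sig2: "restrict (\<lambda>w. card (of_type m s w)) (words m X) = restrict (\<lambda>w. card (of_type m t w)) (words m X)"
    using sig XT[symmetric] X_def[symmetric] unfolding signature_def by simp_all
  have small: "card (component X u) \<le> m"
  proof (rule ccontr)
    assume "\<not> card (component X u) \<le> m"
    then have "u \<in> big_minima m X" using u unfolding big_minima_def by simp
    then show False using sig1 su tu by blast
  qed
  define w where "w = word_of m X u"
  have w: "w \<in> words m X" "encodes X (component X u) w"
    using word_of_properties[OF s(1), of u m] u small su unfolding w_def X_def by simp_all
  have "card (of_type m s w) = card (of_type m t w)" using fun_cong[OF sig2, of w] w(1) by simp
  moreover have fin: "finite (of_type m s w)" "finite (of_type m t w)"
    unfolding of_type_def using finite_minima by simp_all
  moreover have us: "u \<in> of_type m s w" "u \<notin> of_type m t w"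
    unfolding of_type_def using u(1) small su tu w_def X_def XT by simp_all
  \<comment> \<open>Otherwise it would be a proper subset, lacking \<open>u\<close>, of a finite set
    of the same cardinality.\<close>
  ultimately have "\<not> of_type m t w \<subseteq> of_type m s w"
    using psubset_card_mono[of "of_type m s w" "of_type m t w"] by auto
  then obtain u' where u': "u' \<in> of_type m t w" "u' \<notin> of_type m s w" by blast
  then have u'X: "u' \<in> minima X" "card (component X u') \<le> m" "t u' = 2" "word_of m X u' = w"
    unfolding of_type_def XT by simp_all
  have "s u' \<noteq> 2" using u' u'X unfolding of_type_def X_def by auto
  have w': "encodes X (component X u') w"
    using word_of_properties(2)[OF t(1), of u' m] u'X unfolding XT by simp
  have n: "u < n" "u' < n" using u u'X unfolding minima_def by auto
  have "u \<noteq> u'" using us u' by blast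
  then consider "u < u'" | "u' < u" by linarith
  then show False
  proof cases
    case 1
    have "improvable m t u"
      unfolding improvable_def
      using 1 n zero[OF t(1) _ u(1) tu] u(1) small u'X encodes_isomorphic[OF w(2) w']
      unfolding XT minima_def by (intro conjI exI[of _ u']) auto
    then show False using t(2) unfolding canonical_def by blast
  next
    case 2
    have "improvable m s u'"
      unfolding improvable_def
      using 2 n zero[OF s(1) _ u'X(1) \<open>s u' \<noteq> 2\<close>] u(1) su u'X encodes_isomorphic[OF w' w(2)]
      unfolding X_def minima_def by (intro conjI exI[of _ u]) auto
    then show False using s(2) unfolding canonical_def by blast
  qed
qed

lemma signature_inj:
  assumes s: "sweep i s" "canonical m s" and t: "sweep j t" "canonical m t"
    and bag: "bag s = bag t" and sig: "signature m s = signature m t" and v: "v < n"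
  shows "s v = t v"
proof -
  have 1: "s v = 1 \<longleftrightarrow> t v = 1" using bag v unfolding bag_def by blast
  have 2: "s v = 2 \<longleftrightarrow> t v = 2"
    using signature_forgotten[OF s t bag sig v] signature_forgotten[OF t s bag[symmetric] sig[symmetric] v] by blast
  have "s v \<le> 2" "t v \<le> 2" using sweep_invariant[OF s(1)] sweep_invariant[OF t(1)] v by auto
  then show ?thesis using 1 2 by linarith
qed

lemma card_big_minima: "card (big_minima m X) \<le> n div Suc m"
proof -
  have fin: "finite (component X v)" if "v \<in> big_minima m X" for v
    using that finite_subset[OF component_subset[of v X]] unfolding big_minima_def minima_def by auto
  have disj: "component X u \<inter> component X v = {}" if "u \<in> big_minima m X" "v \<in> big_minima m X" "u \<noteq> v" for u v
  proof (rule ccontr)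
    assume "component X u \<inter> component X v \<noteq> {}"
    then obtain w where "w \<in> component X u" "w \<in> component X v" by blast
    then have "component X u = component X v" using component_eq by metis
    then have "u \<in> component X v" "v \<in> component X u" using component_self by auto
    then show False using that unfolding big_minima_def minima_def by fastforce
  qed
  have "card (big_minima m X) * Suc m = (\<Sum>v\<in>big_minima m X. Suc m)" by simp
  also have "\<dots> \<le> (\<Sum>v\<in>big_minima m X. card (component X v))"
    by (rule sum_mono) (simp add: big_minima_def)
  also have "\<dots> = card (\<Union>v\<in>big_minima m X. component X v)"
    using fin disj finite_minima by (intro card_UN_disjoint[symmetric]) (auto simp: big_minima_def)
  also have "\<dots> \<le> card {..<n}"
  proof (rule card_mono)
    show "(\<Union>v\<in>big_minima m X. component X v) \<subseteq> {..<n}"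
      using component_subset[of _ X] unfolding big_minima_def minima_def by blast
  qed simp
  finally show ?thesis by (simp add: less_eq_div_iff_mult_less_eq)
qed

lemma card_words:
  assumes "finite X" "card X \<le> Suc k"
  shows "finite (words m X)" "card (words m X) \<le> alphabet_size ^ Suc m"
proof -
  let ?A = "{..k} \<times> Pow {..k} \<times> Pow X"
  have fin: "finite ?A" using assms by simp
  have "card ?A = Suc k * 2 ^ Suc k * 2 ^ card X" using assms(1) by (simp add: card_cartesian_product card_Pow algebra_simps)
  also have "\<dots> \<le> alphabet_size"
    unfolding alphabet_size_def using assms(2) by (intro mult_left_mono power_increasing) auto
  finally have le: "card ?A \<le> alphabet_size" .
  have "0 < Suc k * 2 ^ Suc k" "(2::nat) \<le> 2 ^ Suc k" by simp_all
  then have two: "2 \<le> alphabet_size"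
    unfolding alphabet_size_def using mult_le_mono[of 1 "Suc k * 2 ^ Suc k" 2 "2 ^ Suc k"] by linarith
  show "finite (words m X)" unfolding words_def by (rule finite_lists_length_le[OF fin])
  have "card (words m X) = (\<Sum>i\<le>m. card ?A ^ i)" unfolding words_def by (rule card_lists_length_le[OF fin])
  also have "\<dots> \<le> (\<Sum>i\<le>m. alphabet_size ^ i)" using le by (intro sum_mono power_mono) auto
  also have "\<dots> \<le> alphabet_size ^ Suc m"
  proof (induction m)
    case 0
    then show ?case using two by simp
  next
    case (Suc m)
    have "alphabet_size ^ Suc m + alphabet_size ^ Suc m \<le> alphabet_size ^ Suc (Suc m)"
      using mult_le_mono1[OF two, of "alphabet_size ^ Suc m"] unfolding power_Suc[of _ "Suc m"] by linarith
    then show ?case using Suc by simp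
  qed
  finally show "card (words m X) \<le> alphabet_size ^ Suc m" .
qed

lemma enumerate_bag:
  assumes "X \<subseteq> {..<n}" "card X \<le> Suc k"
  shows "\<exists>bs. length bs = Suc k \<and> set bs \<subseteq> {..n} \<and> set bs \<inter> {..<n} = X"
proof -
  have "finite X" using assms(1) finite_subset by blast
  then show ?thesis
    using assms by (intro exI[of _ "sorted_list_of_set X @ replicate (Suc k - card X) n"]) auto
qed

definition canonical_states :: "nat \<Rightarrow> nat list set" where
  "canonical_states m = {a. length a = n \<and> (\<exists>i. sweep i ((!) a)) \<and> canonical m ((!) a)}"

text \<open>The factors count the bags, the sets of forgotten large components, and the functions
  from words to numbers of forgotten small components.\<close>

definition state_bound :: "nat \<Rightarrow> nat" where
  "state_bound m = Suc n ^ Suc k * (2 ^ (n div Suc m) * Suc n ^ (alphabet_size ^ Suc m))"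

text \<open>For a fixed bag, \<open>signature\<close> is injective on canonical states with values
  in a finite product; the bound follows by summing over the bags.\<close>

lemma card_canonical_states:
  "finite (canonical_states m) \<and> card (canonical_states m) \<le> state_bound m"
proof -
  let ?BS = "{bs. set bs \<subseteq> {..n} \<and> length bs = Suc k}"
  let ?Bags = "(\<lambda>bs. set bs \<inter> {..<n}) ` ?BS"
  let ?Z = "\<lambda>X. {a \<in> canonical_states m. bag ((!) a) = X}"
  have finBS: "finite ?BS" by (rule finite_lists_length_eq) simp
  have "card ?Bags \<le> Suc n ^ Suc k"
    using card_image_le[OF finBS, of "\<lambda>bs. set bs \<inter> {..<n}"] card_lists_length_eq[of "{..n}" "Suc k"] by simp
  have sub: "canonical_states m \<subseteq> (\<Union>X\<in>{X \<in> ?Bags. card X \<le> Suc k}. ?Z X)"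
  proof
    fix a assume a: "a \<in> canonical_states m"
    then obtain i where "sweep i ((!) a)" unfolding canonical_states_def by blast
    then have "card (bag ((!) a)) \<le> Suc k" using sweep_invariant unfolding bag_def by blast
    moreover have "bag ((!) a) \<subseteq> {..<n}" unfolding bag_def by auto
    ultimately obtain bs where "length bs = Suc k" "set bs \<subseteq> {..n}" "set bs \<inter> {..<n} = bag ((!) a)"
      using enumerate_bag by blast
    then have "bag ((!) a) \<in> ?Bags" by blast
    then show "a \<in> (\<Union>X\<in>{X \<in> ?Bags. card X \<le> Suc k}. ?Z X)" using a \<open>card (bag ((!) a)) \<le> Suc k\<close> by blast
  qed
  have Z: "finite (?Z X) \<and> card (?Z X) \<le> 2 ^ (n div Suc m) * Suc n ^ (alphabet_size ^ Suc m)"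
    if X: "finite X" "card X \<le> Suc k" for X
  proof -
    let ?R = "Pow (big_minima m X) \<times> (words m X \<rightarrow>\<^sub>E {..n})"
    have finbm: "finite (big_minima m X)" unfolding big_minima_def using finite_minima by simp
    note W = card_words[OF X]
    have finR: "finite ?R" using finbm W(1) by (intro finite_cartesian_product finite_PiE) auto
    have "card ?R = 2 ^ card (big_minima m X) * Suc n ^ card (words m X)"
      using finbm W(1) by (simp add: card_cartesian_product card_Pow card_PiE)
    also have "\<dots> \<le> 2 ^ (n div Suc m) * Suc n ^ (alphabet_size ^ Suc m)"
      using card_big_minima W(2) by (intro mult_mono power_increasing) auto
    finally have cR: "card ?R \<le> 2 ^ (n div Suc m) * Suc n ^ (alphabet_size ^ Suc m)" .
    have inj: "inj_on (\<lambda>a. signature m ((!) a)) (?Z X)"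
    proof (rule inj_onI)
      fix a b assume h: "a \<in> ?Z X" "b \<in> ?Z X" "signature m ((!) a) = signature m ((!) b)"
      then obtain i j where "length a = n" "length b = n" "sweep i ((!) a)" "sweep j ((!) b)"
        "canonical m ((!) a)" "canonical m ((!) b)" "bag ((!) a) = bag ((!) b)"
        unfolding canonical_states_def by blast
      with h(3) show "a = b" by (intro nth_equalityI) (metis, metis signature_inj)
    qed
    have img: "(\<lambda>a. signature m ((!) a)) ` ?Z X \<subseteq> ?R"
    proof (rule image_subsetI)
      fix a assume "a \<in> ?Z X"
      then have "bag ((!) a) = X" by blast
      moreover have "card (of_type m ((!) a) w) \<le> n" for w
      proof -
        have "of_type m ((!) a) w \<subseteq> {..<n}" unfolding of_type_def minima_def by auto
        then show ?thesis using card_mono[of "{..<n}"] by fastforce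
      qed
      ultimately show "signature m ((!) a) \<in> ?R"
        unfolding signature_def by auto
    qed
    show ?thesis using inj_on_finite[OF inj img finR] card_inj_on_le[OF inj img finR] cR by linarith
  qed
  let ?B = "{X \<in> ?Bags. card X \<le> Suc k}"
  have finB: "finite ?B" using finBS by simp
  have ZB: "finite (?Z X) \<and> card (?Z X) \<le> 2 ^ (n div Suc m) * Suc n ^ (alphabet_size ^ Suc m)" if "X \<in> ?B" for X
    by (rule Z) (use that in auto)
  have finU: "finite (\<Union>X\<in>?B. ?Z X)" using finB ZB by blast
  have "card (\<Union>X\<in>?B. ?Z X) \<le> (\<Sum>X\<in>?B. card (?Z X))" by (rule card_UN_le[OF finB])
  also have "\<dots> \<le> (\<Sum>X\<in>?B. 2 ^ (n div Suc m) * Suc n ^ (alphabet_size ^ Suc m))" by (rule sum_mono) (use ZB in blast)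
  also have "\<dots> = card ?B * (2 ^ (n div Suc m) * Suc n ^ (alphabet_size ^ Suc m))" by simp
  also have "\<dots> \<le> state_bound m"
    unfolding state_bound_def
  proof (rule mult_right_mono)
    have "card ?B \<le> card ?Bags" using finBS by (intro card_mono) auto
    then show "card ?B \<le> Suc n ^ Suc k" using \<open>card ?Bags \<le> Suc n ^ Suc k\<close> by linarith
  qed simp
  finally show ?thesis using finite_subset[OF sub finU] card_mono[OF finU sub] by linarith
qed

end

subsection \<open>Exchanging isomorphic components\<close>

lemma apply_swaps_simps [simp]:
  "apply_swaps [] v = v"
  "apply_swaps (p # ps) v = (if v = fst p then snd p else if v = snd p then fst p else apply_swaps ps v)"
  by (simp_all add: apply_swaps_def)

text \<open>Since \<open>C\<close> and its image are disjoint and \<open>g\<close> is injective, a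
  vertex determines the pair that contains it. Order and repetition of the pairs are therefore
  immaterial.\<close>

lemma apply_swaps_graph:
  assumes "set ps \<subseteq> (\<lambda>x. (x, g x)) ` C" "inj_on g C" "C \<inter> g ` C = {}"
  shows "apply_swaps ps u = (if u \<in> fst ` set ps then g u else if u \<in> snd ` set ps then the_inv_into C g u else u)"
  using assms(1)
proof (induction ps)
  case (Cons p ps)
  then obtain x where x: "p = (x, g x)" "x \<in> C" by auto
  have 1: "the_inv_into C g (g x) = x" using the_inv_into_f_f[OF assms(2) x(2)] .
  have "fst ` set ps \<subseteq> C" using Cons.prems by force
  then have 2: "g x \<notin> fst ` set ps" "x \<noteq> g x" using assms(3) x(2) by blast+
  show ?case using Cons x 1 2 by auto
qed simp

context bounded_sweep
begin

text \<open>An automorphism fixing \<open>X\<close> pointwise preserves adjacency outside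
  \<open>X\<close>, which gives one inclusion; applying it to the image and using that
  \<open>f\<close> is an involution gives the other.\<close>

lemma involution_component:
  assumes "\<And>u. u < n \<Longrightarrow> f u < n \<and> f (f u) = u" "\<And>u w. u < n \<Longrightarrow> w < n \<Longrightarrow> adj (f u) (f w) \<longleftrightarrow> adj u w"
    and "\<And>u. u \<in> X \<Longrightarrow> f u = u" "X \<subseteq> {..<n}" "d < n" "d \<notin> X"
  shows "component X (f d) = f ` component X d"
proof -
  have fX: "f u \<notin> X" if "u < n" "u \<notin> X" for u using assms(1)[OF that(1)] assms(3)[of "f u"] that by auto
  have link: "linked X (f u) (f w)" if "linked X u w" for u w
    using that assms(1,2) fX unfolding linked_def by blast
  have sub: "f ` component X v \<subseteq> component X (f v)" for v
  proof -
    have "component X v \<subseteq> {u. f u \<in> component X (f v)}"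
      by (rule component_least) (auto simp: component_self intro: component_closed link)
    then show ?thesis by blast
  qed
  have "component X (f d) \<subseteq> {..<n}" using component_subset[of "f d" X] assms(1,5) fX[OF assms(5,6)] by blast
  then have "component X (f d) = f ` f ` component X (f d)"
    using assms(1) by (force simp: image_image)
  also have "\<dots> \<subseteq> f ` component X d" using sub[of "f d"] assms(1)[OF assms(5)] by auto
  finally show ?thesis using sub[of d] by blast
qed

lemma involution_symmetry:
  assumes "\<And>u. u < n \<Longrightarrow> f u < n \<and> f (f u) = u" "\<And>u w. u < n \<Longrightarrow> w < n \<Longrightarrow> adj (f u) (f w) \<longleftrightarrow> adj u w"
  shows "symmetry f"
proof -
  have "bij_betw f {..<n} {..<n}" by (rule bij_betw_byWitness[where f' = f]) (use assms(1) in auto)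
  then show ?thesis using assms(2) unfolding symmetry_def by blast
qed

lemma isomorphic_image:
  assumes "isomorphic X C D" "inj_on f D" "\<And>u w. u \<in> D \<Longrightarrow> w \<in> D \<Longrightarrow> adj (f u) (f w) \<longleftrightarrow> adj u w"
    and "\<And>u x. u \<in> D \<Longrightarrow> x \<in> X \<Longrightarrow> adj x (f u) \<longleftrightarrow> adj x u"
  shows "isomorphic X C (f ` D)"
proof -
  obtain g where g: "bij_betw g C D" "\<forall>u\<in>C. \<forall>w\<in>C. adj (g u) (g w) \<longleftrightarrow> adj u w" "\<forall>u\<in>C. \<forall>x\<in>X. adj x (g u) \<longleftrightarrow> adj x u"
    using assms(1) unfolding isomorphic_def by blast
  have gD: "g u \<in> D" if "u \<in> C" for u using g(1) that bij_betwE by blast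
  have "bij_betw (f \<circ> g) C (f ` D)" 
    by (rule bij_betw_trans[OF g(1)]) (simp add: bij_betw_def assms(2))
  then show ?thesis unfolding isomorphic_def using g(2,3) assms(3,4) gD by (intro exI[of _ "f \<circ> g"]) simp
qed

text \<open>A later exchange only moves vertices \<open>\<ge> v\<close>, so it cannot create a possible improvement at an earlier
  vertex: the forgotten component used there would be the image of one that was already available.\<close>

lemma improvable_before_swap:
  assumes f: "\<And>u. u < n \<Longrightarrow> f u < n \<and> f (f u) = u" "\<And>u w. u < n \<Longrightarrow> w < n \<Longrightarrow> adj (f u) (f w) \<longleftrightarrow> adj u w"
    and moved: "\<And>u. u < n \<Longrightarrow> f u \<noteq> u \<Longrightarrow> s u \<noteq> 1 \<and> v \<le> u"
    and imp: "improvable m (\<lambda>u. s (f u)) v0" and "v0 < v"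
  shows "improvable m s v0"
proof -
  let ?t = "\<lambda>u. s (f u)" let ?X = "bag s"
  have fX: "f u = u" if "u \<in> ?X" for u using moved[of u] that unfolding bag_def by auto
  have bt: "bag ?t = ?X"
  proof -
    have "s (f u) = 1 \<longleftrightarrow> s u = 1" if "u < n" for u
      using moved[of u] moved[of "f u"] f(1)[OF that] that by (cases "f u = u") (simp, metis)
    then show ?thesis unfolding bag_def by auto
  qed
  obtain d where v0: "v0 < n" "s (f v0) = 0" "\<forall>u\<in>component ?X v0. v0 \<le> u" "card (component ?X v0) \<le> m"
    and d: "d < n" "s (f d) = 2" "\<forall>u\<in>component ?X d. v0 < u" "isomorphic ?X (component ?X v0) (component ?X d)"
    using imp unfolding improvable_def bt by blast
  have "f v0 = v0" using moved[OF v0(1)] \<open>v0 < v\<close> by (metis leD)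
  then have s0: "s v0 = 0" using v0(2) by simp
  have dX: "d \<notin> ?X" using fX[of d] d(1,2) unfolding bag_def by auto
  have img: "component ?X (f d) = f ` component ?X d"
    by (rule involution_component) (use f fX d(1) dX in \<open>auto simp: bag_def\<close>)
  have cn: "u < n" if "u \<in> component ?X d" for u using component_subset[OF d(1) dX] that by auto
  have "v0 < u" if "u \<in> component ?X (f d)" for u
  proof -
    have "u \<in> f ` component ?X d" using that img by simp
    then obtain w where w: "w \<in> component ?X d" "u = f w" by blast
    show ?thesis
    proof (cases "f w = w")
      case False
      \<comment> \<open>The image of a moved vertex is moved as well, hence at least
        \<open>v\<close> and so above \<open>v0\<close>.\<close>
      then have "f (f w) \<noteq> f w" using f(1)[OF cn[OF w(1)]] by metis
      then have "v \<le> f w" using moved[of "f w"] f(1)[OF cn[OF w(1)]] by blast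
      then show ?thesis using w \<open>v0 < v\<close> by simp
    qed (use w d(3) in simp)
  qed
  moreover have "isomorphic ?X (component ?X v0) (component ?X (f d))"
    unfolding img
  proof (rule isomorphic_image[OF d(4)])
    show "inj_on f (component ?X d)" using f(1) cn by (metis inj_onI)
    show "adj x (f u) \<longleftrightarrow> adj x u" if "u \<in> component ?X d" "x \<in> ?X" for u x
      using f(2)[of x u] fX[OF that(2)] cn[OF that(1)] that(2) unfolding bag_def by auto
  qed (use f(2) cn in blast)
  ultimately show ?thesis
    unfolding improvable_def using v0 s0 f(1)[OF d(1)] d(2) by blast
qed

definition improving_swaps :: "(nat \<Rightarrow> nat) \<Rightarrow> nat \<Rightarrow> (nat \<times> nat) list \<Rightarrow> bool" where
  "improving_swaps s v ps \<longleftrightarrow> (\<forall>u<n. apply_swaps ps u < n \<and> apply_swaps ps (apply_swaps ps u) = u) \<and>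
     (\<forall>u<n. \<forall>w<n. adj (apply_swaps ps u) (apply_swaps ps w) \<longleftrightarrow> adj u w) \<and>
     (\<forall>u<n. apply_swaps ps u \<noteq> u \<longrightarrow> s u \<noteq> 1 \<and> v \<le> u) \<and> s v = 0 \<and> s (apply_swaps ps v) = 2"

text \<open>The exchange along the isomorphism consists of at most \<open>m\<close> transpositions,
  so the search tries it. It is an automorphism because edges leaving the two components end in the
  bag, which is fixed and meets both in the same way.\<close>

lemma improvable_imp_swaps:
  assumes s: "sweep i s" and imp: "improvable m s v"
  shows "\<exists>ps. length ps = m \<and> set ps \<subseteq> {..<n} \<times> {..<n} \<and> improving_swaps s v ps"
proof -
  let ?X = "bag s" let ?C = "component ?X v"
  obtain d where v: "v < n" "s v = 0" "\<forall>u\<in>?C. v \<le> u" "card ?C \<le> m"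
    and d: "d < n" "s d = 2" "\<forall>u\<in>component ?X d. v < u" "isomorphic ?X ?C (component ?X d)"
    using imp unfolding improvable_def by blast
  let ?D = "component ?X d"
  obtain g where g: "bij_betw g ?C ?D" "\<And>u w. u \<in> ?C \<Longrightarrow> w \<in> ?C \<Longrightarrow> adj (g u) (g w) \<longleftrightarrow> adj u w"
    "\<And>u x. u \<in> ?C \<Longrightarrow> x \<in> ?X \<Longrightarrow> adj x (g u) \<longleftrightarrow> adj x u"
    using d(4) unfolding isomorphic_def by blast
  have vX: "v \<notin> ?X" "d \<notin> ?X" using v d unfolding bag_def by auto
  have Cn: "?C \<subseteq> {..<n} - ?X" "?D \<subseteq> {..<n} - ?X" using component_subset v d vX by blast+
  have finC: "finite ?C" using Cn finite_subset by blast
  have C2: "s u \<noteq> 2" if "u \<in> ?C" for u using sweep_component_const[OF s v(1) _ that] v(2) by simp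
  have D2: "s u = 2" if "u \<in> ?D" for u using sweep_component_forgotten[OF s d(1,2) that] by simp
  have disj: "?C \<inter> ?D = {}" using C2 D2 by blast
  have gim: "g ` ?C = ?D" "inj_on g ?C" using g(1) unfolding bij_betw_def by auto
  \<comment> \<open>Repeating the pair of \<open>v\<close> pads the list to the exact length
    \<open>m\<close> that is enumerated.\<close>
  define ps where "ps = map (\<lambda>x. (x, g x)) (sorted_list_of_set ?C) @ replicate (m - card ?C) (v, g v)"
  have vC: "v \<in> ?C" by (rule component_self)
  have set_ps: "set ps = (\<lambda>x. (x, g x)) ` ?C" unfolding ps_def using finC vC by auto
  have len: "length ps = m" unfolding ps_def using v(4) finC by simp
  let ?f = "apply_swaps ps"
  have f: "?f u = (if u \<in> ?C then g u else if u \<in> ?D then the_inv_into ?C g u else u)" for u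
  proof -
    have 1: "fst ` set ps = ?C" unfolding set_ps image_image by simp
    have 2: "snd ` set ps = ?D" unfolding set_ps image_image using gim(1) by simp
    show ?thesis using apply_swaps_graph[of ps g ?C u] unfolding 1 2 gim(1) using set_ps gim(2) disj by blast
  qed
  have fC: "?f u = g u" "g u \<in> ?D" "?f (g u) = u" if "u \<in> ?C" for u
  proof -
    show gD: "g u \<in> ?D" using that gim(1) by blast
    then show "?f u = g u" "?f (g u) = u" using that f disj the_inv_into_f_f[OF gim(2) that] by auto
  qed
  have fo: "?f u = u" if "u \<notin> ?C" "u \<notin> ?D" for u using f that by simp
  have D: "\<exists>x\<in>?C. u = g x" if "u \<in> ?D" for u using that gim(1) by blast
  have inv: "?f u < n \<and> ?f (?f u) = u" if "u < n" for u
  proof (cases "u \<in> ?C \<union> ?D")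
    case True
    then consider "u \<in> ?C" | x where "x \<in> ?C" "u = g x" using D by blast
    then show ?thesis
    proof cases
      case 1
      then show ?thesis using fC[OF 1] subsetD[OF Cn(2) fC(2)[OF 1]] by simp
    next
      case 2
      then show ?thesis using fC[OF 2(1)] subsetD[OF Cn(1) 2(1)] by simp
    qed
  qed (use fo that in simp)
  have gone: "w \<in> ?C" if "u \<in> ?C" "adj u w" "w < n" "w \<notin> ?X" for u w
    by (rule component_closed[OF that(1)]) (use that Cn in \<open>auto simp: linked_def\<close>)
  have gone': "w \<in> ?D" if "u \<in> ?D" "adj u w" "w < n" "w \<notin> ?X" for u w
    by (rule component_closed[OF that(1)]) (use that Cn in \<open>auto simp: linked_def\<close>)
  have fX: "?f x = x" if "x \<in> ?X" for x by (rule fo) (use that Cn in auto)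
  have edge1: "adj (?f u) (?f w)" if h: "u \<in> ?C \<union> ?D" "w < n" "adj u w" for u w
  proof (cases "u \<in> ?C")
    case True
    show ?thesis
    proof (cases "w \<in> ?X")
      case wX: True
      then show ?thesis using g(3)[OF True wX] fC(1)[OF True] fX[OF wX] h(3) adj_sym by metis
    next
      case False
      then have "w \<in> ?C" using gone[OF True h(3,2)] by blast
      then show ?thesis using g(2)[OF True] fC(1) True h(3) by simp
    qed
  next
    case False
    then obtain x where x: "x \<in> ?C" "u = g x" using D h(1) by blast
    show ?thesis
    proof (cases "w \<in> ?X")
      case wX: True
      then show ?thesis using g(3)[OF x(1) wX] fC(3)[OF x(1)] fX[OF wX] h(3) adj_sym x(2) by metis
    next
      case False
      then have "w \<in> ?D" using gone'[of u w] fC(2)[OF x(1)] x(2) h by blast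
      then obtain y where y: "y \<in> ?C" "w = g y" using D by blast
      then show ?thesis using g(2)[OF x(1) y(1)] fC(3) x y h(3) by simp
    qed
  qed
  have edge: "adj (?f u) (?f w)" if "u < n" "w < n" "adj u w" for u w
  proof (cases "u \<in> ?C \<union> ?D")
    case False
    show ?thesis
    proof (cases "w \<in> ?C \<union> ?D")
      case True
      then show ?thesis using edge1[OF True that(1) adj_sym[OF that(3)]] adj_sym by blast
    qed (use False fo that in simp)
  qed (use edge1 that in blast)
  have "adj (?f u) (?f w) \<longleftrightarrow> adj u w" if "u < n" "w < n" for u w
    using edge[OF that] edge[of "?f u" "?f w"] inv that by metis
  moreover have "s u \<noteq> 1 \<and> v \<le> u" if "u < n" "?f u \<noteq> u" for u
  proof -
    have "u \<in> ?C \<or> u \<in> ?D" using fo that by blast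
    then have "u \<notin> ?X" "v \<le> u" using Cn v(3) d(3) by (blast, fastforce)
    then show ?thesis using that unfolding bag_def by simp
  qed
  moreover have "s (?f v) = 2" using fC[OF vC] D2 by simp
  ultimately have "improving_swaps s v ps" unfolding improving_swaps_def using inv v(2) by blast
  moreover have "set ps \<subseteq> {..<n} \<times> {..<n}" unfolding set_ps using Cn gim(1) by blast
  ultimately show ?thesis using len by blast
qed

end

subsection \<open>Correctness of the search\<close>

lemma lookup_nth: "i < length xs \<Longrightarrow> lookup xs i = xs ! i"
proof -
  have fold_le: "fold (\<lambda>y a. (fst a - 1, if fst a = 0 then y else snd a)) ys (j, z) = (j - int (length ys), z)"
    if "j < 0" for ys j and z :: nat
    using that by (induction ys arbitrary: j) auto
  have "snd (fold (\<lambda>y a. (fst a - 1, if fst a = 0 then y else snd a)) xs (int i, z)) = xs ! i" if "i < length xs" for z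
    using that
  proof (induction xs arbitrary: i z)
    case (Cons x xs)
    show ?case
    proof (cases i)
      case 0
      then show ?thesis using fold_le[of "-1" xs x] by simp
    next
      case (Suc j)
      then show ?thesis using Cons.IH[of j z] Cons.prems by simp
    qed
  qed simp
  then show "i < length xs \<Longrightarrow> lookup xs i = xs ! i" unfolding lookup_def by blast
qed

lemma dedup_correct:
  assumes "\<forall>x\<in>set xs. length x = n"
  shows "distinct (dedup n xs) \<and> set (dedup n xs) = set xs"
proof -
  let ?f = "\<lambda>x a. if \<exists>y\<in>set a. \<forall>v\<in>set [0..<n]. lookup y v = lookup x v then a else x # a"
  have eq: "(\<forall>v\<in>set [0..<n]. lookup y v = lookup x v) \<longleftrightarrow> y = x" if "length x = n" "length y = n" for x y
    using that by (auto simp: lookup_nth intro: nth_equalityI)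
  have "distinct (fold ?f xs a) \<and> set (fold ?f xs a) = set xs \<union> set a"
    if "\<forall>x\<in>set xs. length x = n" "\<forall>x\<in>set a. length x = n" "distinct a" for xs a
    using that
  proof (induction xs arbitrary: a)
    case (Cons x xs)
    have "(\<exists>y\<in>set a. \<forall>v\<in>set [0..<n]. lookup y v = lookup x v) \<longleftrightarrow> x \<in> set a"
      using eq[of x] Cons.prems by auto
    then have step: "?f x a = (if x \<in> set a then a else x # a)" by presburger
    show ?case unfolding fold_Cons comp_apply step using Cons.IH[of "if x \<in> set a then a else x # a"] Cons.prems by auto
  qed simp
  then show ?thesis unfolding dedup_def using assms by fastforce
qed

locale search = bounded_sweep +
  fixes A :: "nat list" and PL :: "(nat \<times> nat) list list" and BL :: "nat list list" and m :: nat
  assumes edges: "u < n \<Longrightarrow> v < n \<Longrightarrow> has_edge n A u v \<longleftrightarrow> adj u v"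
    and PL: "set PL = {ps. length ps = m \<and> set ps \<subseteq> {..<n} \<times> {..<n}}"
    and BL: "set BL = {bs. length bs = Suc k \<and> set bs \<subseteq> {..n}}"
begin

section \<open>Canonization\<close>

lemma improvable_cong:
  assumes "\<And>v. v < n \<Longrightarrow> s v = t v" shows "improvable m s v \<longleftrightarrow> improvable m t v"
proof -
  have B: "bag s = bag t" unfolding bag_def using assms by (intro Collect_cong conj_cong) simp_all
  show ?thesis unfolding improvable_def B by (intro conj_cong refl ex_cong1; simp add: assms)
qed

text \<open>The tests on lists agree with those on functions only while all images are vertices,
  since \<open>lookup\<close> has a default value elsewhere. If some image is out of range, both
  sides are false.\<close>

lemma improves_iff:
  assumes "length a = n" "v < n" shows "improves n A a v ps \<longleftrightarrow> improving_swaps ((!) a) v ps"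
proof (cases "\<forall>u<n. apply_swaps ps u < n")
  case True
  let ?f = "apply_swaps ps"
  have lt: "?f u < n" if "u < n" for u using True that by blast
  have "is_symmetry n A ps \<longleftrightarrow> (\<forall>u\<in>set [0..<n]. ?f u < n \<and> ?f (?f u) = u \<and>
     (\<forall>w\<in>set [0..<n]. adj u w \<longleftrightarrow> adj (?f u) (?f w)))"
    unfolding is_symmetry_def by (intro ball_cong refl conj_cong) (simp add: edges lt)
  also have "\<dots> \<longleftrightarrow> (\<forall>u<n. ?f u < n \<and> ?f (?f u) = u) \<and> (\<forall>u<n. \<forall>w<n. adj (?f u) (?f w) \<longleftrightarrow> adj u w)"
    by (simp add: Ball_def) meson
  finally have 1: "is_symmetry n A ps \<longleftrightarrow> (\<forall>u<n. ?f u < n \<and> ?f (?f u) = u) \<and>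
     (\<forall>u<n. \<forall>w<n. adj (?f u) (?f w) \<longleftrightarrow> adj u w)" .
  have 2: "(\<forall>u\<in>set [0..<n]. ?f u \<noteq> u \<longrightarrow> lookup a u \<noteq> 1 \<and> v \<le> u) \<longleftrightarrow>
     (\<forall>u<n. ?f u \<noteq> u \<longrightarrow> a ! u \<noteq> 1 \<and> v \<le> u)"
    using assms(1) by (simp add: Ball_def lookup_nth)
  show ?thesis
    unfolding improves_def improving_swaps_def 1 2 using lt assms by (simp add: lookup_nth)
next
  case False
  then show ?thesis unfolding improves_def is_symmetry_def improving_swaps_def by auto
qed

text \<open>The automorphism need not fix the bag here: reachability and completion of a sweep are
  invariant under all automorphisms of the graph.\<close>

definition equivalent :: "nat list \<Rightarrow> (nat \<Rightarrow> nat) \<Rightarrow> bool" where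
  "equivalent b s \<longleftrightarrow> length b = n \<and> (\<exists>f. symmetry f \<and> (\<forall>u<n. b ! u = s (f u)))"

lemma equivalent_refl: "length a = n \<Longrightarrow> equivalent a ((!) a)"
  unfolding equivalent_def using symmetry_id by blast

lemma equivalent_trans:
  assumes "equivalent c ((!) b)" "equivalent b s" shows "equivalent c s"
proof -
  obtain f g where "symmetry f" "\<forall>u<n. b ! u = s (f u)" "symmetry g" "\<forall>u<n. c ! u = b ! g u" "length c = n"
    using assms unfolding equivalent_def by blast
  then show ?thesis
    unfolding equivalent_def using symmetry_comp[of f g] symmetry_less[of g] by (intro conjI exI[of _ "\<lambda>v. f (g v)"]) auto
qed

lemma equivalent_sweep:
  assumes "equivalent b s" "sweep i s" shows "sweep i ((!) b)"
proof -
  obtain f where "symmetry f" "\<forall>u<n. b ! u = s (f u)" using assms(1) unfolding equivalent_def by blast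
  then show ?thesis using sweep_cong[OF sweep_symmetry[OF assms(2)]] by blast
qed

text \<open>Treating \<open>v\<close> must not spoil what holds for smaller vertices; this is the
  relation that the inner loop maintains.\<close>

definition better :: "nat \<Rightarrow> nat list \<Rightarrow> nat list \<Rightarrow> bool" where
  "better v a b \<longleftrightarrow> equivalent b ((!) a) \<and> (\<forall>v0<v. improvable m ((!) b) v0 \<longrightarrow> improvable m ((!) a) v0)"

lemma better_permute:
  assumes "length a = n" "v < n" "improves n A a v ps"
  shows "better v a (permute n a ps) \<and> permute n a ps ! v = 2"
proof -
  let ?f = "apply_swaps ps"
  have I: "improving_swaps ((!) a) v ps" using assms improves_iff by blast
  have f: "\<And>u. u < n \<Longrightarrow> ?f u < n \<and> ?f (?f u) = u" "\<And>u w. u < n \<Longrightarrow> w < n \<Longrightarrow> adj (?f u) (?f w) \<longleftrightarrow> adj u w"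
    "\<And>u. u < n \<Longrightarrow> ?f u \<noteq> u \<Longrightarrow> a ! u \<noteq> 1 \<and> v \<le> u" "a ! ?f v = 2"
    using I unfolding improving_swaps_def by blast+
  have nth: "permute n a ps ! u = a ! ?f u" if "u < n" for u
    unfolding permute_def using that f(1)[OF that] assms(1) by (simp add: lookup_nth)
  have "equivalent (permute n a ps) ((!) a)"
    unfolding equivalent_def using involution_symmetry[of ?f] f(1,2) nth by auto
  moreover have "improvable m ((!) a) v0" if "v0 < v" "improvable m ((!) (permute n a ps)) v0" for v0
  proof (rule improvable_before_swap[of ?f])
    show "improvable m (\<lambda>u. a ! ?f u) v0" using that(2) improvable_cong[of "\<lambda>u. a ! ?f u" "(!) (permute n a ps)"] nth by simp
  qed (use f that in auto)
  ultimately show ?thesis unfolding better_def using nth[OF assms(2)] f(4) by simp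
qed

lemma better_refl: "length a = n \<Longrightarrow> better v a a"
  unfolding better_def using equivalent_refl by blast

definition improve_at :: "nat \<Rightarrow> (nat \<times> nat) list list \<Rightarrow> nat list \<Rightarrow> nat list" where
  "improve_at v qs a = fold (\<lambda>ps a. if improves n A a v ps then permute n a ps else a) qs a"

lemma improve_at_idle: "length a = n \<Longrightarrow> v < n \<Longrightarrow> a ! v \<noteq> 0 \<Longrightarrow> improve_at v qs a = a"
  by (induction qs) (auto simp: improve_at_def improves_def lookup_nth)

lemma improve_at_better:
  assumes "length a = n" "v < n"
  shows "better v a (improve_at v qs a) \<and>
    (improve_at v qs a ! v \<noteq> 0 \<or> improve_at v qs a = a \<and> (\<forall>ps\<in>set qs. \<not> improves n A a v ps))"
proof (induction qs)
  case Nil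
  then show ?case using better_refl assms by (simp add: improve_at_def)
next
  case (Cons ps qs)
  show ?case
  proof (cases "improves n A a v ps")
    case True
    note p = better_permute[OF assms True]
    have "improve_at v (ps # qs) a = improve_at v qs (permute n a ps)" using True by (simp add: improve_at_def)
    also have "\<dots> = permute n a ps" by (rule improve_at_idle) (use p assms in auto)
    finally show ?thesis using p by simp
  next
    case False
    then have "improve_at v (ps # qs) a = improve_at v qs a" by (simp add: improve_at_def)
    then show ?thesis using Cons False by simp
  qed
qed

text \<open>Either \<open>v\<close> is no longer unseen, or every list has failed on the unchanged
  state; the latter excludes an improvement, because \<open>improvable_imp_swaps\<close> would
  supply a successful list.\<close>

lemma improve_at_final:
  assumes "length a = n" "v < n" "sweep i ((!) a)"
  shows "\<not> improvable m ((!) (improve_at v PL a)) v"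
proof
  assume imp: "improvable m ((!) (improve_at v PL a)) v"
  then have "improve_at v PL a ! v = 0" unfolding improvable_def by blast
  then have *: "improve_at v PL a = a" "\<forall>ps\<in>set PL. \<not> improves n A a v ps"
    using improve_at_better[OF assms(1,2), of PL] by auto
  have "improvable m ((!) a) v" using imp unfolding *(1) .
  then obtain ps where "length ps = m" "set ps \<subseteq> {..<n} \<times> {..<n}" "improving_swaps ((!) a) v ps"
    using improvable_imp_swaps[OF assms(3)] by blast
  then show False using * PL improves_iff[OF assms(1,2)] by blast
qed

lemma canonize_correct:
  assumes "length a = n" "sweep i ((!) a)"
  shows "equivalent (canonize n A PL a) ((!) a) \<and> canonical m ((!) (canonize n A PL a))"
proof -
  let ?c = "\<lambda>j. fold (\<lambda>v. improve_at v PL) [0..<j] a"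
  have "equivalent (?c j) ((!) a) \<and> (\<forall>v<j. \<not> improvable m ((!) (?c j)) v)" if "j \<le> n" for j
    using that
  proof (induction j)
    case 0
    then show ?case using equivalent_refl assms by simp
  next
    case (Suc j)
    then have IH: "equivalent (?c j) ((!) a)" "\<forall>v<j. \<not> improvable m ((!) (?c j)) v" "j < n" by auto
    have len: "length (?c j) = n" using IH(1) unfolding equivalent_def by blast
    have eq: "?c (Suc j) = improve_at j PL (?c j)" by simp
    have b: "better j (?c j) (?c (Suc j))" unfolding eq using improve_at_better[OF len IH(3)] by blast
    then have "equivalent (?c (Suc j)) ((!) a)" using IH(1) equivalent_trans unfolding better_def by blast
    moreover have "\<not> improvable m ((!) (?c (Suc j))) j"
      unfolding eq by (rule improve_at_final[OF len IH(3) equivalent_sweep[OF IH(1) assms(2)]])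
    moreover have "\<not> improvable m ((!) (?c (Suc j))) v" if "v < j" for v
      using b IH(2) that unfolding better_def by blast
    ultimately show ?case using less_Suc_eq by blast
  qed
  moreover have "canonize n A PL a = ?c n" unfolding canonize_def improve_at_def ..
  ultimately show ?thesis unfolding canonical_def improvable_def by auto
qed

section \<open>Soundness and completeness of the levels\<close>

lemma nth_advance:
  "length a = n \<Longrightarrow> v < n \<Longrightarrow> advance n a bs ! v =
     (if a ! v = 2 then 2 else if v \<in> set bs then 1 else if a ! v = 1 then 2 else 0)"
  unfolding advance_def by (simp add: lookup_nth)

lemma admissible_iff:
  assumes "length a = n"
  shows "admissible n A a (advance n a bs) \<longleftrightarrow> (\<forall>u<n. \<forall>v<n. adj u v \<longrightarrow> advance n a bs ! u = 2 \<longrightarrow> a ! v \<noteq> 0)"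
  unfolding admissible_def using assms by (auto simp: lookup_nth edges)

lemma advance_sound:
  assumes "length a = n" "sweep i ((!) a)" "bs \<in> set BL" "admissible n A a (advance n a bs)"
  shows "sweep (Suc i) ((!) (advance n a bs))"
proof (rule sweep_Suc[OF assms(2)])
  have "a ! v = 0 \<or> a ! v = 1 \<or> a ! v = 2" if "v < n" for v
    using sweep_invariant[OF assms(2)] that by force
  then have 1: "\<forall>v<n. a ! v = 0 \<and> advance n a bs ! v \<in> {0, 1} \<or> a ! v = 1 \<and> advance n a bs ! v \<in> {1, 2} \<or>
     a ! v = 2 \<and> advance n a bs ! v = 2"
    using nth_advance[OF assms(1)] by auto
  have "{v. v < n \<and> advance n a bs ! v = 1} \<subseteq> set bs"
    using nth_advance[OF assms(1)] by (auto split: if_splits)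
  then have "card {v. v < n \<and> advance n a bs ! v = 1} \<le> card (set bs)" by (intro card_mono) auto
  also have "\<dots> \<le> Suc k" using card_length[of bs] assms(3) BL by simp
  finally show "sweep_step ((!) a) ((!) (advance n a bs))"
    unfolding sweep_step_def using 1 assms(4) admissible_iff[OF assms(1)] by blast
qed

lemma advance_complete:
  assumes "length a = n" "sweep_step ((!) a) t"
  shows "\<exists>bs\<in>set BL. (\<forall>v<n. advance n a bs ! v = t v) \<and> admissible n A a (advance n a bs)"
proof -
  note st = sweep_stepD[OF assms(2)]
  obtain bs where bs: "length bs = Suc k" "set bs \<subseteq> {..n}" "set bs \<inter> {..<n} = {v. v < n \<and> t v = 1}"
    using enumerate_bag[OF _ st(2)] by blast
  have mem: "v \<in> set bs \<longleftrightarrow> t v = 1" if "v < n" for v using bs(3) that by blast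
  have eq: "advance n a bs ! v = t v" if "v < n" for v
    using nth_advance[OF assms(1) that, of bs] st(1)[OF that] mem[OF that] by auto
  then have "admissible n A a (advance n a bs)" using st(3) admissible_iff[OF assms(1)] by simp
  then show ?thesis using eq bs BL by blast
qed

abbreviation lvl :: "nat \<Rightarrow> nat list list" where
  "lvl i \<equiv> level n A PL BL i"

lemma level_Suc: "lvl (Suc i) = next_level n A PL BL (lvl i)"
  unfolding level_def by simp

lemma set_level_Suc:
  assumes "\<forall>a\<in>set (lvl i). length a = n"
  shows "distinct (lvl (Suc i)) \<and> set (lvl (Suc i)) = {canonize n A PL (advance n a bs) | a bs.
     a \<in> set (lvl i) \<and> bs \<in> set BL \<and> admissible n A a (advance n a bs)}"
proof -
  let ?xs = "concat (map (\<lambda>a. map (\<lambda>bs. canonize n A PL (advance n a bs))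
     (filter (\<lambda>bs. admissible n A a (advance n a bs)) BL)) (lvl i))"
  have "\<forall>x\<in>set ?xs. length x = n" by (auto simp: length_canonize)
  from dedup_correct[OF this] show ?thesis unfolding level_Suc next_level_def by auto
qed

lemma level_sound:
  "distinct (lvl i) \<and> (\<forall>a\<in>set (lvl i). length a = n \<and> sweep i ((!) a) \<and> canonical m ((!) a))"
proof (induction i)
  case 0
  have "sweep 0 ((!) (map (\<lambda>_. 0) [0..<n]))" by (rule sweep_0) simp
  moreover have "canonical m ((!) (map (\<lambda>_. 0) [0..<n]))" unfolding canonical_def improvable_def by auto
  ultimately show ?case unfolding level_def by simp
next
  case (Suc i)
  have "length b = n \<and> sweep (Suc i) ((!) b) \<and> canonical m ((!) b)" if "b \<in> set (lvl (Suc i))" for b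
  proof -
    obtain a bs where h: "b = canonize n A PL (advance n a bs)" "a \<in> set (lvl i)" "bs \<in> set BL"
      "admissible n A a (advance n a bs)"
      using \<open>b \<in> set (lvl (Suc i))\<close> set_level_Suc[of i] Suc by blast
    then have sw: "sweep (Suc i) ((!) (advance n a bs))" using advance_sound Suc by blast
    note c = canonize_correct[OF length_advance sw]
    then show ?thesis unfolding h(1) using equivalent_sweep[OF _ sw] unfolding equivalent_def by blast
  qed
  then show ?case using set_level_Suc[of i] Suc by blast
qed

text \<open>The stored state \<open>a\<close> is \<open>s\<close> moved by an automorphism
  \<open>f\<close>. The step from \<open>s\<close> to \<open>t\<close>, transported along
  \<open>f\<close>, is one of those tried from \<open>a\<close>, and canonization composes
  \<open>f\<close> with a further automorphism.\<close>

lemma level_complete: "sweep i s \<Longrightarrow> \<exists>a\<in>set (lvl i). equivalent a s"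
proof (induction rule: sweep.induct)
  case (sweep_0 s)
  then have "equivalent (map (\<lambda>_. 0) [0..<n]) s"
    unfolding equivalent_def using symmetry_id by (intro conjI exI[of _ "\<lambda>v. v"]) auto
  then show ?case unfolding level_def by simp
next
  case (sweep_Suc i s t)
  then obtain a f where a: "a \<in> set (lvl i)" "length a = n" "symmetry f" "\<forall>u<n. a ! u = s (f u)"
    unfolding equivalent_def by blast
  have "sweep_step ((!) a) (\<lambda>v. t (f v))"
    by (rule sweep_step_cong[OF sweep_step_symmetry[OF a(3) sweep_Suc.hyps(2)]]) (use a in auto)
  then obtain bs where bs: "bs \<in> set BL" "\<forall>v<n. advance n a bs ! v = t (f v)" "admissible n A a (advance n a bs)"
    using advance_complete[OF a(2)] by blast
  have eq: "equivalent (advance n a bs) t" unfolding equivalent_def using a(3) bs(2) by auto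
  have "sweep (Suc i) ((!) (advance n a bs))"
    using advance_sound[OF a(2) _ bs(1,3)] level_sound[of i] a(1) by blast
  then have "equivalent (canonize n A PL (advance n a bs)) t"
    using canonize_correct[OF length_advance] equivalent_trans eq by blast
  moreover have "canonize n A PL (advance n a bs) \<in> set (lvl (Suc i))"
    using set_level_Suc[of i] level_sound[of i] a(1) bs by blast
  ultimately show ?case by blast
qed

text \<open>Removing duplicates is what turns the length of a level into a number of states.\<close>

lemma length_level: "length (lvl i) \<le> state_bound m"
proof -
  have "length (lvl i) = card (set (lvl i))" using level_sound[of i] distinct_card by metis
  also have "\<dots> \<le> card (canonical_states m)"
    using level_sound[of i] card_canonical_states[of m] unfolding canonical_states_def by (intro card_mono) auto
  finally show ?thesis using card_canonical_states[of m] by linarith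
qed

lemma level_full_iff:
  "(\<exists>a\<in>set (lvl i). \<forall>v\<in>set [0..<n]. lookup a v \<noteq> 0) \<longleftrightarrow> (\<exists>s. sweep i s \<and> (\<forall>v<n. s v \<noteq> 0))"
proof
  assume "\<exists>a\<in>set (lvl i). \<forall>v\<in>set [0..<n]. lookup a v \<noteq> 0"
  then obtain a where a: "a \<in> set (lvl i)" "\<forall>v\<in>set [0..<n]. lookup a v \<noteq> 0" by blast
  then have "length a = n" "sweep i ((!) a)" using level_sound by blast+
  then show "\<exists>s. sweep i s \<and> (\<forall>v<n. s v \<noteq> 0)" using a(2) by (intro exI[of _ "(!) a"]) (auto simp: lookup_nth)
next
  assume "\<exists>s. sweep i s \<and> (\<forall>v<n. s v \<noteq> 0)"
  then obtain s where s: "sweep i s" "\<forall>v<n. s v \<noteq> 0" by blast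
  then obtain a f where a: "a \<in> set (lvl i)" "length a = n" "symmetry f" "\<forall>u<n. a ! u = s (f u)"
    using level_complete unfolding equivalent_def by blast
  then have "\<forall>v\<in>set [0..<n]. lookup a v \<noteq> 0" using s(2) symmetry_less[OF a(3)] by (simp add: lookup_nth)
  then show "\<exists>a\<in>set (lvl i). \<forall>v\<in>set [0..<n]. lookup a v \<noteq> 0" using a(1) by blast
qed

end

subsection \<open>Asymptotics\<close>

text \<open>By its hypothesis, \<open>m n\<close> is the integer part of
  \<open>log 2 n / (2 * a)\<close> for positive \<open>n\<close>. With \<open>A <= 2 ^ a\<close>,
  the power \<open>A ^ m n\<close> is at most \<open>sqrt n\<close> and adds only
  \<open>O(sqrt n * log n)\<close> to the logarithm; the dominating term
  \<open>n div Suc (m n)\<close> is at most \<open>2 * a * n / log 2 n\<close>.\<close>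

lemma work_bound_asymptotics:
  fixes m :: "nat \<Rightarrow> nat" and K d c e A a :: nat
  assumes A: "A \<le> 2 ^ a" and pos: "0 < a" "0 < K" "0 < c"
    and m: "\<And>n. 0 < n \<Longrightarrow> (2 ^ (2 * a)) ^ m n \<le> n \<and> n < (2 ^ (2 * a)) ^ Suc (m n)"
  shows "(\<lambda>n. log 2 (real (K * (c * Suc n ^ (e + 2 * m n + A ^ Suc (m n)) * 2 ^ (n div Suc (m n)) + 1) ^ d)))
           \<in> O(\<lambda>n. real n / log 2 (real n))"
proof -
  let ?X = "\<lambda>n. c * Suc n ^ (e + 2 * m n + A ^ Suc (m n)) * 2 ^ (n div Suc (m n))"
  let ?f = "\<lambda>n. log 2 (real (K * (?X n + 1) ^ d))"
  \<comment> \<open>Collects the terms of lower order. As it is at least 1 for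
    \<open>n >= 2\<close>, it absorbs the additive constants too.\<close>
  let ?g = "\<lambda>n::nat. (1 + log 2 (real n) + sqrt (real n)) * (1 + log 2 (real n))"
  define C where "C = log 2 (real K) + real d * (1 + log 2 (real c) + real e + 2 + real A)"
  have log_Suc: "log 2 (real (x + 1)) \<le> 1 + log 2 (real x)" if "1 \<le> x" for x :: nat
  proof -
    have "log 2 (real (x + 1)) \<le> log 2 (2 * real x)" using that by (subst log_le_cancel_iff) auto
    then show ?thesis using that by (simp add: log_mult)
  qed
  have log_f: "log 2 (real (K * (x + 1) ^ d)) = log 2 (real K) + real d * log 2 (real (x + 1))" for x :: nat
    using pos(2) unfolding of_nat_mult of_nat_power by (subst log_mult) (auto simp: log_nat_power)
  have bound: "norm (?f n) \<le> C * ?g n + (real d * 2 * real a) * (real n / log 2 (real n))" if n: "2 \<le> n" for n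
  proof -
    let ?L = "log 2 (real n)"
    have n0: "0 < n" and L1: "1 \<le> ?L" using n by (auto simp: le_log_iff)
    have mle: "real (2 * a * m n) \<le> ?L"
    proof -
      have "(2::nat) ^ (2 * a * m n) \<le> n" using m[OF n0] by (simp add: power_mult)
      then have "(2::real) ^ (2 * a * m n) \<le> real n" by (metis of_nat_le_iff of_nat_numeral of_nat_power)
      then have "2 powr real (2 * a * m n) \<le> real n" by (simp only: powr_realpow zero_less_numeral)
      then show ?thesis using n0 by (subst le_log_iff) auto
    qed
    have mgt: "?L \<le> 2 * real a * real (Suc (m n))"
    proof -
      have "n \<le> (2::nat) ^ (2 * a * Suc (m n))" using m[OF n0] by (simp only: power_mult) linarith
      then have "real n \<le> 2 ^ (2 * a * Suc (m n))" by (metis of_nat_le_iff of_nat_numeral of_nat_power)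
      then have "real n \<le> 2 powr real (2 * a * Suc (m n))" by (simp only: powr_realpow zero_less_numeral)
      then have "?L \<le> real (2 * a * Suc (m n))" using n0 by (subst log_le_iff) auto
      then show ?thesis by (simp only: of_nat_mult of_nat_numeral)
    qed
    have "real (m n) \<le> ?L"
    proof -
      have "1 * m n \<le> 2 * a * m n" using pos(1) by (intro mult_right_mono) auto
      then have "real (m n) \<le> real (2 * a * m n)" by (simp only: of_nat_le_iff mult_1)
      then show ?thesis using mle by linarith
    qed
    moreover have "real (A ^ Suc (m n)) \<le> real A * sqrt (real n)"
    proof -
      have "A ^ m n \<le> 2 ^ (a * m n)" using power_mono[OF A, of "m n"] by (simp add: power_mult)
      then have "(A ^ m n)\<^sup>2 \<le> (2 ^ (a * m n))\<^sup>2" by (rule power_mono) simp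
      also have "\<dots> = (2 ^ (2 * a)) ^ m n" by (simp add: power_mult[symmetric] mult_ac)
      also have "\<dots> \<le> n" using m[OF n0] by blast
      finally have "(real (A ^ m n))\<^sup>2 \<le> real n" by (metis of_nat_le_iff of_nat_power)
      then have "real (A ^ m n) \<le> sqrt (real n)" by (rule real_le_rsqrt)
      then show ?thesis by (simp add: mult_left_mono)
    qed
    ultimately have E: "real (e + 2 * m n + A ^ Suc (m n)) \<le> real e + 2 * ?L + real A * sqrt (real n)" by simp
    have "real (n div Suc (m n)) \<le> real n / real (Suc (m n))" by (rule of_nat_div_le_of_nat)
    also have "\<dots> = (real n / ?L) * (?L / real (Suc (m n)))" using L1 by simp
    also have "\<dots> \<le> (real n / ?L) * (2 * real a)"
      using mgt L1 by (intro mult_left_mono) (simp_all add: pos_divide_le_eq mult_ac del: of_nat_Suc)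
    finally have D: "real (n div Suc (m n)) \<le> 2 * real a * (real n / ?L)" by (simp add: mult_ac)
    have "real (Suc n) \<le> 2 * real n" using n by simp
    then have "log 2 (real (Suc n)) \<le> log 2 (2 * real n)" by (subst log_le_cancel_iff) (use n in auto)
    then have S: "log 2 (real (Suc n)) \<le> 1 + ?L" using n0 by (simp add: log_mult)
    have S0: "0 \<le> log 2 (real (Suc n))" by simp
    have X1: "1 \<le> ?X n" using pos(3) by (simp add: Suc_le_eq)
    have lX: "log 2 (real (?X n)) = log 2 (real c) + real (e + 2 * m n + A ^ Suc (m n)) * log 2 (real (Suc n)) + real (n div Suc (m n))"
      using pos(3) by (simp add: log_mult log_nat_power del: of_nat_Suc power_Suc)
    have "real (e + 2 * m n + A ^ Suc (m n)) * log 2 (real (Suc n)) \<le> (real e + 2 * ?L + real A * sqrt (real n)) * (1 + ?L)"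
      using E S S0 L1 by (intro mult_mono) auto
    also have "\<dots> \<le> ((real e + 2 + real A) * (1 + ?L + sqrt (real n))) * (1 + ?L)"
    proof (rule mult_right_mono)
      have "0 \<le> real e * ?L" "0 \<le> real e * sqrt (real n)" "0 \<le> sqrt (real n)" "0 \<le> real A * ?L" "0 \<le> real A"
        using L1 by (auto intro!: mult_nonneg_nonneg)
      then show "real e + 2 * ?L + real A * sqrt (real n) \<le> (real e + 2 + real A) * (1 + ?L + sqrt (real n))"
        by (simp add: algebra_simps)
    qed (use L1 in simp)
    finally have M: "real (e + 2 * m n + A ^ Suc (m n)) * log 2 (real (Suc n)) \<le> (real e + 2 + real A) * ?g n"
      by (simp add: mult_ac)
    have g1: "1 \<le> ?g n"
    proof -
      have "1 * 1 \<le> ?g n" using L1 by (intro mult_mono) auto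
      then show ?thesis by simp
    qed
    have logc: "0 \<le> log 2 (real c)" "0 \<le> log 2 (real K)" using pos by simp_all
    have p1: "log 2 (real K) * 1 \<le> log 2 (real K) * ?g n" by (rule mult_left_mono[OF g1 logc(2)])
    have p2: "real d * (1 + log 2 (real c)) * 1 \<le> real d * (1 + log 2 (real c)) * ?g n"
      by (rule mult_left_mono[OF g1]) (use logc in simp)
    have X2: "log 2 (real (?X n + 1)) \<le> 1 + log 2 (real (?X n))" by (rule log_Suc[OF X1])
    have "?f n = log 2 (real K) + real d * log 2 (real (?X n + 1))" by (rule log_f)
    also have "\<dots> \<le> log 2 (real K) + real d * (1 + (log 2 (real c) + (real e + 2 + real A) * ?g n + 2 * real a * (real n / ?L)))"
      using X2 lX M D by (intro add_left_mono mult_left_mono) auto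
    also have "\<dots> = log 2 (real K) * 1 + real d * (1 + log 2 (real c)) * 1 + real d * (real e + 2 + real A) * ?g n
        + (real d * 2 * real a) * (real n / ?L)"
      by (simp add: algebra_simps)
    also have "\<dots> \<le> log 2 (real K) * ?g n + real d * (1 + log 2 (real c)) * ?g n + real d * (real e + 2 + real A) * ?g n
        + (real d * 2 * real a) * (real n / ?L)"
      using p1 p2 by linarith
    also have "\<dots> = C * ?g n + (real d * 2 * real a) * (real n / ?L)" unfolding C_def by (simp add: algebra_simps)
    finally have "?f n \<le> C * ?g n + (real d * 2 * real a) * (real n / ?L)" .
    moreover have "0 \<le> ?f n"
    proof -
      have "1 \<le> K * (?X n + 1) ^ d" using pos(2) by (simp add: Suc_le_eq)
      then have "1 \<le> real (K * (?X n + 1) ^ d)" by linarith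
      then show ?thesis by (simp only: zero_le_log_cancel_iff one_less_numeral_iff semiring_norm)
    qed
    ultimately show ?thesis by simp
  qed
  have "?f \<in> O(\<lambda>n. C * ?g n + (real d * 2 * real a) * (real n / log 2 (real n)))"
  proof (rule bigoI[where c = 1], rule eventually_at_top_linorderI[of 2])
    fix n :: nat assume "2 \<le> n"
    from bound[OF this] show "norm (?f n) \<le> 1 * norm (C * ?g n + (real d * 2 * real a) * (real n / log 2 (real n)))"
      by simp
  qed
  also have "(\<lambda>n. C * ?g n + (real d * 2 * real a) * (real n / log 2 (real n))) \<in> O(\<lambda>n. real n / log 2 (real n))"
  proof (rule sum_in_bigo)
    have "?g \<in> O(\<lambda>n. real n / log 2 (real n))" by real_asymp
    then show "(\<lambda>n. C * ?g n) \<in> O(\<lambda>n. real n / log 2 (real n))" by simp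
    show "(\<lambda>n. (real d * 2 * real a) * (real n / log 2 (real n))) \<in> O(\<lambda>n. real n / log 2 (real n))"
      by (rule bigoI[where c = "real d * 2 * real a"], rule always_eventually) (simp add: abs_mult)
  qed
  finally show ?thesis .
qed

subsection \<open>Loading the input\<close>

text \<open>Registers 2, 3 and 4 hold \<open>n\<close>, \<open>s\<close> and 1. The first loop forms
  \<open>n * n\<close> by repeated addition. The heap then starts above the matrix, so that the
  second loop, consing the entries from last to first, overwrites none of them. The last
  instructions build the cells of the triple and leave its address in register 1.\<close>

definition load_input :: "instr list" where
  "load_input =
    [Copy 2 0, Copy 3 1, Const 4 1, Copy 5 0, Const 6 0,
     JumpPos 5 7, Jump 10, Add 6 6 2, Sub 5 5 4, Jump 5,
     Add 0 6 4, Const 7 0,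
     JumpPos 6 14, Jump 23, Sub 6 6 4, Load 8 6, Copy 9 0, Store 0 8, Add 0 0 4, Store 0 7, Add 0 0 4, Copy 7 9, Jump 12,
     Copy 9 0, Store 0 3, Add 0 0 4, Store 0 7, Add 0 0 4, Copy 1 0, Store 0 2, Add 0 0 4, Store 0 9, Add 0 0 4]"

lemmas load_simps = load_input_def exec_config

definition adj_list :: "nat \<Rightarrow> nat set set \<Rightarrow> nat list" where
  "adj_list n E = map (\<lambda>a. nat (adj_matrix n E (int a))) [0..<n * n]"

lemma length_load_input: "length load_input = 33"
  by (simp add: load_input_def)

lemma load_input_at:
  assumes "code_at P 0 load_input" "b < 33"
  shows "b < length P \<and> P ! b = load_input ! b"
  using assms unfolding code_at_def by (auto simp: length_load_input nth_append)

lemma reaches_load: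
  assumes "code_at P 0 load_input" "b < 33"
    and "reaches P (exec (load_input ! b) (conf b R m)) T Q"
  shows "reaches P (conf b R m) (Suc T) Q"
  using reaches_step[of b P] load_input_at[OF assms(1,2)] assms(3) by blast

lemma reaches_square_loop:
  assumes P: "code_at P 0 load_input"
    and Q: "\<And>R'. (\<forall>q. q \<noteq> 5 \<longrightarrow> q \<noteq> 6 \<longrightarrow> R' q = R q) \<Longrightarrow> R' 6 = R 6 + int j * R 2 \<Longrightarrow>
       reaches P (conf 10 R' m) T Q"
    and "R 5 = int j" "R 4 = 1"
  shows "reaches P (conf 5 R m) (4 * j + (T + 2)) Q"
  using assms(2-)
proof (induction j arbitrary: R)
  case 0
  note load = reaches_load[OF P]
  have "reaches P (conf 5 R m) (Suc (Suc T)) Q"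
    apply (rule load, simp, simp add: load_simps 0(2))
    apply (rule load, simp, simp add: load_simps)
    using 0 by simp
  then show ?case by simp
next
  case (Suc j)
  note load = reaches_load[OF P]
  let ?R = "R(6 := R 6 + R 2, 5 := R 5 - 1)"
  have "reaches P (conf 5 ?R m) (4 * j + (T + 2)) Q"
  proof (rule Suc.IH)
    fix R' assume "\<forall>q. q \<noteq> 5 \<longrightarrow> q \<noteq> 6 \<longrightarrow> R' q = ?R q" "R' 6 = ?R 6 + int j * ?R 2"
    then show "reaches P (conf 10 R' m) T Q"
      by (intro Suc.prems(1)) (auto simp: algebra_simps)
  qed (use Suc.prems in auto)
  then have "reaches P (conf 5 R m) (Suc (Suc (Suc (Suc (4 * j + (T + 2)))))) Q"
    apply -
    apply (rule load, simp, simp add: load_simps Suc.prems(2))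
    apply (rule load, simp, simp add: load_simps)
    apply (rule load, simp, simp add: load_simps Suc.prems)
    apply (rule load, simp, simp add: load_simps Suc.prems)
    done
  moreover have "4 * Suc j + (T + 2) = Suc (Suc (Suc (Suc (4 * j + (T + 2)))))" by simp
  ultimately show ?case by (simp only:)
qed

text \<open>Invariant: register 7 represents the entries from \<open>j\<close> on, and the heap
  pointer stays above the matrix. A pass takes ten instructions, leaving the loop takes two.\<close>

lemma reaches_list_loop:
  assumes P: "code_at P 0 load_input"
    and Q: "\<And>R' m'. R' 2 = R 2 \<Longrightarrow> R' 3 = R 3 \<Longrightarrow> R' 4 = 1 \<Longrightarrow> 0 < R' 0 \<Longrightarrow>
       rep m' (R' 0) (enc (map inp [0..<N] :: nat list)) (R' 7) \<Longrightarrow> reaches P (conf 23 R' m') T Q"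
    and "R 6 = int j" "R 4 = 1" "j \<le> N" "int N < R 0" "\<And>a. a < N \<Longrightarrow> m (int a) = int (inp a)"
    and "rep m (R 0) (enc (map inp [j..<N])) (R 7)"
  shows "reaches P (conf 12 R m) (10 * j + (T + 2)) Q"
  using assms(2-)
proof (induction j arbitrary: R m)
  case 0
  note load = reaches_load[OF P]
  have "reaches P (conf 23 R m) T Q" by (rule 0(1)) (use 0 in auto)
  then have "reaches P (conf 12 R m) (Suc (Suc T)) Q"
    apply -
    apply (rule load, simp, simp add: load_simps 0(2))
    apply (rule load, simp, simp add: load_simps)
    done
  then show ?case by simp
next
  case (Suc j)
  note load = reaches_load[OF P]
  let ?h = "R 0"
  let ?m = "m(?h := m (int j), ?h + 1 := R 7)"
  let ?R = "R(6 := int j, 8 := m (int j), 9 := ?h, 0 := ?h + 1 + 1, 7 := ?h)"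
  have h0: "0 < ?h" using Suc.prems(5) by linarith
  have upt: "[j..<N] = j # [Suc j..<N]" using Suc.prems(4) by (simp add: upt_conv_Cons)
  have "reaches P (conf 12 ?R ?m) (10 * j + (T + 2)) Q"
  proof (rule Suc.IH)
    show "rep ?m (?R 0) (enc (map inp [j..<N])) (?R 7)"
      unfolding upt using h0 Suc.prems(4,6) rep_mono[OF Suc.prems(7), of "?h + 1 + 1" ?m] by (simp add: enc_simps)
    show "?m (int a) = int (inp a)" if "a < N" for a using Suc.prems(5,6) that by auto
  qed (use Suc.prems in auto)
  then have "reaches P (conf 12 R m)
      (Suc (Suc (Suc (Suc (Suc (Suc (Suc (Suc (Suc (Suc (10 * j + (T + 2)))))))))))) Q"
    apply -
    apply (rule load, simp, simp add: load_simps Suc.prems(2))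
    apply (rule load, simp, simp add: load_simps Suc.prems(2,3))
    apply (rule load, simp, simp add: load_simps)
    apply (rule load, simp, simp add: load_simps)
    apply (rule load, simp, simp add: load_simps)
    apply (rule load, simp, simp add: load_simps Suc.prems(3))
    apply (rule load, simp, simp add: load_simps)
    apply (rule load, simp, simp add: load_simps Suc.prems(3))
    apply (rule load, simp, simp add: load_simps)
    apply (rule load, simp, simp add: load_simps)
    done
  moreover have "10 * Suc j + (T + 2) = Suc (Suc (Suc (Suc (Suc (Suc (Suc (Suc (Suc (Suc (10 * j + (T + 2)))))))))))" by simp
  ultimately show ?case by (simp only:)
qed

lemma adj_matrix_nonneg: "0 \<le> adj_matrix n E a"
  by (simp add: adj_matrix_def)

lemma reaches_load_input:
  assumes P: "code_at P 0 load_input"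
    and Q: "\<And>R m. 0 < R 0 \<Longrightarrow> rep m (R 0) (enc (n, s, adj_list n E)) (R 1) \<Longrightarrow>
       reaches P (conf 33 R m) T Q"
  shows "reaches P (input_config n E s) (10 * (n * n) + 4 * n + 21 + T) Q"
proof -
  note load = reaches_load[OF P]
  let ?R = "((\<lambda>_. 0)(0 := int n, 1 := s)) :: nat \<Rightarrow> int"
  let ?m = "adj_matrix n E"
  have last: "reaches P (conf 23 R m) (Suc (Suc (Suc (Suc (Suc (Suc (Suc (Suc (Suc (Suc T)))))))))) Q"
    if R: "R 2 = int n" "R 3 = s" "R 4 = 1" "0 < R 0" "rep m (R 0) (enc (adj_list n E)) (R 7)" for R m
  proof -
    let ?h = "R 0"
    let ?m = "m(?h := s, ?h + 1 := R 7, 2 + ?h := int n, 3 + ?h := ?h)"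
    have r: "rep ?m (4 + ?h) (enc (adj_list n E)) (R 7)"
      by (rule rep_mono[OF R(5)]) auto
    show ?thesis
      apply (rule load, simp, simp add: load_simps R)+
      apply (rule Q)
      using R(4) r by (simp_all add: enc_simps add.assoc)
  qed
  let ?T1 = "Suc (Suc (Suc (Suc (Suc (Suc (Suc (Suc (Suc (Suc T)))))))))"
  have mid: "reaches P (conf 10 R ?m) (Suc (Suc (10 * (n * n) + (?T1 + 2)))) Q"
    if R: "R 2 = int n" "R 3 = s" "R 4 = 1" "R 6 = int (n * n)" for R
  proof -
    have "reaches P (conf 12 (R(0 := int (n * n) + 1, 7 := 0)) ?m) (10 * (n * n) + (?T1 + 2)) Q"
    proof (rule reaches_list_loop[OF P, where inp = "\<lambda>a. nat (adj_matrix n E (int a))" and N = "n * n"])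
      fix R' :: "nat \<Rightarrow> int" and m'
      assume "R' 2 = (R(0 := int (n * n) + 1, 7 := 0)) 2" "R' 3 = (R(0 := int (n * n) + 1, 7 := 0)) 3" "R' 4 = 1" "0 < R' 0"
        "rep m' (R' 0) (enc (map (\<lambda>a. nat (adj_matrix n E (int a))) [0..<n * n])) (R' 7)"
      then show "reaches P (conf 23 R' m') ?T1 Q"
        by (intro last) (use R in \<open>simp_all add: adj_list_def\<close>)
    qed (use R in \<open>simp_all add: adj_matrix_nonneg\<close>)
    then show ?thesis
      apply -
      apply (rule load, simp, simp add: load_simps R)
      apply (rule load, simp, simp add: load_simps R)
      done
  qed
  let ?T2 = "Suc (Suc (10 * (n * n) + (?T1 + 2)))"
  have "reaches P (conf 5 (?R(2 := int n, 3 := s, 4 := 1, 5 := int n, 6 := 0)) ?m) (4 * n + (?T2 + 2)) Q"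
  proof (rule reaches_square_loop[OF P])
    fix R' :: "nat \<Rightarrow> int"
    assume a: "\<forall>q. q \<noteq> 5 \<longrightarrow> q \<noteq> 6 \<longrightarrow> R' q = (?R(2 := int n, 3 := s, 4 := 1, 5 := int n, 6 := 0)) q"
      "R' 6 = (?R(2 := int n, 3 := s, 4 := 1, 5 := int n, 6 := 0)) 6 + int n * (?R(2 := int n, 3 := s, 4 := 1, 5 := int n, 6 := 0)) 2"
    show "reaches P (conf 10 R' ?m) ?T2 Q"
      by (rule mid) (use a in simp_all)
  qed simp_all
  then have "reaches P (conf 0 ?R ?m) (Suc (Suc (Suc (Suc (Suc (4 * n + (?T2 + 2))))))) Q"
    apply -
    apply (rule load, simp, simp add: load_simps)
    apply (rule load, simp, simp add: load_simps)
    apply (rule load, simp, simp add: load_simps)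
    apply (rule load, simp, simp add: load_simps)
    apply (rule load, simp, simp add: load_simps)
    apply (simp add: eval_nat_numeral)
    done
  moreover have "Suc (Suc (Suc (Suc (Suc (4 * n + (?T2 + 2)))))) = 10 * (n * n) + 4 * n + 21 + T" by simp
  ultimately show ?thesis unfolding input_config_def by (simp only:)
qed

lemma has_edge_adj_list:
  assumes "u < n" "v < n" shows "has_edge n (adj_list n E) u v \<longleftrightarrow> {u, v} \<in> E"
proof -
  have "u * n + v < Suc u * n" using assms(2) by simp
  also have "\<dots> \<le> n * n" using assms(1) by (intro mult_right_mono) auto
  finally have lt: "u * n + v < n * n" .
  have "i = u \<and> j = v" if "j < n" "u * n + v = i * n + j" for i j
  proof -
    have "(u * n + v) div n = u" "(u * n + v) mod n = v" "(i * n + j) div n = i" "(i * n + j) mod n = j"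
      using assms(2) that(1) by simp_all
    then show ?thesis using that(2) by metis
  qed
  then have "(\<exists>i<n. \<exists>j<n. int (u * n + v) = int (i * n + j) \<and> {i, j} \<in> E) \<longleftrightarrow> {u, v} \<in> E"
    using assms unfolding of_nat_eq_iff by blast
  then have "adj_matrix n E (int (u * n + v)) = (if {u, v} \<in> E then 1 else 0)"
    unfolding adj_matrix_def by (simp only:)
  then show ?thesis unfolding has_edge_def using lt by (simp add: lookup_nth adj_list_def)
qed

section \<open>The size threshold and the final time bound\<close>

lemma threshold_bounds:
  assumes "2 \<le> q" "0 < n"
  shows "q ^ threshold q n \<le> n \<and> n < q ^ Suc (threshold q n)"
proof -
  let ?r = "\<lambda>N. fold (\<lambda>j a. if q ^ j \<le> n then j else a) [0..<N] 0"
  have r: "q ^ ?r N \<le> n \<and> (\<forall>j<N. q ^ j \<le> n \<longrightarrow> j \<le> ?r N)" for N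
    using assms(2) by (induction N) (auto simp: less_Suc_eq)
  have "n < q ^ Suc (?r n)"
  proof (rule ccontr)
    assume "\<not> n < q ^ Suc (?r n)"
    then have le: "q ^ Suc (?r n) \<le> n" by simp
    have "Suc (?r n) < 2 ^ Suc (?r n)" by (rule less_exp)
    also have "\<dots> \<le> q ^ Suc (?r n)" using assms(1) by (rule power_mono) simp
    finally have "Suc (?r n) < n" using le by linarith
    then show False using r[of n] le by fastforce
  qed
  then show ?thesis unfolding threshold_def using r[of n] by blast
qed

lemma threshold_le: "2 \<le> q \<Longrightarrow> threshold q n \<le> n"
proof (cases "n = 0")
  case False
  assume q: "2 \<le> q"
  have "threshold q n < 2 ^ threshold q n" by (rule less_exp)
  also have "\<dots> \<le> q ^ threshold q n" using q by (rule power_mono) simp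
  also have "\<dots> \<le> n" using threshold_bounds[OF q] False by simp
  finally show ?thesis by simp
qed (simp add: threshold_def)

lemma poly_boundedD: "poly_bounded \<tau> \<Longrightarrow> \<exists>K d. 0 < K \<and> (\<forall>B. \<tau> B \<le> K * (B + 1) ^ d)"
  unfolding poly_bounded_def by (metis le_trans mult_le_mono1 less_Suc_eq_0_disj le_SucI order_refl zero_less_Suc)

theorem theorem2:
  fixes k :: nat
  assumes "k > 0"
  shows "\<exists>P f. f \<in> O(\<lambda>n. real n / log 2 (real n)) \<and>
               solves_in_time P (MSPD k) (\<lambda>n. 2 powr f n)"
proof -
  define S where "S = Suc k * 2 ^ Suc k * 2 ^ Suc k"
  \<comment> \<open>\<open>S\<close> is the alphabet size. Because of \<open>S <= 2 ^ S\<close>,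
    this base makes \<open>S ^ m n\<close> at most \<open>sqrt n\<close> for positive
    \<open>n\<close>.\<close>
  define q :: nat where "q = 2 ^ (2 * S)"
  define m where "m = threshold q"
  define c where "c = q + Suc k + 3"
  define e where "e = 2 * k + 4"
  \<comment> \<open>A single bound for all loop lengths of the search. In the exponent,
    \<open>2 * m n\<close> accounts for the swap lists, the power of \<open>S\<close> for the counts
    per type, and \<open>e\<close> for polynomial factors, the largest being
    \<open>Suc n ^ (2 * k + 2)\<close> for a level times the bag lists. The factor \<open>c\<close>
    covers \<open>q\<close>, \<open>Suc k\<close> and 2.\<close>
  define W where "W = (\<lambda>n. c * Suc n ^ (e + 2 * m n + S ^ Suc (m n)) * 2 ^ (n div Suc (m n)))"
  have S0: "0 < S" "S \<le> 2 ^ S" unfolding S_def by (simp, rule less_imp_le, rule less_exp)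
  have q2: "2 \<le> q" unfolding q_def using S0(1) power_increasing[of 1 "2 * S" "2::nat"] by simp
  have search: "search n (\<lambda>u v. {u, v} \<in> E) k (adj_list n E) (swap_lists q n) (bag_lists k n) (m n)"
    if "simple_graph {..<n} E" for n E
  proof
    show "{u, v} \<in> E \<Longrightarrow> {v, u} \<in> E" for u v by (simp add: insert_commute)
    show "{v, v} \<notin> E" for v using that unfolding simple_graph_def by force
    show "has_edge n (adj_list n E) u v \<longleftrightarrow> {u, v} \<in> E" if "u < n" "v < n" for u v
      using has_edge_adj_list that by blast
    show "set (swap_lists q n) = {ps. length ps = m n \<and> set ps \<subseteq> {..<n} \<times> {..<n}}"
    proof -
      have "set (concat (map (\<lambda>u. map (\<lambda>v. (u, v)) [0..<n]) [0..<n])) = {..<n} \<times> {..<n}" by auto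
      then show ?thesis unfolding swap_lists_def m_def set_n_lists by simp
    qed
    show "set (bag_lists k n) = {bs. length bs = Suc k \<and> set bs \<subseteq> {..n}}"
      unfolding bag_lists_def set_n_lists by (simp only: set_upt atLeast0LessThan lessThan_Suc_atMost)
  qed
  let ?N = "\<lambda>n. Suc n ^ Suc k * (2 ^ (n div Suc (m n)) * Suc n ^ (S ^ Suc (m n)))"
  have W: "n * n \<le> W n" "Suc (n + n) \<le> W n" "q \<le> W n" "m n \<le> W n" "Suc k \<le> W n" "Suc n ^ Suc k \<le> W n"
    "\<forall>j\<le>m n. (n * n) ^ j \<le> W n" "n \<le> W n"
    "?N n * Suc n ^ Suc k \<le> W n" for n
  proof -
    have c: "1 \<le> c" "q \<le> c" "Suc k \<le> c" "2 \<le> c" unfolding c_def by auto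
    have WI: "x * Suc n ^ i * 2 ^ j \<le> W n"
      if "x \<le> c" "i \<le> e + 2 * m n + S ^ Suc (m n)" "j \<le> n div Suc (m n)" for x i j
      unfolding W_def using that by (intro mult_le_mono power_increasing) auto
    show "q \<le> W n" "Suc k \<le> W n" using WI[of q 0 0] WI[of "Suc k" 0 0] c by auto
    have 2: "Suc n ^ 2 \<le> W n" using WI[of 1 2 0] c unfolding e_def by auto
    show "n * n \<le> W n" by (rule le_trans[OF _ 2]) (simp add: power2_eq_square)
    show "n \<le> W n" by (rule le_trans[OF _ 2]) (simp add: power2_eq_square)
    then show "m n \<le> W n" using threshold_le[OF q2, of n] unfolding m_def by linarith
    show "Suc (n + n) \<le> W n" using WI[of 2 1 0] c unfolding e_def by auto
    show "Suc n ^ Suc k \<le> W n" using WI[of 1 "Suc k" 0] c unfolding e_def by auto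
    show "\<forall>j\<le>m n. (n * n) ^ j \<le> W n"
    proof (intro allI impI)
      fix j assume j: "j \<le> m n"
      have "(n * n) ^ j \<le> (Suc n ^ 2) ^ j" by (intro power_mono) (auto simp: power2_eq_square)
      also have "\<dots> = Suc n ^ (2 * j)" by (simp only: power_mult)
      also have "\<dots> \<le> W n" using WI[of 1 "2 * j" 0] c j by simp
      finally show "(n * n) ^ j \<le> W n" .
    qed
    have "?N n * Suc n ^ Suc k =
      1 * Suc n ^ (Suc k + Suc k + S ^ Suc (m n)) * 2 ^ (n div Suc (m n))"
      by (simp only: power_add mult_ac mult_1)
    also have "\<dots> \<le> W n" by (rule WI) (use c in \<open>auto simp: e_def\<close>)
    finally show "?N n * Suc n ^ Suc k \<le> W n" .
  qed
  define D where "D = (\<lambda>B (x :: nat \<times> int \<times> nat list). \<exists>n s E. simple_graph {..<n} E \<and> x = (n, s, adj_list n E) \<and> W n \<le> B)"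
  have "ram D (decide k q)"
  proof (rule ram_decide, goal_cases)
    case (1 B x)
    then obtain n s E where x: "simple_graph {..<n} E" "x = (n, s, adj_list n E)" "W n \<le> B" unfolding D_def by blast
    interpret search n "\<lambda>u v. {u, v} \<in> E" k "adj_list n E" "swap_lists q n" "bag_lists k n" "m n" by (rule search[OF x(1)])
    have state: "state_bound (m n) = ?N n"
      unfolding state_bound_def alphabet_size_def S_def ..
    have lv: "length (lvl j) * Suc n ^ Suc k \<le> B" for j
      using mult_le_mono1[OF length_level[of j], of "Suc n ^ Suc k"] W(9)[of n] x(3) unfolding state by linarith
    have "length (lvl j) * 1 \<le> length (lvl j) * Suc n ^ Suc k" for j
      by (rule mult_le_mono2, rule one_le_power) simp
    then have b9: "length (lvl j) \<le> B" for j using lv[of j] by (metis le_trans mult_1_right)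
    have b11: "length \<sigma> \<le> B" if "\<sigma> \<in> set (lvl j)" for \<sigma> j using level_sound[of j] that W(8)[of n] x(3) by auto
    have b2: "length (adj_list n E) \<le> B" using le_trans[OF W(1) x(3)] by (simp add: adj_list_def)
    have b6: "(n * n) ^ j \<le> B" if "j \<le> threshold q n" for j
      using W(7)[of n] that le_trans[OF _ x(3)] unfolding m_def by blast
    note b = W(1-6)[of n, THEN le_trans, OF x(3), unfolded m_def]
    show ?case
      unfolding x(2) fst_conv snd_conv
      by (intro conjI allI impI ballI) (rule b(1), rule b2, rule b(2), rule b(3), rule b(4), erule b6, rule b(5), rule b(6),
          rule b9, rule lv, erule b11)
  qed
  then obtain code l \<tau> where \<tau>: "poly_bounded \<tau>" "implements code l \<tau> D (decide k q)" unfolding ram_def by blast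
  \<comment> \<open>Register 0 is the heap pointer while the code works on register 1. The final
    copy delivers the answer, and the program halts by running past its end.\<close>
  define P where "P = load_input @ code 1 33 @ [Copy 0 1]"
  have P: "code_at P 0 load_input" "code_at P 33 (code 1 33)" "33 + l < length P" "P ! (33 + l) = Copy 0 1" "length P = 34 + l"
    using implements_length[OF \<tau>(2), of 1 33] unfolding P_def code_at_def
    by (auto simp: length_load_input nth_append intro: exI[of _ load_input])
  have run: "reaches P (input_config n E s) (10 * W n + 4 * W n + 21 + (\<tau> (W n) + Suc 0))
      (\<lambda>\<sigma>. halted P \<sigma> \<and> reg \<sigma> 0 = (if MSPD k {..<n} E s then 1 else 0))" (is "reaches _ _ _ ?Q")
    if g: "simple_graph {..<n} E" for n E s
  proof -
    interpret search n "\<lambda>u v. {u, v} \<in> E" k "adj_list n E" "swap_lists q n" "bag_lists k n" "m n" by (rule search[OF g])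
    have ans: "decide k q (n, s, adj_list n E) = (if MSPD k {..<n} E s then 1 else 0)"
    proof -
      have "{u, v} \<in> E \<longleftrightarrow> u < n \<and> v < n \<and> {u, v} \<in> E" for u v using g unfolding simple_graph_def by blast
      from MSPD_iff_sweep[OF this, of s] show ?thesis unfolding decide_def Let_def fst_conv snd_conv level_full_iff by simp
    qed
    have "reaches P (input_config n E s) (10 * (n * n) + 4 * n + 21 + (\<tau> (W n) + Suc 0)) ?Q"
    proof (rule reaches_load_input[OF P(1)])
      fix R :: "nat \<Rightarrow> int" and mm
      assume h: "0 < R 0" "rep mm (R 0) (enc (n, s, adj_list n E)) (R 1)"
      show "reaches P (conf 33 R mm) (\<tau> (W n) + Suc 0) ?Q"
      proof (rule reaches_call[OF \<tau>(2) P(2) _ h(2) _ h(1)])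
        show "D (W n) (n, s, adj_list n E)" using g unfolding D_def by blast
        fix R' :: "nat \<Rightarrow> int" and m' assume "rep m' (R' 0) (enc (decide k q (n, s, adj_list n E))) (R' 1)"
        then have v: "R' 1 = (if MSPD k {..<n} E s then 1 else 0)" unfolding ans by (simp add: enc_simps)
        show "reaches P (conf (33 + l) R' m') (Suc 0) ?Q"
          by (rule reaches_step[OF P(3,4)], unfold exec_config, rule reaches_refl) (use v in \<open>simp add: halted_def P(5)\<close>)
      qed simp
    qed
    then show ?thesis
    proof (rule reaches_trans[where T' = 0, OF _ reaches_refl])
      show "10 * (n * n) + 4 * n + 21 + (\<tau> (W n) + Suc 0) + 0 \<le> 10 * W n + 4 * W n + 21 + (\<tau> (W n) + Suc 0)"
        using W(1,8)[of n] by linarith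
    qed
  qed
  have "poly_bounded (\<lambda>B. 10 * B + 4 * B + 21 + (\<tau> B + Suc 0))" by (intro poly_bounded_intros \<tau>(1))
  then obtain K d where K: "0 < K" "\<And>B. 10 * B + 4 * B + 21 + (\<tau> B + Suc 0) \<le> K * (B + 1) ^ d"
    using poly_boundedD by blast
  \<comment> \<open>With the logarithm of the step bound as \<open>f\<close>,
    \<open>2 powr f n\<close> is that bound itself, valid for every \<open>n\<close> and not only
    asymptotically.\<close>
  define f where "f = (\<lambda>n. log 2 (real (K * (W n + 1) ^ d)))"
  have "f \<in> O(\<lambda>n. real n / log 2 (real n))"
    unfolding f_def W_def
  proof (rule work_bound_asymptotics[OF S0(2,1) K(1)])
    show "0 < c" unfolding c_def by simp
    show "(2 ^ (2 * S)) ^ m n \<le> n \<and> n < (2 ^ (2 * S)) ^ Suc (m n)" if "0 < n" for n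
      using threshold_bounds[OF q2 that] unfolding m_def q_def by blast
  qed
  moreover have "solves_in_time P (MSPD k) (\<lambda>n. 2 powr f n)"
    unfolding solves_in_time_def
  proof (intro allI impI)
    fix n :: nat and E s assume "simple_graph {..<n} E"
    from run[OF this, of s] obtain t where t: "t \<le> 10 * W n + 4 * W n + 21 + (\<tau> (W n) + Suc 0)"
      "halted P ((step P ^^ t) (input_config n E s))"
      "reg ((step P ^^ t) (input_config n E s)) 0 = (if MSPD k {..<n} E s then 1 else 0)"
      unfolding reaches_def by blast
    have "t \<le> K * (W n + 1) ^ d" using t(1) K(2)[of "W n"] by linarith
    moreover have "0 < K * (W n + 1) ^ d" using K(1) by simp
    ultimately have "real t \<le> 2 powr f n" unfolding f_def 
      by (subst powr_log_cancel) (simp, simp, simp only: of_nat_0_less_iff, simp only: of_nat_le_iff)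
    then show "\<exists>t \<sigma>. real t \<le> 2 powr f n \<and> \<sigma> = (step P ^^ t) (input_config n E s) \<and> halted P \<sigma> \<and>
        reg \<sigma> 0 = (if MSPD k {..<n} E s then 1 else 0)"
      using t(2,3) by blast
  qed
  ultimately show ?thesis by blast
qed

end
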